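(* Let $n\ge2$, let $\Omega$ be a bounded Lipschitz domain in $\mathbb{R}^{n}$, let $0\le k_{i}<k_{*}$ and $f_{i}\in L^{\infty}(\Omega)$ for all $i=1,\dots,m$. If $\mathbf{u}_{*}=(u_{*,1},\dots,u_{*,m})$ is a segregated ground state of the energy functional $\mathcal{J}_{\mathbf{k}}$, i.e. a minimizer of the functional $\mathcal{J}_{\mathbf{k}}$ in $\mathbb{S}_{m}(\Omega)$, then for all $i\ne j$ $$\Delta(u_{*,i}-u_{*,j})+k_{i}^{2}u_{*,i}-k_{j}^{2}u_{*,j}=-f_{i}\chi_{\{u_{*,i}>0\}}+f_{j}\chi_{\{u_{*,j}>0\}}\quad\text{in }\Omega\setminus\bigcup_{\ell\ne i,j}\overline{\Omega_{\ell}},$$ where $\Omega_{i}=\{u_{*,i}>0\}$ for all $i=1,\dots,m$.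
   Context: $\mathbf{k}=(k_{1},\dots,k_{m})$. For $\mathbf{u}=(u_{1},\dots,u_{m})\in(H^{1}(\Omega))^{m}$, $$\mathcal{J}_{\mathbf{k}}(\mathbf{u}):=\sum_{i=1}^{m}\mathcal{J}_{k_{i}}(u_{i}),\qquad \mathcal{J}_{k_{i}}(u_{i}):=\int_{\Omega}\left(|\nabla u_{i}|^{2}-k_{i}^{2}|u_{i}|^{2}-2f_{i}u_{i}\right)dx.$$ The set of segregated states is $$\mathbb{S}_{m}(\Omega):=\left\{(u_{1},\dots,u_{m})\in(H_{0}^{1}(\Omega))^{m}: u_{i}\ge 0\text{ for all }i,\ u_{i}\cdot u_{j}=0\text{ for all }i\neq j\right\}.$$ The number $k_{*}=k_{*}(\Omega)>0$ is given by the first Dirichlet eigenvalue: $$k_{*}^{2}:=\inf_{\phi\in C_{c}^{\infty}(\Omega),\,\phi\not\equiv0}\frac{\|\nabla\phi\|_{L^{2}(\Omega)}^{2}}{\|\phi\|_{L^{2}(\Omega)}^{2}}.$$ Convention: $\{v>0\}:=\mathbb{R}^{n}\setminus\{v\le0\}$. The equation is understood in the sense of distributions. *)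

theory Defs
  imports "HOL-Analysis.Analysis"
begin

text \<open>
  Elements of Lebesgue and Sobolev spaces are represented by honest functions on the whole of
  \<open>real^'n\<close>; they are not quotiented by equality almost everywhere.
\<close>

section \<open>Smooth functions and test functions\<close>

definition partial_deriv :: "'n \<Rightarrow> (real^'n \<Rightarrow> real) \<Rightarrow> real^'n \<Rightarrow> real" where
  "partial_deriv i f x = frechet_derivative f (at x) (axis i 1)"

definition classical_grad :: "(real^'n \<Rightarrow> real) \<Rightarrow> real^'n \<Rightarrow> real^'n" where
  "classical_grad f x = (\<chi> i. partial_deriv i f x)"

definition laplacian :: "(real^'n \<Rightarrow> real) \<Rightarrow> real^'n \<Rightarrow> real" where
  "laplacian f x = (\<Sum>i\<in>UNIV. partial_deriv i (partial_deriv i f) x)"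

primrec Ck :: "nat \<Rightarrow> (real^'n \<Rightarrow> real) \<Rightarrow> bool" where
  "Ck 0 f \<longleftrightarrow> continuous_on UNIV f"
| "Ck (Suc k) f \<longleftrightarrow> (\<forall>x. f differentiable (at x)) \<and> (\<forall>i. Ck k (partial_deriv i f))"

definition test_functions :: "(real^'n) set \<Rightarrow> (real^'n \<Rightarrow> real) set" where
  "test_functions U = {\<phi>. (\<forall>k. Ck k \<phi>) \<and>
     compact (closure {x. \<phi> x \<noteq> 0}) \<and> closure {x. \<phi> x \<noteq> 0} \<subseteq> U}"

section \<open>Distributions\<close>

text \<open>Distributions on \<open>U\<close> are represented by functionals on test functions, compared only on
  \<open>test_functions U\<close>.\<close>

definition regular_distribution ::
    "(real^'n) set \<Rightarrow> (real^'n \<Rightarrow> real) \<Rightarrow> (real^'n \<Rightarrow> real) \<Rightarrow> real" where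
  "regular_distribution U w \<phi> = integral\<^sup>L (lebesgue_on U) (\<lambda>x. w x * \<phi> x)"

definition distribution_laplacian ::
    "((real^'n \<Rightarrow> real) \<Rightarrow> real) \<Rightarrow> (real^'n \<Rightarrow> real) \<Rightarrow> real" where
  "distribution_laplacian T \<phi> = T (laplacian \<phi>)"

section \<open>Lebesgue and Sobolev spaces\<close>

definition L2_space :: "(real^'n) set \<Rightarrow> (real^'n \<Rightarrow> 'b::euclidean_space) set" where
  "L2_space \<Omega> = {f. f \<in> borel_measurable (lebesgue_on \<Omega>) \<and>
     integrable (lebesgue_on \<Omega>) (\<lambda>x. (norm (f x))\<^sup>2)}"

definition L2_norm :: "(real^'n) set \<Rightarrow> (real^'n \<Rightarrow> 'b::euclidean_space) \<Rightarrow> real" where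
  "L2_norm \<Omega> f = sqrt (integral\<^sup>L (lebesgue_on \<Omega>) (\<lambda>x. (norm (f x))\<^sup>2))"

definition Linf_space :: "(real^'n) set \<Rightarrow> (real^'n \<Rightarrow> real) set" where
  "Linf_space \<Omega> = {f. f \<in> borel_measurable (lebesgue_on \<Omega>) \<and>
     (\<exists>C. AE x in lebesgue_on \<Omega>. \<bar>f x\<bar> \<le> C)}"

definition is_weak_grad ::
    "(real^'n) set \<Rightarrow> (real^'n \<Rightarrow> real) \<Rightarrow> (real^'n \<Rightarrow> real^'n) \<Rightarrow> bool" where
  "is_weak_grad \<Omega> u G \<longleftrightarrow> (\<forall>\<phi>\<in>test_functions \<Omega>. \<forall>i.
     integral\<^sup>L (lebesgue_on \<Omega>) (\<lambda>x. u x * partial_deriv i \<phi> x)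
       = - integral\<^sup>L (lebesgue_on \<Omega>) (\<lambda>x. G x $ i * \<phi> x))"

definition H1_space :: "(real^'n) set \<Rightarrow> (real^'n \<Rightarrow> real) set" where
  "H1_space \<Omega> = {u \<in> L2_space \<Omega>. \<exists>G\<in>L2_space \<Omega>. is_weak_grad \<Omega> u G}"

text \<open>The weak gradient is determined only up to a null set; every use below is insensitive to
  the representative chosen.\<close>

definition weak_grad :: "(real^'n) set \<Rightarrow> (real^'n \<Rightarrow> real) \<Rightarrow> real^'n \<Rightarrow> real^'n" where
  "weak_grad \<Omega> u = (SOME G. G \<in> L2_space \<Omega> \<and> is_weak_grad \<Omega> u G)"

definition H1_norm :: "(real^'n) set \<Rightarrow> (real^'n \<Rightarrow> real) \<Rightarrow> real" where
  "H1_norm \<Omega> u = sqrt ((L2_norm \<Omega> u)\<^sup>2 + (L2_norm \<Omega> (weak_grad \<Omega> u))\<^sup>2)"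

text \<open>Closure of the test functions in the \<open>H\<^sup>1\<close> norm; elements are extended by zero outside
  \<open>\<Omega>\<close>.\<close>

definition H10_space :: "(real^'n) set \<Rightarrow> (real^'n \<Rightarrow> real) set" where
  "H10_space \<Omega> = {u \<in> H1_space \<Omega>. (\<forall>x. x \<notin> \<Omega> \<longrightarrow> u x = 0) \<and>
     (\<exists>\<phi>. (\<forall>j::nat. \<phi> j \<in> test_functions \<Omega>) \<and>
          (\<lambda>j. H1_norm \<Omega> (\<lambda>x. u x - \<phi> j x)) \<longlonglongrightarrow> 0)}"

section \<open>Bounded Lipschitz domains\<close>

text \<open>Near each boundary point, \<open>\<Omega>\<close> lies above the graph of a Lipschitz function
  \<open>\<gamma>\<close> over the hyperplane orthogonal to a unit vector \<open>\<nu>\<close> (the last coordinate direction after a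
  rotation); \<open>x - (x \<bullet> \<nu>) *\<^sub>R \<nu>\<close> is the projection of \<open>x\<close> to that hyperplane.\<close>

definition lipschitz_boundary :: "(real^'n) set \<Rightarrow> bool" where
  "lipschitz_boundary \<Omega> \<longleftrightarrow> (\<forall>x0\<in>frontier \<Omega>. \<exists>r>0. \<exists>\<nu> \<gamma> L.
     norm \<nu> = 1 \<and> L-lipschitz_on {y. y \<bullet> \<nu> = 0} (\<gamma> :: real^'n \<Rightarrow> real) \<and>
     \<Omega> \<inter> ball x0 r = {x \<in> ball x0 r. x \<bullet> \<nu> > \<gamma> (x - (x \<bullet> \<nu>) *\<^sub>R \<nu>)})"

definition bounded_lipschitz_domain :: "(real^'n) set \<Rightarrow> bool" where
  "bounded_lipschitz_domain \<Omega> \<longleftrightarrow>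
     open \<Omega> \<and> connected \<Omega> \<and> \<Omega> \<noteq> {} \<and> bounded \<Omega> \<and> lipschitz_boundary \<Omega>"

section \<open>The energy and its segregated ground states\<close>

text \<open>Tuples \<open>(u\<^sub>1,\<dots>,u\<^sub>m)\<close> are functions on \<open>nat\<close> of which only the values at \<open>{1..m}\<close> matter.\<close>

definition k_star :: "(real^'n) set \<Rightarrow> real" where
  "k_star \<Omega> = sqrt (Inf {(L2_norm \<Omega> (classical_grad \<phi>))\<^sup>2 / (L2_norm \<Omega> \<phi>)\<^sup>2 | \<phi>.
     \<phi> \<in> test_functions \<Omega> \<and> (\<exists>x. \<phi> x \<noteq> 0)})"

definition energy1 ::
    "(real^'n) set \<Rightarrow> real \<Rightarrow> (real^'n \<Rightarrow> real) \<Rightarrow> (real^'n \<Rightarrow> real) \<Rightarrow> real" where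
  "energy1 \<Omega> k f u = integral\<^sup>L (lebesgue_on \<Omega>)
     (\<lambda>x. (norm (weak_grad \<Omega> u x))\<^sup>2 - k\<^sup>2 * \<bar>u x\<bar>\<^sup>2 - 2 * f x * u x)"

definition energy ::
    "(real^'n) set \<Rightarrow> nat \<Rightarrow> (nat \<Rightarrow> real) \<Rightarrow> (nat \<Rightarrow> real^'n \<Rightarrow> real) \<Rightarrow>
      (nat \<Rightarrow> real^'n \<Rightarrow> real) \<Rightarrow> real" where
  "energy \<Omega> m k f u = (\<Sum>i\<in>{1..m}. energy1 \<Omega> (k i) (f i) (u i))"

definition segregated_states :: "(real^'n) set \<Rightarrow> nat \<Rightarrow> (nat \<Rightarrow> real^'n \<Rightarrow> real) set" where
  "segregated_states \<Omega> m = {u.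
     (\<forall>i\<in>{1..m}. u i \<in> H10_space \<Omega>) \<and>
     (\<forall>i\<in>{1..m}. AE x in lebesgue_on \<Omega>. u i x \<ge> 0) \<and>
     (\<forall>i\<in>{1..m}. \<forall>j\<in>{1..m}. i \<noteq> j \<longrightarrow> (AE x in lebesgue_on \<Omega>. u i x * u j x = 0))}"

definition segregated_ground_state ::
    "(real^'n) set \<Rightarrow> nat \<Rightarrow> (nat \<Rightarrow> real) \<Rightarrow> (nat \<Rightarrow> real^'n \<Rightarrow> real) \<Rightarrow>
      (nat \<Rightarrow> real^'n \<Rightarrow> real) \<Rightarrow> bool" where
  "segregated_ground_state \<Omega> m k f u \<longleftrightarrow> u \<in> segregated_states \<Omega> m \<and>
     (\<forall>v\<in>segregated_states \<Omega> m. energy \<Omega> m k f u \<le> energy \<Omega> m k f v)"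

text \<open>This set, and above all its closure, depends on the representative of \<open>v\<close>. A claim about
  every function in \<open>H10_space \<Omega>\<close> is a claim about every representative, including those for which
  the closure is smallest.\<close>

definition positivity_set :: "(real^'n \<Rightarrow> real) \<Rightarrow> (real^'n) set" where
  "positivity_set v = UNIV - {x. v x \<le> 0}"

end

theory Submission
  imports Defs
begin

text \<open>
  Fix \<open>i \<noteq> j\<close>, put \<open>w = u\<^sub>i - u\<^sub>j\<close>, and let \<open>\<phi>\<close> be a test function off the closed supports of the other
  components. The positive and negative parts of \<open>w + t \<phi>\<close> are an admissible replacement for
  \<open>(u\<^sub>i, u\<^sub>j)\<close>, and letting \<open>t\<close> tend to \<open>0\<close> gives \<open>\<bar>L \<phi>\<bar> \<le> C \<integral>\<^bsub>{w = 0}\<^esub> \<bar>\<phi>\<bar>\<close> for the linear functional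
  \<open>L\<close> that measures the failure of the equation; the error comes from the kinks of
  \<open>f\<^sub>i w\<^sup>+ + f\<^sub>j w\<^sup>-\<close> at \<open>w = 0\<close>. In particular \<open>\<Delta> w\<close> is locally square integrable, so that \<open>w\<close> is
  locally in \<open>H\<^sup>2\<close>. The gradient of a Sobolev function vanishes almost everywhere on its zero set;
  applied to \<open>w\<close> and to its derivatives, this shows that \<open>\<Delta> w\<close> vanishes almost everywhere on
  \<open>{w = 0}\<close>, as do the remaining terms of \<open>L\<close>, whence \<open>L = 0\<close>.

  The \<open>H\<^sup>2\<close> regularity uses neither mollifiers nor weak compactness: the difference quotients of \<open>w\<close>
  are bounded in \<open>H\<^sup>1\<close>, and elements of nearly minimal norm in convex sets around their tails
  converge strongly to a derivative of \<open>w\<close>.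
\<close>

section \<open>Smooth functions\<close>

text \<open>Neither component can be varied alone: \<open>{u\<^sub>i > 0}\<close> is merely
  measurable, depends on the representative and need not contain a ball. The difference w can be
  varied with either sign, and it determines both components almost everywhere. Disjointness removes
  the mixed gradient term, so the Dirichlet energies of the pair add up to that of w. The squares in
  the energy carry the sign -k^2, and convexity of the squared positive part gives them an estimate
  without error. The f terms are different: at w = 0 their one-sided derivative is
  \<open>f\<^sub>i \<phi>\<^sup>+ + f\<^sub>j \<phi>\<^sup>-\<close>, which is not linear in \<phi>,
  so an error of first order survives when {w = 0} has positive measure. The resulting bound on L is
  used twice: it gives the regularity of w, and it confines L to {w = 0}. Difference quotients need
  translations, so the analysis takes place on the whole space: a function is paired with its
  gradient as a common limit of test functions. The localisation \<eta> w fits this setting, and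
  product rule, chain rule and integration by parts pass to such pairs from smooth
  functions.\<close>

lemma partial_deriv_eq:
  "(f has_derivative f') (at x) \<Longrightarrow> partial_deriv i f x = f' (axis i 1)"
  unfolding partial_deriv_def using frechet_derivative_at by metis

lemma partial_deriv_add:
  assumes "f differentiable at x" "g differentiable at x"
  shows "partial_deriv i (\<lambda>x. f x + g x) x = partial_deriv i f x + partial_deriv i g x"
  by (rule partial_deriv_eq[OF has_derivative_add, OF assms[unfolded frechet_derivative_works],
      unfolded partial_deriv_def[symmetric]])

lemma partial_deriv_mult:
  assumes "f differentiable at x" "g differentiable at x"
  shows "partial_deriv i (\<lambda>x. f x * g x) x = f x * partial_deriv i g x + partial_deriv i f x * g x"
  by (rule partial_deriv_eq[OF has_derivative_mult, OF assms[unfolded frechet_derivative_works],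
      unfolded partial_deriv_def[symmetric]])

lemma partial_deriv_const [simp]: "partial_deriv i (\<lambda>x. c) = (\<lambda>x. 0)"
  by (rule ext, rule partial_deriv_eq) (rule has_derivative_const)

lemma partial_deriv_compose:
  assumes "(h has_real_derivative h') (at (f x))" "f differentiable at x"
  shows "(\<lambda>x. h (f x)) differentiable at x"
    and "partial_deriv i (\<lambda>x. h (f x)) x = h' * partial_deriv i f x"
proof -
  have "((\<lambda>x. h (f x)) has_derivative (\<lambda>y. frechet_derivative f (at x) y * h')) (at x)"
    using DERIV_compose_FDERIV[of h h' f x] assms by (simp add: frechet_derivative_works)
  then show "(\<lambda>x. h (f x)) differentiable at x"
    "partial_deriv i (\<lambda>x. h (f x)) x = h' * partial_deriv i f x"
    using partial_deriv_eq[of "\<lambda>x. h (f x)"]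
    by (auto simp: differentiable_def partial_deriv_def[of i f])
qed

lemma partial_deriv_translate:
  assumes "f differentiable at (x + a)"
  shows "partial_deriv i (\<lambda>x. f (x + a)) x = partial_deriv i f (x + a)"
    and "(\<lambda>x. f (x + a)) differentiable at x"
proof -
  have "((\<lambda>x. f (x + a)) has_derivative frechet_derivative f (at (x + a))) (at x)"
    using has_derivative_compose[of "\<lambda>x. x + a" "\<lambda>y. y" x UNIV f] assms[unfolded frechet_derivative_works]
      has_derivative_add_const[OF has_derivative_ident] by blast
  then show "partial_deriv i (\<lambda>x. f (x + a)) x = partial_deriv i f (x + a)"
    and "(\<lambda>x. f (x + a)) differentiable at x"
    using partial_deriv_eq[of "\<lambda>x. f (x + a)"]
    by (auto simp: differentiable_def partial_deriv_def[of i f])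
qed

section \<open>Closure properties of C^k functions\<close>

lemma Ck_SucD: "Ck (Suc k) f \<Longrightarrow> Ck k f"
proof (induction k arbitrary: f)
  case 0
  then show ?case
    by (auto simp: differentiable_imp_continuous_within intro!: continuous_at_imp_continuous_on)
qed simp

lemma Ck_const [simp]: "Ck k (\<lambda>x. c)"
  by (induction k arbitrary: c) auto

lemma Ck_add: "Ck k f \<Longrightarrow> Ck k g \<Longrightarrow> Ck k (\<lambda>x. f x + g x)"
proof (induction k arbitrary: f g)
  case 0 then show ?case by (auto intro: continuous_intros)
next
  case (Suc k)
  then have "partial_deriv i (\<lambda>x. f x + g x) = (\<lambda>x. partial_deriv i f x + partial_deriv i g x)" for i
    by (auto simp: partial_deriv_add)
  with Suc show ?case by auto
qed

lemma Ck_mult: "Ck k f \<Longrightarrow> Ck k g \<Longrightarrow> Ck k (\<lambda>x. f x * g x)"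
proof (induction k arbitrary: f g)
  case 0 then show ?case by (auto intro: continuous_intros)
next
  case (Suc k)
  then have "partial_deriv i (\<lambda>x. f x * g x) =
      (\<lambda>x. f x * partial_deriv i g x + partial_deriv i f x * g x)" for i
    by (auto simp: partial_deriv_mult)
  with Suc show ?case
    by (auto intro!: Ck_add Suc.IH Ck_SucD[OF Suc.prems(1)] Ck_SucD[OF Suc.prems(2)])
qed

lemma Ck_bounded_linear:
  assumes "bounded_linear f"
  shows "Ck k f"
proof (cases k)
  case 0
  then show ?thesis using assms by (auto intro: linear_continuous_on)
next
  case (Suc n)
  have "partial_deriv i f = (\<lambda>x. f (axis i 1))" for i
    using bounded_linear_imp_has_derivative[OF assms] by (auto simp: partial_deriv_eq)
  then show ?thesis
    using Suc bounded_linear_imp_differentiable[OF assms] by auto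
qed

lemma Ck_translate: "Ck k f \<Longrightarrow> Ck k (\<lambda>x. f (x + a))"
proof (induction k arbitrary: f)
  case 0
  then show ?case by (auto intro!: continuous_on_compose2[of UNIV f] continuous_intros)
next
  case (Suc k)
  then have "partial_deriv i (\<lambda>x. f (x + a)) = (\<lambda>x. partial_deriv i f (x + a))" for i
    by (auto simp: partial_deriv_translate)
  with Suc show ?case by (auto simp: partial_deriv_translate)
qed

text \<open>Differentiation only lowers the exponent, so the induction needs it arbitrary. Exponent
  -1 later supplies reciprocals and 1/2 square roots.\<close>

lemma Ck_powr:
  assumes "\<And>x. f x > 0" "Ck k f"
  shows "Ck k (\<lambda>x. f x powr a)"
  using assms
proof (induction k arbitrary: a)
  case 0 then show ?case by (auto intro!: continuous_intros simp: less_imp_neq[symmetric])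
next
  case (Suc k)
  have d: "((\<lambda>t. t powr a) has_real_derivative a * f x powr (a - 1)) (at (f x))" for x
    using Suc.prems(1)[of x] has_real_derivative_powr by auto
  have "partial_deriv i (\<lambda>x. f x powr a) =
      (\<lambda>x. a * f x powr (a - 1) * partial_deriv i f x)" for i
    using Suc.prems by (auto simp: partial_deriv_compose(2)[OF d])
  moreover have "(\<lambda>x. f x powr a) differentiable at x" for x
    using Suc.prems by (auto intro: partial_deriv_compose(1)[OF d])
  ultimately show ?case
    using Suc by (auto intro!: Ck_mult Suc.IH Ck_SucD[OF Suc.prems(2)])
qed

text \<open>The factor \<open>t\<^sup>-\<^sup>m\<close> makes the family closed under differentiation.\<close>

definition flat :: "nat \<Rightarrow> real \<Rightarrow> real" where
  "flat m t = (if t > 0 then inverse t ^ m * exp (- inverse t) else 0)"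

text \<open>Substituting the inverse of t turns the claim into decay of \<open>t ^ m / exp t\<close>
  at infinity.\<close>

lemma flat_tendsto_0: "((\<lambda>t. inverse t ^ m * exp (- inverse t)) \<longlongrightarrow> 0) (at_right (0::real))"
proof -
  have "((\<lambda>t::real. t ^ m / exp t) \<longlongrightarrow> 0) at_top" by (rule tendsto_power_div_exp_0)
  from filterlim_compose[OF this filterlim_inverse_at_top_right] show ?thesis
    by (simp add: exp_minus divide_inverse)
qed

lemma has_real_derivative_flat:
  "(flat m has_real_derivative (flat (m+2) t - m * flat (m+1) t)) (at t)"
proof -
  consider "t > 0" | "t < 0" | "t = 0" by linarith
  then show ?thesis
  proof cases
    case 1
    have "((\<lambda>t. inverse t ^ m) has_real_derivative - (m * inverse t ^ (m + 1))) (at t)"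
    proof (cases m)
      case (Suc n)
      then show ?thesis
        using DERIV_power_Suc[OF DERIV_inverse, of t n] 1 by (simp add: algebra_simps)
    qed auto
    moreover have "((\<lambda>t. exp (- inverse t)) has_real_derivative exp (- inverse t) * (inverse t)\<^sup>2) (at t)"
      using 1 by (auto intro!: derivative_eq_intros simp: power2_eq_square)
    ultimately have "((\<lambda>t. inverse t ^ m * exp (- inverse t)) has_real_derivative
        (flat (m+2) t - m * flat (m+1) t)) (at t)"
      using 1 DERIV_mult[of "\<lambda>t. inverse t ^ m" _ t UNIV]
      by (fastforce simp: flat_def algebra_simps power2_eq_square)
    then show ?thesis
      by (rule has_field_derivative_transform_within_open[where S="{0<..}"])
        (use 1 in \<open>auto simp: flat_def\<close>)
  next
    case 2
    have "((\<lambda>t. 0) has_real_derivative (flat (m+2) t - m * flat (m+1) t)) (at t)"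
      using 2 by (auto simp: flat_def)
    then show ?thesis
      by (rule has_field_derivative_transform_within_open[where S="{..<0}"])
        (use 2 in \<open>auto simp: flat_def\<close>)
  next
    case 3
    have "((\<lambda>h. flat m h / h) \<longlongrightarrow> 0) (at_left 0)"
      by (rule Lim_transform_eventually[OF tendsto_const])
         (auto simp: flat_def eventually_at_left_field intro: exI[of _ "-1"])
    \<comment> \<open>For h > 0, division by h raises the power of \<open>inverse h\<close> by one,
      so the quotient is \<open>flat (m+1) h\<close>, which tends to 0. From the left everything
      vanishes identically.\<close>
    moreover have "((\<lambda>h. flat m h / h) \<longlongrightarrow> 0) (at_right 0)"
      by (rule Lim_transform_eventually[OF flat_tendsto_0[of "m+1"]])
         (auto simp: flat_def eventually_at_right_field divide_inverse intro: exI[of _ 1])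
    ultimately have "((\<lambda>h. flat m h / h) \<longlongrightarrow> 0) (at 0)"
      using filterlim_split_at by blast
    then show ?thesis using 3 by (simp add: DERIV_def flat_def)
  qed
qed

lemma Ck_flat: "Ck k f \<Longrightarrow> Ck k (\<lambda>x. flat m (f x))"
proof (induction k arbitrary: m)
  case 0
  have "continuous_on UNIV (flat m)"
    by (rule DERIV_continuous_on) (rule has_field_derivative_at_within[OF has_real_derivative_flat])
  then show ?case using 0 by (auto intro!: continuous_on_compose2[of UNIV "flat m" UNIV f])
next
  case (Suc k)
  have "partial_deriv i (\<lambda>x. flat m (f x)) =
      (\<lambda>x. (flat (m+2) (f x) + (- real m) * flat (m+1) (f x)) * partial_deriv i f x)" for i
    using Suc.prems by (auto simp: partial_deriv_compose(2)[OF has_real_derivative_flat] algebra_simps)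
  moreover have "(\<lambda>x. flat m (f x)) differentiable at x" for x
    using Suc.prems by (auto intro: partial_deriv_compose(1)[OF has_real_derivative_flat])
  ultimately show ?case
    using Suc.prems unfolding Ck.simps
    by (intro conjI allI, simp, simp only:, intro Ck_mult Ck_add Suc.IH Ck_SucD[OF Suc.prems] Ck_const) simp
qed

definition smooth :: "(real^'n \<Rightarrow> real) \<Rightarrow> bool" where
  "smooth f \<longleftrightarrow> (\<forall>k. Ck k f)"

lemma smooth_const [simp]: "smooth (\<lambda>x. c)" by (simp add: smooth_def)

lemma smooth_add: "smooth f \<Longrightarrow> smooth g \<Longrightarrow> smooth (\<lambda>x. f x + g x)"
  by (simp add: smooth_def Ck_add)

lemma smooth_mult: "smooth f \<Longrightarrow> smooth g \<Longrightarrow> smooth (\<lambda>x. f x * g x)"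
  by (simp add: smooth_def Ck_mult)

lemma smooth_diff: "smooth f \<Longrightarrow> smooth g \<Longrightarrow> smooth (\<lambda>x. f x - g x)"
  using smooth_add[of f "\<lambda>x. (-1) * g x"] smooth_mult[of "\<lambda>x. -1" g] by auto

lemma smooth_powr: "smooth f \<Longrightarrow> (\<And>x. f x > 0) \<Longrightarrow> smooth (\<lambda>x. f x powr a)"
  by (simp add: smooth_def Ck_powr)

lemma smooth_flat: "smooth f \<Longrightarrow> smooth (\<lambda>x. flat m (f x))"
  by (simp add: smooth_def Ck_flat)

lemma smooth_translate: "smooth f \<Longrightarrow> smooth (\<lambda>x. f (x + a))"
  by (simp add: smooth_def Ck_translate)

lemma smooth_sum: "(\<And>i. i \<in> A \<Longrightarrow> smooth (f i)) \<Longrightarrow> smooth (\<lambda>x. \<Sum>i\<in>A. f i x)"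
  by (induction A rule: infinite_finite_induct) (auto intro: smooth_add)

lemma smooth_real_polynomial_function: "real_polynomial_function f \<Longrightarrow> smooth f"
  by (induction f rule: real_polynomial_function.induct)
    (auto simp: smooth_def intro: Ck_bounded_linear Ck_add Ck_mult)

lemma smooth_norm_sq: "smooth (\<lambda>x. (norm (x - a))\<^sup>2)"
proof -
  have "(\<lambda>x. (norm (x - a))\<^sup>2) = (\<lambda>x. \<Sum>i\<in>UNIV. (x $ i - a $ i) * (x $ i - a $ i))"
    by (auto simp: power2_norm_eq_inner inner_vec_def)
  moreover have "smooth (\<lambda>x. x $ i)" for i
    by (simp add: smooth_def Ck_bounded_linear bounded_linear_vec_nth)
  ultimately show ?thesis by (auto intro!: smooth_sum smooth_mult smooth_diff)
qed

lemma smooth_differentiable: "smooth f \<Longrightarrow> f differentiable at x"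
  using Ck.simps(2)[of 0 f] unfolding smooth_def by blast

lemma smooth_partial_deriv: "smooth f \<Longrightarrow> smooth (partial_deriv i f)"
  unfolding smooth_def using Ck.simps(2) by blast

lemma smooth_continuous_on: "smooth f \<Longrightarrow> continuous_on S f"
  using Ck.simps(1)[of f] continuous_on_subset[of UNIV f S] unfolding smooth_def by blast

lemma smooth_partial_deriv_add:
  "smooth f \<Longrightarrow> smooth g \<Longrightarrow>
    partial_deriv i (\<lambda>x. f x + g x) = (\<lambda>x. partial_deriv i f x + partial_deriv i g x)"
  by (auto simp: partial_deriv_add smooth_differentiable)

lemma smooth_partial_deriv_mult:
  "smooth f \<Longrightarrow> smooth g \<Longrightarrow>
    partial_deriv i (\<lambda>x. f x * g x) = (\<lambda>x. f x * partial_deriv i g x + partial_deriv i f x * g x)"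
  by (auto simp: partial_deriv_mult smooth_differentiable)

lemma smooth_partial_deriv_cmult:
  "smooth f \<Longrightarrow> partial_deriv i (\<lambda>x. c * f x) = (\<lambda>x. c * partial_deriv i f x)"
  using smooth_partial_deriv_mult[of "\<lambda>x. c" f] by simp

lemma smooth_partial_deriv_translate:
  "smooth f \<Longrightarrow> partial_deriv i (\<lambda>x. f (x + a)) = (\<lambda>x. partial_deriv i f (x + a))"
  by (auto simp: partial_deriv_translate smooth_differentiable)

section \<open>Test functions\<close>

lemma test_functions_iff: "\<phi> \<in> test_functions U \<longleftrightarrow> smooth \<phi> \<and>
     compact (closure {x. \<phi> x \<noteq> 0}) \<and> closure {x. \<phi> x \<noteq> 0} \<subseteq> U"
  by (simp add: test_functions_def smooth_def)

lemma test_smooth: "\<phi> \<in> test_functions U \<Longrightarrow> smooth \<phi>"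
  by (simp add: test_functions_iff)

lemma test_mono: "\<phi> \<in> test_functions U \<Longrightarrow> U \<subseteq> V \<Longrightarrow> \<phi> \<in> test_functions V"
  by (auto simp: test_functions_iff)

lemma test_UNIV: "\<phi> \<in> test_functions U \<Longrightarrow> \<phi> \<in> test_functions UNIV"
  by (rule test_mono) auto

lemma test_zero_outside: "\<phi> \<in> test_functions U \<Longrightarrow> x \<notin> U \<Longrightarrow> \<phi> x = 0"
  using closure_subset[of "{x. \<phi> x \<noteq> 0}"] by (auto simp: test_functions_iff)

lemma zero_outside_closure: "x \<notin> closure {x. f x \<noteq> 0} \<Longrightarrow> f x = 0"
  using closure_subset[of "{x. f x \<noteq> 0}"] by auto

text \<open>The support of \<psi> is a closed subset of the compact support of \<phi>, so only
  smoothness has to be shown for a function built from \<phi>.\<close>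

lemma test_functionsI:
  assumes "smooth \<psi>" "\<phi> \<in> test_functions U" "\<And>x. x \<notin> closure {x. \<phi> x \<noteq> 0} \<Longrightarrow> \<psi> x = 0"
  shows "\<psi> \<in> test_functions U"
proof -
  have "closure {x. \<psi> x \<noteq> 0} \<subseteq> closure {x. \<phi> x \<noteq> 0}"
    using assms(3) by (intro closure_minimal) auto
  then show ?thesis
    using assms(1,2) compact_Int_closed[of "closure {x. \<phi> x \<noteq> 0}" "closure {x. \<psi> x \<noteq> 0}"]
    by (auto simp: test_functions_iff Int_absorb1)
qed

lemma partial_deriv_zero_outside:
  assumes "x \<notin> closure {x. f x \<noteq> 0}"
  shows "partial_deriv i f x = 0"
proof -
  have "((\<lambda>x. 0) has_derivative (\<lambda>x. 0)) (at x)" by (rule has_derivative_const)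
  then have "(f has_derivative (\<lambda>x. 0)) (at x)"
    by (rule has_derivative_transform_within_open[where s="- closure {x. f x \<noteq> 0}"])
      (use assms in \<open>auto dest: zero_outside_closure\<close>)
  then show ?thesis by (rule partial_deriv_eq)
qed

lemma test_partial_deriv:
  assumes "\<phi> \<in> test_functions U"
  shows "partial_deriv i \<phi> \<in> test_functions U"
proof (rule test_functionsI[OF _ assms])
  show "smooth (partial_deriv i \<phi>)" by (rule smooth_partial_deriv[OF test_smooth[OF assms]])
qed (rule partial_deriv_zero_outside)

lemma test_smooth_mult:
  assumes "\<phi> \<in> test_functions U" "smooth \<psi>"
  shows "(\<lambda>x. \<phi> x * \<psi> x) \<in> test_functions U"
proof (rule test_functionsI[OF _ assms(1)])
  show "smooth (\<lambda>x. \<phi> x * \<psi> x)" by (intro smooth_mult assms test_smooth[OF assms(1)])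
  show "\<phi> x * \<psi> x = 0" if "x \<notin> closure {x. \<phi> x \<noteq> 0}" for x
    using zero_outside_closure[OF that] by simp
qed

lemma test_smooth_mult_left:
  "\<phi> \<in> test_functions U \<Longrightarrow> smooth \<psi> \<Longrightarrow> (\<lambda>x. \<psi> x * \<phi> x) \<in> test_functions U"
  using test_smooth_mult[of \<phi> U \<psi>] by (simp add: mult.commute)

lemma test_cmult: "\<phi> \<in> test_functions U \<Longrightarrow> (\<lambda>x. c * \<phi> x) \<in> test_functions U"
  by (rule test_smooth_mult_left) auto

lemma test_zero: "(\<lambda>x. 0) \<in> test_functions U"
  by (simp add: test_functions_iff)

lemma test_add:
  assumes "\<phi> \<in> test_functions U" "\<psi> \<in> test_functions U"
  shows "(\<lambda>x. \<phi> x + \<psi> x) \<in> test_functions U"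
proof -
  let ?K = "closure {x. \<phi> x \<noteq> 0} \<union> closure {x. \<psi> x \<noteq> 0}"
  have K: "compact ?K" "?K \<subseteq> U" using assms by (auto simp: test_functions_iff)
  have "closure {x. \<phi> x + \<psi> x \<noteq> 0} \<subseteq> ?K"
  proof (rule closure_minimal)
    have "{x. \<phi> x + \<psi> x \<noteq> 0} \<subseteq> {x. \<phi> x \<noteq> 0} \<union> {x. \<psi> x \<noteq> 0}" by auto
    then show "{x. \<phi> x + \<psi> x \<noteq> 0} \<subseteq> ?K"
      using closure_subset[of "{x. \<phi> x \<noteq> 0}"] closure_subset[of "{x. \<psi> x \<noteq> 0}"] by blast
  qed (simp add: closed_Un)
  with K show ?thesis
    using assms compact_Int_closed[of ?K "closure {x. \<phi> x + \<psi> x \<noteq> 0}"]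
    by (auto simp: test_functions_iff smooth_add Int_absorb1)
qed

lemma test_translate:
  assumes "\<phi> \<in> test_functions UNIV"
  shows "(\<lambda>x. \<phi> (x + a)) \<in> test_functions UNIV"
proof -
  have "{x. \<phi> (x + a) \<noteq> 0} = (\<lambda>x. x - a) ` {x. \<phi> x \<noteq> 0}"
    by (auto simp: image_iff intro!: exI[of _ "_ + a"])
  then have "closure {x. \<phi> (x + a) \<noteq> 0} = (\<lambda>x. x - a) ` closure {x. \<phi> x \<noteq> 0}"
    by (simp add: closure_translation_subtract)
  then show ?thesis
    using assms by (auto simp: test_functions_iff smooth_translate intro: compact_translation_subtract)
qed

lemma test_compose:
  assumes "\<phi> \<in> test_functions U" "smooth (\<lambda>x. T (\<phi> x))" "T 0 = 0"
  shows "(\<lambda>x. T (\<phi> x)) \<in> test_functions U"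
proof (rule test_functionsI[OF assms(2,1)])
  show "T (\<phi> x) = 0" if "x \<notin> closure {x. \<phi> x \<noteq> 0}" for x
    using zero_outside_closure[OF that] assms(3) by simp
qed

lemma test_support_bounded:
  assumes "\<phi> \<in> test_functions U"
  obtains R where "R > 0" "\<And>x. norm x \<ge> R \<Longrightarrow> \<phi> x = 0"
proof -
  obtain R where R: "R > 0" "\<And>x. x \<in> closure {x. \<phi> x \<noteq> 0} \<Longrightarrow> norm x < R"
    using assms bounded_pos_less[of "closure {x. \<phi> x \<noteq> 0}"]
    by (auto simp: test_functions_iff compact_imp_bounded)
  then have "\<phi> x = 0" if "norm x \<ge> R" for x
    using that closure_subset[of "{x. \<phi> x \<noteq> 0}"] by fastforce
  with R that show thesis by blast
qed

lemma test_bounded: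
  assumes "\<phi> \<in> test_functions U"
  obtains B where "B > 0" "\<And>x. \<bar>\<phi> x\<bar> \<le> B"
proof -
  have "compact (\<phi> ` closure {x. \<phi> x \<noteq> 0})"
    using assms by (auto simp: test_functions_iff intro!: compact_continuous_image smooth_continuous_on)
  then obtain B where B: "B > 0" "\<And>x. x \<in> closure {x. \<phi> x \<noteq> 0} \<Longrightarrow> \<bar>\<phi> x\<bar> \<le> B"
    using bounded_pos[of "\<phi> ` closure {x. \<phi> x \<noteq> 0}"] by (auto simp: compact_imp_bounded)
  then have "\<bar>\<phi> x\<bar> \<le> B" for x
    using closure_subset[of "{x. \<phi> x \<noteq> 0}"] by (cases "\<phi> x = 0") auto
  with B that show thesis by blast
qed

section \<open>Bump functions and cut-offs\<close>

lemma test_ball: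
  assumes "r > 0" "cball a r \<subseteq> U"
  obtains \<phi> where "\<phi> \<in> test_functions U" "\<And>x. x \<in> ball a r \<Longrightarrow> \<phi> x > 0" "\<And>x. \<phi> x \<ge> 0"
proof
  \<comment> \<open>The norm enters squared so that the bump is smooth at the centre as
    well.\<close>
  let ?\<phi> = "\<lambda>x. flat 0 (r\<^sup>2 - (norm (x - a))\<^sup>2)"
  have 1: "norm (x - a) < r" if "?\<phi> x \<noteq> 0" for x
    using that assms(1) by (auto simp: flat_def split: if_splits intro: power2_less_imp_less)
  then have "closure {x. ?\<phi> x \<noteq> 0} \<subseteq> cball a r"
    by (intro closure_minimal) (force simp: dist_norm norm_minus_commute)+
  moreover from this have "compact (closure {x. ?\<phi> x \<noteq> 0})"
    using compact_Int_closed[of "cball a r" "closure {x. ?\<phi> x \<noteq> 0}"] by (simp add: Int_absorb1)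
  ultimately show "?\<phi> \<in> test_functions U"
    using assms by (auto simp: test_functions_iff intro!: smooth_flat smooth_diff smooth_norm_sq)
  show "?\<phi> x > 0" if "x \<in> ball a r" for x
    using that by (auto simp: flat_def dist_norm norm_minus_commute intro!: power_strict_mono)
  show "?\<phi> x \<ge> 0" for x by (simp add: flat_def)
qed

text \<open>The witness is a quotient a / (a + b), where q = |x|^2 / R^2, a is positive exactly for
  q < 2 and b exactly for q > 1. The two never vanish together, so the denominator is positive
  everywhere; the reciprocal is written as a power to reuse \<open>smooth_powr\<close>.\<close>

lemma test_plateau:
  assumes "R > 0"
  obtains \<psi> :: "real^'n \<Rightarrow> real" where "\<psi> \<in> test_functions UNIV" "\<And>x. norm x \<le> R \<Longrightarrow> \<psi> x = 1" 
    "\<And>x. 0 \<le> \<psi> x" "\<And>x. \<psi> x \<le> 1"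
proof
  let ?q = "\<lambda>x::real^'n. (norm (x - 0))\<^sup>2 * inverse (R\<^sup>2)"
  let ?a = "\<lambda>x. flat 0 (2 - ?q x)" and ?b = "\<lambda>x. flat 0 (?q x - 1)"
  let ?\<psi> = "\<lambda>x. ?a x * (?a x + ?b x) powr (-1)"
  have q: "smooth ?q" by (intro smooth_mult smooth_norm_sq smooth_const)
  have pos: "?a x + ?b x > 0" for x by (auto simp: flat_def intro!: add_pos_nonneg add_nonneg_pos)
  have le: "norm x \<le> 2 * R" if "?\<psi> x \<noteq> 0" for x
  proof -
    have "?q x < 2" using that by (auto simp: flat_def split: if_splits)
    then have "(norm x)\<^sup>2 < 2 * R\<^sup>2" using assms by (simp add: field_simps)
    also have "\<dots> \<le> (2 * R)\<^sup>2" by (simp add: power_mult_distrib)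
    finally have "norm x < 2 * R" using assms by (auto intro: power2_less_imp_less)
    then show ?thesis by simp
  qed
  then have "closure {x. ?\<psi> x \<noteq> 0} \<subseteq> cball 0 (2 * R)"
    by (intro closure_minimal subsetI) (simp_all only: mem_Collect_eq mem_cball dist_0_norm closed_cball)
  then have "compact (closure {x. ?\<psi> x \<noteq> 0})"
    using compact_Int_closed[of "cball 0 (2*R)" "closure {x. ?\<psi> x \<noteq> 0}"] by (simp add: Int_absorb1)
  then show "?\<psi> \<in> test_functions UNIV"
    unfolding test_functions_iff
    by (intro conjI smooth_mult smooth_powr smooth_add smooth_flat smooth_diff pos q smooth_const) auto
  show "?\<psi> x = 1" if "norm x \<le> R" for x
  proof -
    have "(norm x)\<^sup>2 \<le> R\<^sup>2" using that by (intro power_mono) auto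
    then have "?q x \<le> 1" using assms by (simp add: field_simps)
    then have "?b x = 0" by (simp add: flat_def)
    moreover have "?a x > 0" using \<open>?q x \<le> 1\<close> by (simp add: flat_def)
    ultimately show ?thesis by (simp add: powr_minus)
  qed
  have "?\<psi> x = ?a x / (?a x + ?b x)" for x
    using pos[of x] by (simp add: powr_minus divide_inverse)
  moreover have "?a x \<ge> 0" "?b x \<ge> 0" for x by (auto simp: flat_def)
  ultimately show "0 \<le> ?\<psi> x" "?\<psi> x \<le> 1" for x
    using pos[of x] by (auto simp: divide_le_eq_1)
qed

section \<open>Square integrable functions\<close>

text \<open>A real-valued version of \<open>L2_space\<close> over an arbitrary measure, so that the
  same facts serve \<open>lebesgue\<close> and \<open>lebesgue_on\<close>. The norm below stays
  squared, which suits the parallelogram law and sums over gradient components.\<close>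

definition l2 :: "'a measure \<Rightarrow> ('a \<Rightarrow> real) \<Rightarrow> bool" where
  "l2 M f \<longleftrightarrow> f \<in> borel_measurable M \<and> integrable M (\<lambda>x. (f x)\<^sup>2)"

definition nsq :: "'a measure \<Rightarrow> ('a \<Rightarrow> real) \<Rightarrow> real" where
  "nsq M f = (LINT x|M. (f x)\<^sup>2)"

lemma l2_measurable [measurable_dest]: "l2 M f \<Longrightarrow> f \<in> borel_measurable M"
  by (simp add: l2_def)

lemma nsq_nonneg [simp]: "nsq M f \<ge> 0"
  by (simp add: nsq_def)

lemma l2_bound:
  assumes "l2 M f" "g \<in> borel_measurable M" "AE x in M. \<bar>g x\<bar> \<le> \<bar>f x\<bar>"
  shows "l2 M g" "nsq M g \<le> nsq M f"
proof -
  have ae: "AE x in M. (g x)\<^sup>2 \<le> (f x)\<^sup>2"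
    using assms(3) by eventually_elim (rule abs_le_square_iff[THEN iffD1])
  show 1: "l2 M g"
    unfolding l2_def using assms ae
    by (auto simp: l2_def intro!: Bochner_Integration.integrable_bound[of M "\<lambda>x. (f x)\<^sup>2"])
  show "nsq M g \<le> nsq M f"
    unfolding nsq_def using 1 assms(1) ae by (intro integral_mono_AE) (auto simp: l2_def)
qed

lemma l2_mult_integrable:
  assumes "l2 M f" "l2 M g"
  shows "integrable M (\<lambda>x. f x * g x)"
proof (rule Bochner_Integration.integrable_bound[of M "\<lambda>x. (f x)\<^sup>2 + (g x)\<^sup>2"])
  have "\<bar>a * b\<bar> \<le> a\<^sup>2 + b\<^sup>2" for a b :: real
  proof -
    have "0 \<le> \<bar>a\<bar> * \<bar>b\<bar>" by simp
    moreover have "2 * (\<bar>a\<bar> * \<bar>b\<bar>) \<le> a\<^sup>2 + b\<^sup>2"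
      using sum_squares_bound[of "\<bar>a\<bar>" "\<bar>b\<bar>"] by (simp add: mult.assoc)
    ultimately show ?thesis unfolding abs_mult by linarith
  qed
  then show "AE x in M. norm (f x * g x) \<le> norm ((f x)\<^sup>2 + (g x)\<^sup>2)" by auto
qed (use assms in \<open>auto simp: l2_def\<close>)

lemma l2_zero [simp]: "l2 M (\<lambda>x. 0)" by (simp add: l2_def)

lemma l2_cmult: "l2 M f \<Longrightarrow> l2 M (\<lambda>x. c * f x)"
  by (auto simp: l2_def power_mult_distrib)

lemma l2_add: 
  assumes "l2 M f" "l2 M g"
  shows "l2 M (\<lambda>x. f x + g x)"
  using assms integrable_mult_right[OF l2_mult_integrable[OF assms], of 2]
  by (auto simp: l2_def power2_sum mult.assoc)

lemma l2_diff: "l2 M f \<Longrightarrow> l2 M g \<Longrightarrow> l2 M (\<lambda>x. f x - g x)"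
  using l2_add[of M f "\<lambda>x. (-1) * g x"] l2_cmult[of M g "-1"] by simp

lemma l2_sum: "(\<And>i. i \<in> A \<Longrightarrow> l2 M (f i)) \<Longrightarrow> l2 M (\<lambda>x. \<Sum>i\<in>A. f i x)"
  by (induction A rule: infinite_finite_induct) (auto intro: l2_add)

lemma nsq_cmult: "nsq M (\<lambda>x. c * f x) = c\<^sup>2 * nsq M f"
  by (simp add: nsq_def power_mult_distrib)

lemma nsq_minus_commute: "nsq M (\<lambda>x. f x - g x) = nsq M (\<lambda>x. g x - f x)"
  by (simp add: nsq_def power2_commute)

lemma l2_bounded_mult:
  assumes "l2 M f" "h \<in> borel_measurable M" "AE x in M. \<bar>h x\<bar> \<le> B"
  shows "l2 M (\<lambda>x. h x * f x)" "nsq M (\<lambda>x. h x * f x) \<le> B\<^sup>2 * nsq M f"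
proof -
  have ae: "AE x in M. \<bar>h x * f x\<bar> \<le> \<bar>B * f x\<bar>"
    using assms(3) by eventually_elim (auto simp: abs_mult intro!: mult_right_mono)
  have m: "(\<lambda>x. h x * f x) \<in> borel_measurable M" using assms by (auto simp: l2_def)
  show "l2 M (\<lambda>x. h x * f x)" "nsq M (\<lambda>x. h x * f x) \<le> B\<^sup>2 * nsq M f"
    using l2_bound[OF l2_cmult[OF assms(1), of B] m ae] by (auto simp: nsq_cmult)
qed

lemma nsq_parallelogram:
  assumes "l2 M f" "l2 M g"
  shows "nsq M (\<lambda>x. f x + g x) + nsq M (\<lambda>x. f x - g x) = 2 * nsq M f + 2 * nsq M g"
proof -
  have "nsq M (\<lambda>x. f x + g x) + nsq M (\<lambda>x. f x - g x)
      = (LINT x|M. (f x + g x)\<^sup>2 + (f x - g x)\<^sup>2)"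
    unfolding nsq_def
    using l2_add[OF assms] l2_diff[OF assms] by (subst Bochner_Integration.integral_add) (auto simp: l2_def)
  also have "\<dots> = (LINT x|M. 2 * (f x)\<^sup>2 + 2 * (g x)\<^sup>2)"
    by (intro Bochner_Integration.integral_cong) (auto simp: power2_eq_square algebra_simps)
  also have "\<dots> = 2 * nsq M f + 2 * nsq M g"
    unfolding nsq_def using assms by (subst Bochner_Integration.integral_add) (auto simp: l2_def)
  finally show ?thesis .
qed

lemma nsq_add_le:
  assumes "l2 M f" "l2 M g"
  shows "nsq M (\<lambda>x. f x + g x) \<le> 2 * nsq M f + 2 * nsq M g"
  using nsq_parallelogram[OF assms] nsq_nonneg[of M "\<lambda>x. f x - g x"] by linarith

lemma nsq_triangle:
  assumes "l2 M f" "l2 M g" "l2 M h"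
  shows "nsq M (\<lambda>x. f x - h x) \<le> 2 * nsq M (\<lambda>x. f x - g x) + 2 * nsq M (\<lambda>x. g x - h x)"
  using nsq_add_le[OF l2_diff[OF assms(1,2)] l2_diff[OF assms(2,3)]] by simp

lemma nsq_add_expand:
  assumes "l2 M f" "l2 M g"
  shows "nsq M (\<lambda>x. f x + t * g x) = nsq M f + 2 * t * (LINT x|M. f x * g x) + t\<^sup>2 * nsq M g"
proof -
  have "nsq M (\<lambda>x. f x + t * g x) = (LINT x|M. (f x)\<^sup>2 + (2 * t) * (f x * g x) + t\<^sup>2 * (g x)\<^sup>2)"
    unfolding nsq_def
    by (intro Bochner_Integration.integral_cong) (auto simp: power2_eq_square algebra_simps)
  also have "\<dots> = nsq M f + (2 * t) * (LINT x|M. f x * g x) + t\<^sup>2 * nsq M g"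
    unfolding nsq_def using assms l2_mult_integrable[OF assms]
    by (subst Bochner_Integration.integral_add) (auto simp: l2_def)
  finally show ?thesis by simp
qed

lemma cauchy_schwarz:
  assumes "l2 M f" "l2 M g"
  shows "\<bar>(LINT x|M. f x * g x)\<bar> \<le> sqrt (nsq M f) * sqrt (nsq M g)"
proof -
  define I where "I = (LINT x|M. f x * g x)"
  have q: "0 \<le> nsq M f + 2 * t * I + t\<^sup>2 * nsq M g" for t
    using nsq_add_expand[OF assms, of t] nsq_nonneg[of M "\<lambda>x. f x + t * g x"] by (simp add: I_def)
  have "I\<^sup>2 \<le> nsq M f * nsq M g"
  proof (cases "nsq M g = 0")
    case True
    have "I = 0"
    proof (rule ccontr)
      assume "I \<noteq> 0"
      \<comment> \<open>At this t the quadratic, here linear in t, takes the value -1.\<close>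
      with q[of "- (nsq M f + 1) / (2 * I)"] True show False by (simp add: field_simps)
    qed
    then show ?thesis by simp
  next
    case False
    then have "nsq M g > 0" using nsq_nonneg[of M g] by linarith
    \<comment> \<open>This t minimises the quadratic.\<close>
    with q[of "- I / nsq M g"] show ?thesis
      by (simp add: field_simps power2_eq_square)
  qed
  then have "sqrt (I\<^sup>2) \<le> sqrt (nsq M f * nsq M g)" by (rule real_sqrt_le_mono)
  then show ?thesis by (simp add: real_sqrt_mult I_def)
qed

lemma minkowski:
  assumes "l2 M f" "l2 M g"
  shows "sqrt (nsq M (\<lambda>x. f x + g x)) \<le> sqrt (nsq M f) + sqrt (nsq M g)"
proof (rule real_le_lsqrt)
  have "nsq M (\<lambda>x. f x + g x) = nsq M f + 2 * (LINT x|M. f x * g x) + nsq M g"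
    using nsq_add_expand[OF assms, of 1] by simp
  also have "\<dots> \<le> nsq M f + 2 * (sqrt (nsq M f) * sqrt (nsq M g)) + nsq M g"
    using cauchy_schwarz[OF assms] by linarith
  also have "\<dots> = (sqrt (nsq M f) + sqrt (nsq M g))\<^sup>2" by (simp add: power2_sum)
  finally show "nsq M (\<lambda>x. f x + g x) \<le> (sqrt (nsq M f) + sqrt (nsq M g))\<^sup>2" .
qed auto

section \<open>Strong convergence and completeness in L2\<close>

definition tends_l2 :: "'a measure \<Rightarrow> (nat \<Rightarrow> 'a \<Rightarrow> real) \<Rightarrow> ('a \<Rightarrow> real) \<Rightarrow> bool" where
  "tends_l2 M F f \<longleftrightarrow> (\<forall>n. l2 M (F n)) \<and> l2 M f \<and> (\<lambda>n. nsq M (\<lambda>x. F n x - f x)) \<longlonglongrightarrow> 0"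

text \<open>The difference of the products splits as (F - f)(G - g) + (F - f) g + f (G - g), and the
  Cauchy-Schwarz inequality makes each part small.\<close>

lemma tends_l2_inner:
  assumes "tends_l2 M F f" "tends_l2 M G g"
  shows "(\<lambda>n. (LINT x|M. F n x * G n x)) \<longlonglongrightarrow> (LINT x|M. f x * g x)"
proof (rule LIM_zero_cancel, rule Lim_null_comparison)
  have l: "l2 M (F n)" "l2 M (G n)" "l2 M f" "l2 M g" for n using assms by (auto simp: tends_l2_def)
  let ?a = "\<lambda>n. nsq M (\<lambda>x. F n x - f x)" and ?b = "\<lambda>n. nsq M (\<lambda>x. G n x - g x)"
  have ab: "?a \<longlonglongrightarrow> 0" "?b \<longlonglongrightarrow> 0" using assms by (auto simp: tends_l2_def)
  show "\<forall>\<^sub>F n in sequentially. norm ((LINT x|M. F n x * G n x) - (LINT x|M. f x * g x))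
     \<le> sqrt (?a n) * sqrt (?b n) + sqrt (?a n) * sqrt (nsq M g) + sqrt (nsq M f) * sqrt (?b n)"
  proof (rule always_eventually, rule allI)
    fix n
    let ?u = "\<lambda>x. F n x - f x" and ?v = "\<lambda>x. G n x - g x"
    have "(LINT x|M. F n x * G n x) - (LINT x|M. f x * g x)
        = (LINT x|M. F n x * G n x - f x * g x)"
      by (intro Bochner_Integration.integral_diff[symmetric] l2_mult_integrable l)
    also have "\<dots> = (LINT x|M. ?u x * ?v x + ?u x * g x + f x * ?v x)"
      by (intro Bochner_Integration.integral_cong) (auto simp: algebra_simps)
    also have "\<dots> = (LINT x|M. ?u x * ?v x) + (LINT x|M. ?u x * g x) + (LINT x|M. f x * ?v x)"
    proof -
      have i: "integrable M (\<lambda>x. ?u x * ?v x)" "integrable M (\<lambda>x. ?u x * g x)" "integrable M (\<lambda>x. f x * ?v x)"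
        by (intro l2_mult_integrable l2_diff l)+
      show ?thesis
        by (simp only: Bochner_Integration.integral_add[OF Bochner_Integration.integrable_add[OF i(1,2)] i(3)]
            Bochner_Integration.integral_add[OF i(1,2)])
    qed
    finally show "norm ((LINT x|M. F n x * G n x) - (LINT x|M. f x * g x))
     \<le> sqrt (?a n) * sqrt (?b n) + sqrt (?a n) * sqrt (nsq M g) + sqrt (nsq M f) * sqrt (?b n)"
      using cauchy_schwarz[of M ?u ?v] cauchy_schwarz[of M ?u g] cauchy_schwarz[of M f ?v] l
      by (simp add: l2_diff)
  qed
  have "(\<lambda>n. sqrt (?a n) * sqrt (?b n) + sqrt (?a n) * sqrt (nsq M g) + sqrt (nsq M f) * sqrt (?b n))
    \<longlonglongrightarrow> sqrt 0 * sqrt 0 + sqrt 0 * sqrt (nsq M g) + sqrt (nsq M f) * sqrt 0"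
    by (intro tendsto_intros ab)
  then show "(\<lambda>n. sqrt (?a n) * sqrt (?b n) + sqrt (?a n) * sqrt (nsq M g) + sqrt (nsq M f) * sqrt (?b n))
    \<longlonglongrightarrow> 0" by simp
qed

lemma tends_l2_const: "l2 M f \<Longrightarrow> tends_l2 M (\<lambda>n. f) f"
  by (simp add: tends_l2_def nsq_def)

lemma tends_l2_nsq:
  assumes "tends_l2 M F f"
  shows "(\<lambda>n. nsq M (F n)) \<longlonglongrightarrow> nsq M f"
  using tends_l2_inner[OF assms assms] by (simp add: nsq_def power2_eq_square)

lemma tends_l2_dominated:
  assumes "\<And>n. F n \<in> borel_measurable M" "f \<in> borel_measurable M" "l2 M h"
    and "\<And>n. AE x in M. \<bar>F n x\<bar> \<le> \<bar>h x\<bar>" "AE x in M. (\<lambda>n. F n x) \<longlonglongrightarrow> f x"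
  shows "tends_l2 M F f"
proof -
  have "AE x in M. \<forall>n. \<bar>F n x\<bar> \<le> \<bar>h x\<bar>" using assms(4) by (simp add: AE_all_countable)
  with assms(5) have fh: "AE x in M. \<bar>f x\<bar> \<le> \<bar>h x\<bar>"
  proof eventually_elim
    case (elim x)
    then show ?case by (intro LIMSEQ_le_const2[of "\<lambda>n. \<bar>F n x\<bar>"]) (auto intro: tendsto_rabs)
  qed
  have F: "l2 M (F n)" for n using l2_bound(1)[OF assms(3,1,4)] .
  have f: "l2 M f" using l2_bound(1)[OF assms(3,2) fh] .
  have "(\<lambda>n. (LINT x|M. (F n x - f x)\<^sup>2)) \<longlonglongrightarrow> (LINT x|M. 0)"
  proof (rule integral_dominated_convergence[where w="\<lambda>x. 4 * (h x)\<^sup>2"])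
    show "AE x in M. (\<lambda>n. (F n x - f x)\<^sup>2) \<longlonglongrightarrow> 0"
      using assms(5)
    proof eventually_elim
      case (elim x)
      then have "(\<lambda>n. (F n x - f x)\<^sup>2) \<longlonglongrightarrow> (f x - f x)\<^sup>2" by (intro tendsto_intros)
      then show ?case by simp
    qed
    show "AE x in M. norm ((F n x - f x)\<^sup>2) \<le> 4 * (h x)\<^sup>2" for n
      using fh assms(4)[of n]
    proof eventually_elim
      case (elim x)
      then have "\<bar>F n x - f x\<bar> \<le> \<bar>2 * h x\<bar>" by linarith
      then have "(F n x - f x)\<^sup>2 \<le> (2 * h x)\<^sup>2" by (rule abs_le_square_iff[THEN iffD1])
      then show ?case by (simp add: power_mult_distrib)
    qed
  qed (use assms in \<open>auto simp: l2_def\<close>)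
  then show ?thesis using F f by (simp add: tends_l2_def nsq_def)
qed

lemma tends_l2_subseq:
  assumes "tends_l2 M F f" "strict_mono r"
  shows "tends_l2 M (\<lambda>n. F (r n)) f"
  using assms LIMSEQ_subseq_LIMSEQ[of "\<lambda>n. nsq M (\<lambda>x. F n x - f x)" 0 r]
  by (auto simp: tends_l2_def o_def)

lemma tends_l2_AE_subseq:
  assumes "tends_l2 M F f"
  obtains r where "strict_mono r" "AE x in M. (\<lambda>n. F (r n) x) \<longlonglongrightarrow> f x"
proof -
  have "\<exists>r::nat\<Rightarrow>nat. strict_mono r \<and> (AE x in M. (\<lambda>n. (F (r n) x - f x)\<^sup>2) \<longlonglongrightarrow> 0)"
    using assms l2_diff[of M _ f] by (intro tendsto_L1_AE_subseq) (auto simp: tends_l2_def nsq_def l2_def)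
  then obtain r where r: "strict_mono r" "AE x in M. (\<lambda>n. (F (r n) x - f x)\<^sup>2) \<longlonglongrightarrow> 0" by blast
  from r(2) have "AE x in M. (\<lambda>n. F (r n) x) \<longlonglongrightarrow> f x"
  proof eventually_elim
    case (elim x)
    then have "(\<lambda>n. sqrt ((F (r n) x - f x)\<^sup>2)) \<longlonglongrightarrow> sqrt 0" by (rule tendsto_real_sqrt)
    then show ?case by (simp add: tendsto_rabs_zero_iff LIM_zero_iff)
  qed
  with r(1) that show thesis by blast
qed

lemma tends_l2_add:
  assumes "tends_l2 M F f" "tends_l2 M G g"
  shows "tends_l2 M (\<lambda>n x. F n x + G n x) (\<lambda>x. f x + g x)"
proof -
  have l: "l2 M (F n)" "l2 M (G n)" "l2 M f" "l2 M g" for n using assms by (auto simp: tends_l2_def)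
  have "(\<lambda>n. nsq M (\<lambda>x. (F n x + G n x) - (f x + g x))) \<longlonglongrightarrow> 0"
  proof (rule tendsto_sandwich[OF _ _ tendsto_const])
    have "nsq M (\<lambda>x. (F n x + G n x) - (f x + g x)) \<le>
      2 * nsq M (\<lambda>x. F n x - f x) + 2 * nsq M (\<lambda>x. G n x - g x)" for n
      using nsq_add_le[OF l2_diff[OF l(1) l(3)] l2_diff[OF l(2) l(4)], of n n] by (simp add: algebra_simps)
    then show "\<forall>\<^sub>F n in sequentially. nsq M (\<lambda>x. (F n x + G n x) - (f x + g x)) \<le>
      2 * nsq M (\<lambda>x. F n x - f x) + 2 * nsq M (\<lambda>x. G n x - g x)" by simp
    have "(\<lambda>n. 2 * nsq M (\<lambda>x. F n x - f x) + 2 * nsq M (\<lambda>x. G n x - g x)) \<longlonglongrightarrow> 2 * 0 + 2 * 0"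
      using assms by (intro tendsto_intros) (auto simp: tends_l2_def)
    then show "(\<lambda>n. 2 * nsq M (\<lambda>x. F n x - f x) + 2 * nsq M (\<lambda>x. G n x - g x)) \<longlonglongrightarrow> 0" by simp
  qed auto
  then show ?thesis using l by (simp add: tends_l2_def l2_add)
qed

text \<open>The factors \<open>H n\<close> converge only pointwise, so the product is split:
  \<open>H n * f\<close> converges by dominated convergence, while \<open>H n * (F n - f)\<close> is
  small by the uniform bound.\<close>

lemma tends_l2_bounded_mult:
  assumes "tends_l2 M F f" "\<And>n. H n \<in> borel_measurable M" "\<And>n. AE x in M. \<bar>H n x\<bar> \<le> B"
    "h \<in> borel_measurable M" "AE x in M. (\<lambda>n. H n x) \<longlonglongrightarrow> h x"
  shows "tends_l2 M (\<lambda>n x. H n x * F n x) (\<lambda>x. h x * f x)"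
proof -
  have l: "l2 M (F n)" "l2 M f" for n using assms by (auto simp: tends_l2_def)
  have "tends_l2 M (\<lambda>n x. H n x * f x) (\<lambda>x. h x * f x)"
  proof (rule tends_l2_dominated[where h="\<lambda>x. B * f x"])
    show "AE x in M. \<bar>H n x * f x\<bar> \<le> \<bar>B * f x\<bar>" for n
      using assms(3)[of n] by eventually_elim (auto simp: abs_mult intro!: mult_right_mono)
    show "AE x in M. (\<lambda>n. H n x * f x) \<longlonglongrightarrow> h x * f x"
      using assms(5) by eventually_elim (intro tendsto_intros)
  qed (use assms l l2_cmult[OF l(2)] in \<open>auto simp: l2_measurable\<close>)
  moreover have "tends_l2 M (\<lambda>n x. H n x * (F n x - f x)) (\<lambda>x. 0)"
  proof -
    have b: "l2 M (\<lambda>x. H n x * (F n x - f x))"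
      "nsq M (\<lambda>x. H n x * (F n x - f x)) \<le> B\<^sup>2 * nsq M (\<lambda>x. F n x - f x)" for n
      using l2_bounded_mult[OF l2_diff[OF l(1) l(2)] assms(2,3)] by auto
    have "(\<lambda>n. nsq M (\<lambda>x. H n x * (F n x - f x))) \<longlonglongrightarrow> 0"
    proof (rule tendsto_sandwich[OF _ _ tendsto_const])
      have "(\<lambda>n. B\<^sup>2 * nsq M (\<lambda>x. F n x - f x)) \<longlonglongrightarrow> B\<^sup>2 * 0"
        using assms(1) by (intro tendsto_intros) (auto simp: tends_l2_def)
      then show "(\<lambda>n. B\<^sup>2 * nsq M (\<lambda>x. F n x - f x)) \<longlonglongrightarrow> 0" by simp
    qed (use b in auto)
    with b show ?thesis by (simp add: tends_l2_def)
  qed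
  ultimately have "tends_l2 M (\<lambda>n x. H n x * f x + H n x * (F n x - f x)) (\<lambda>x. h x * f x + 0)"
    by (rule tends_l2_add)
  then show ?thesis by (simp add: algebra_simps)
qed

text \<open>A local Lipschitz bound for s |s|. Together with the Cauchy-Schwarz inequality it turns
  closeness in L2 into closeness in L1.\<close>

lemma signed_square_diff: "\<bar>\<bar>a\<bar> * a - \<bar>b\<bar> * b\<bar> \<le> \<bar>a - b\<bar> * (\<bar>a\<bar> + \<bar>b\<bar>)" for a b :: real
proof -
  have "\<bar>a\<bar> * a - \<bar>b\<bar> * b = \<bar>a\<bar> * (a - b) + (\<bar>a\<bar> - \<bar>b\<bar>) * b" by (simp add: algebra_simps)
  also have "\<bar>\<dots>\<bar> \<le> \<bar>a\<bar> * \<bar>a - b\<bar> + \<bar>\<bar>a\<bar> - \<bar>b\<bar>\<bar> * \<bar>b\<bar>"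
    using abs_triangle_ineq[of "\<bar>a\<bar> * (a - b)" "(\<bar>a\<bar> - \<bar>b\<bar>) * b"] by (simp add: abs_mult)
  also have "\<dots> \<le> \<bar>a\<bar> * \<bar>a - b\<bar> + \<bar>a - b\<bar> * \<bar>b\<bar>"
    by (intro add_left_mono mult_right_mono) auto
  finally show ?thesis by (simp add: algebra_simps)
qed

text \<open>The signed squares form a Cauchy sequence in \<open>L\<^sup>1\<close>, which yields an almost everywhere
  convergent subsequence also when the measure is infinite.\<close>

lemma l2_complete:
  assumes F: "\<And>n. l2 M (F n)"
    and cauchy: "\<And>e. e > 0 \<Longrightarrow> \<exists>N. \<forall>m\<ge>N. \<forall>n\<ge>N. nsq M (\<lambda>x. F m x - F n x) < e"
  obtains f where "tends_l2 M F f"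
proof -
  obtain N1 where N1: "\<And>m n. m \<ge> N1 \<Longrightarrow> n \<ge> N1 \<Longrightarrow> nsq M (\<lambda>x. F m x - F n x) < 1"
    using cauchy[of 1] by auto
  \<comment> \<open>All terms from \<open>N1\<close> on lie within squared distance 1 of
    \<open>F N1\<close>; \<open>nsq_add_le\<close> doubles both contributions.\<close>
  define B where "B = 2 * nsq M (F N1) + 2"
  have B: "nsq M (F n) \<le> B" if "n \<ge> N1" for n
    using nsq_add_le[OF F l2_diff[OF F F], of N1 n N1] N1[OF that order_refl] by (simp add: B_def)
  have "B \<ge> 0" by (simp add: B_def)
  let ?s = "\<lambda>n x. \<bar>F n x\<bar> * F n x"
  have absF: "l2 M (\<lambda>x. \<bar>F n x\<bar>)" for n using F[of n] by (auto simp: l2_def)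
  have s: "integrable M (?s n)" for n using l2_mult_integrable[OF absF F] .
  have "\<exists>N. \<forall>i\<ge>N. \<forall>j\<ge>N. LINT x|M. norm (?s i x - ?s j x) < e" if "e > 0" for e
  proof -
    \<comment> \<open>Chosen so that \<open>sqrt d * (2 * sqrt B)\<close> is below e; the added 1
      makes the inequality strict and the quotient meaningful when B = 0.\<close>
    define d where "d = (e / (2 * sqrt B + 1))\<^sup>2"
    have pos: "2 * sqrt B + 1 > 0" using \<open>B \<ge> 0\<close> by (intro add_nonneg_pos) auto
    then have "d > 0" using that by (simp add: d_def)
    then obtain N where N: "\<And>m n. m \<ge> N \<Longrightarrow> n \<ge> N \<Longrightarrow> nsq M (\<lambda>x. F m x - F n x) < d"
      using cauchy by blast
    have "LINT x|M. norm (?s i x - ?s j x) < e" if ij: "i \<ge> max N N1" "j \<ge> max N N1" for i j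
    proof -
      have ad: "l2 M (\<lambda>x. \<bar>F i x - F j x\<bar>)" using l2_diff[OF F F, of i j] by (auto simp: l2_def)
      have as: "l2 M (\<lambda>x. \<bar>F i x\<bar> + \<bar>F j x\<bar>)" by (intro l2_add absF)
      have "(LINT x|M. norm (?s i x - ?s j x)) \<le> LINT x|M. \<bar>F i x - F j x\<bar> * (\<bar>F i x\<bar> + \<bar>F j x\<bar>)"
        by (intro integral_mono integrable_norm Bochner_Integration.integrable_diff s
            l2_mult_integrable[OF ad as]) (use signed_square_diff in auto)
      also have "\<dots> \<le> sqrt (nsq M (\<lambda>x. \<bar>F i x - F j x\<bar>)) * sqrt (nsq M (\<lambda>x. \<bar>F i x\<bar> + \<bar>F j x\<bar>))"
        using cauchy_schwarz[OF ad as] by linarith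
      also have "\<dots> \<le> sqrt d * (2 * sqrt B)"
      proof (intro mult_mono)
        show "sqrt (nsq M (\<lambda>x. \<bar>F i x - F j x\<bar>)) \<le> sqrt d"
          using N[of i j] ij by (simp add: nsq_def)
        have "sqrt (nsq M (\<lambda>x. \<bar>F i x\<bar> + \<bar>F j x\<bar>)) \<le> sqrt (nsq M (F i)) + sqrt (nsq M (F j))"
          using minkowski[OF absF absF, of i j] by (simp add: nsq_def)
        also have "\<dots> \<le> sqrt B + sqrt B" using B[of i] B[of j] ij by (intro add_mono) auto
        finally show "sqrt (nsq M (\<lambda>x. \<bar>F i x\<bar> + \<bar>F j x\<bar>)) \<le> 2 * sqrt B" by simp
      qed (use \<open>d > 0\<close> in auto)
      also have "\<dots> = e * (2 * sqrt B / (2 * sqrt B + 1))"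
        using pos \<open>e > 0\<close> by (simp add: d_def)
      also have "\<dots> < e * 1"
        using pos \<open>e > 0\<close> by (intro mult_strict_left_mono) (auto simp: divide_less_eq_1)
      finally show ?thesis by simp
    qed
    then show ?thesis by blast
  qed
  from cauchy_L1_AE_cauchy_subseq[OF s this]
  obtain r where r: "strict_mono r" "AE x in M. Cauchy (\<lambda>i. ?s (r i) x)" by blast
  define f where "f x = lim (\<lambda>i. F (r i) x)" for x
  have conv: "AE x in M. (\<lambda>i. F (r i) x) \<longlonglongrightarrow> f x"
    using r(2)
  proof eventually_elim
    case (elim x)
    then obtain L where L: "(\<lambda>i. ?s (r i) x) \<longlonglongrightarrow> L" using Cauchy_convergent convergent_def by blast
    have inv: "sgn (\<bar>a\<bar> * a) * sqrt \<bar>\<bar>a\<bar> * a\<bar> = a" for a :: real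
      by (cases a "0::real" rule: linorder_cases) (auto simp: abs_mult sgn_mult real_sqrt_mult)
    \<comment> \<open>This is the inverse of the signed square, so its continuity transfers
      convergence back to \<open>F (r i) x\<close>. Only L = 0, where \<open>sgn\<close> jumps,
      needs an argument.\<close>
    have "isCont (\<lambda>y. sgn y * sqrt \<bar>y\<bar>) L"
    proof -
      show ?thesis
      proof (cases "L = 0")
        case True
        have "((\<lambda>y. sgn y * sqrt \<bar>y\<bar>) \<longlongrightarrow> 0) (at 0)"
        proof (rule Lim_null_comparison)
          show "\<forall>\<^sub>F y in at (0::real). norm (sgn y * sqrt \<bar>y\<bar>) \<le> sqrt \<bar>y\<bar>"
            by (auto simp: abs_mult sgn_if intro!: always_eventually)
          have "((\<lambda>y::real. sqrt \<bar>y\<bar>) \<longlongrightarrow> sqrt \<bar>0\<bar>) (at 0)" by (intro tendsto_intros)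
          then show "((\<lambda>y::real. sqrt \<bar>y\<bar>) \<longlongrightarrow> 0) (at 0)" by simp
        qed
        then show ?thesis using True by (simp add: isCont_def)
      next
        case False
        then show ?thesis by (auto intro!: continuous_intros)
      qed
    qed
    from isCont_tendsto_compose[OF this L] have "(\<lambda>i. F (r i) x) \<longlonglongrightarrow> sgn L * sqrt \<bar>L\<bar>"
      by (simp add: inv)
    then show ?case by (simp add: f_def limI)
  qed
  have fm: "f \<in> borel_measurable M" unfolding f_def by (intro borel_measurable_lim_metric l2_measurable F)
  \<comment> \<open>Fatou's lemma along the subsequence. The integral is taken with extended values
    because integrability of the limit is still unknown and is derived from this bound.\<close>
  have key: "(\<integral>\<^sup>+x. ennreal ((F n x - f x)\<^sup>2) \<partial>M) \<le> ennreal e" if N: "\<And>m. m \<ge> N \<Longrightarrow> nsq M (\<lambda>x. F n x - F m x) \<le> e" for n N e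
  proof -
    have "(\<integral>\<^sup>+x. ennreal ((F n x - f x)\<^sup>2) \<partial>M) = (\<integral>\<^sup>+x. liminf (\<lambda>i. ennreal ((F n x - F (r i) x)\<^sup>2)) \<partial>M)"
    proof (rule nn_integral_cong_AE)
      show "AE x in M. ennreal ((F n x - f x)\<^sup>2) = liminf (\<lambda>i. ennreal ((F n x - F (r i) x)\<^sup>2))"
        using conv
      proof eventually_elim
        case (elim x)
        then have "(\<lambda>i. ennreal ((F n x - F (r i) x)\<^sup>2)) \<longlonglongrightarrow> ennreal ((F n x - f x)\<^sup>2)"
          by (intro tendsto_intros)
        then show ?case by (rule lim_imp_Liminf[OF trivial_limit_sequentially, symmetric])
      qed
    qed
    also have "\<dots> \<le> liminf (\<lambda>i. \<integral>\<^sup>+x. ennreal ((F n x - F (r i) x)\<^sup>2) \<partial>M)"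
      using l2_measurable[OF F] by (intro nn_integral_liminf) measurable
    also have "\<dots> \<le> ennreal e"
    proof (rule Liminf_le)
      show "\<forall>\<^sub>F i in sequentially. (\<integral>\<^sup>+x. ennreal ((F n x - F (r i) x)\<^sup>2) \<partial>M) \<le> ennreal e"
        using eventually_ge_at_top[of N]
      proof eventually_elim
        case (elim i)
        then have "nsq M (\<lambda>x. F n x - F (r i) x) \<le> e"
          using N[of "r i"] seq_suble[OF r(1), of i] by simp
        then show ?case
          using l2_diff[OF F F, of n "r i"]
          by (subst nn_integral_eq_integral) (auto simp: l2_def nsq_def ennreal_leI)
      qed
    qed simp
    finally show ?thesis .
  qed
  have diff: "l2 M (\<lambda>x. F n x - f x)" if "n \<ge> N1" for n
    using key[of N1 n 1] N1[OF that] fm F[of n]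
    by (auto simp: l2_def less_imp_le integrable_iff_bounded intro: order.strict_trans1)
  have "l2 M f" using l2_diff[OF F[of N1] diff[OF order_refl]] by simp
  moreover have "(\<lambda>n. nsq M (\<lambda>x. F n x - f x)) \<longlonglongrightarrow> 0"
  proof (rule LIMSEQ_I)
    fix e :: real assume "e > 0"
    then obtain N where N: "\<And>m n. m \<ge> N \<Longrightarrow> n \<ge> N \<Longrightarrow> nsq M (\<lambda>x. F m x - F n x) < e / 2"
      using cauchy[of "e/2"] by auto
    have "nsq M (\<lambda>x. F n x - f x) \<le> e / 2" if "n \<ge> max N N1" for n
    proof -
      have "ennreal (nsq M (\<lambda>x. F n x - f x)) = (\<integral>\<^sup>+x. ennreal ((F n x - f x)\<^sup>2) \<partial>M)"
        unfolding nsq_def using diff[of n] that by (subst nn_integral_eq_integral) (auto simp: l2_def)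
      also have "\<dots> \<le> ennreal (e / 2)" using N[of n] that by (intro key[of N]) (auto intro: less_imp_le)
      finally show ?thesis using \<open>e > 0\<close> by (simp add: ennreal_le_iff)
    qed
    then show "\<exists>no. \<forall>n\<ge>no. norm (nsq M (\<lambda>x. F n x - f x) - 0) < e"
      using \<open>e > 0\<close> by (intro exI[of _ "max N N1"]) force
  qed
  ultimately show thesis using F by (intro that) (simp add: tends_l2_def)
qed

lemma tends_l2_cmult: "tends_l2 M F f \<Longrightarrow> tends_l2 M (\<lambda>n x. c * F n x) (\<lambda>x. c * f x)"
  by (rule tends_l2_bounded_mult[where B="\<bar>c\<bar>"]) auto

lemma tends_l2_diff:
  assumes "tends_l2 M F f" "tends_l2 M G g"
  shows "tends_l2 M (\<lambda>n x. F n x - G n x) (\<lambda>x. f x - g x)"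
  using tends_l2_add[OF assms(1) tends_l2_cmult[OF assms(2), of "-1"]] by simp

lemma tends_l2_cong_AE:
  assumes "tends_l2 M F f" "AE x in M. f x = g x" "g \<in> borel_measurable M"
  shows "tends_l2 M F g"
proof -
  have l: "l2 M (F n)" "l2 M f" for n using assms by (auto simp: tends_l2_def)
  have g: "l2 M g" by (rule l2_bound(1)[OF l(2) assms(3)]) (use assms(2) in eventually_elim, auto)
  have "nsq M (\<lambda>x. F n x - g x) = nsq M (\<lambda>x. F n x - f x)" for n
    unfolding nsq_def
  proof (rule integral_cong_AE)
    show "AE x in M. (F n x - g x)\<^sup>2 = (F n x - f x)\<^sup>2" using assms(2) by eventually_elim simp
  qed (use l2_measurable[OF g] l2_measurable[OF l(1)] l2_measurable[OF l(2)] in measurable)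
  then show ?thesis using assms(1) g l by (simp add: tends_l2_def)
qed

section \<open>Translations and bounded supports under Lebesgue measure\<close>

lemma lebesgue_translate: "distr lebesgue lebesgue (\<lambda>x::'a::euclidean_space. x + a) = lebesgue"
  and measurable_lebesgue_translate: "(\<lambda>x::'a. x + a) \<in> lebesgue \<rightarrow>\<^sub>M lebesgue"
proof -
  have T: "(\<lambda>x::'a. a + (\<Sum>j\<in>Basis. (1 * (x \<bullet> j)) *\<^sub>R j)) = (\<lambda>x. x + a)"
    by (auto simp: euclidean_representation add.commute)
  show "distr lebesgue lebesgue (\<lambda>x::'a. x + a) = lebesgue"
    using lebesgue_affine_euclidean[of "\<lambda>_. 1" a] unfolding T by (simp add: density_1)
  show "(\<lambda>x::'a. x + a) \<in> lebesgue \<rightarrow>\<^sub>M lebesgue"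
    using lebesgue_affine_measurable[of "\<lambda>_. 1" a] unfolding T by simp
qed

lemma integral_translate:
  fixes f :: "'a::euclidean_space \<Rightarrow> real"
  assumes "f \<in> borel_measurable lebesgue"
  shows "(LINT x|lebesgue. f (x + a)) = integral\<^sup>L lebesgue f"
    "integrable lebesgue (\<lambda>x. f (x + a)) \<longleftrightarrow> integrable lebesgue f"
  using integral_distr[OF measurable_lebesgue_translate assms, of a]
    integrable_distr_eq[OF measurable_lebesgue_translate assms, of a]
  by (auto simp: lebesgue_translate)

lemma l2_translate:
  fixes f :: "'a::euclidean_space \<Rightarrow> real"
  assumes "l2 lebesgue f"
  shows "l2 lebesgue (\<lambda>x. f (x + a))" "nsq lebesgue (\<lambda>x. f (x + a)) = nsq lebesgue f"
  using assms integral_translate[of "\<lambda>x. (f x)\<^sup>2" a] measurable_compose[OF measurable_lebesgue_translate, of f borel a]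
  by (auto simp: l2_def nsq_def)

lemma smooth_measurable: "smooth f \<Longrightarrow> f \<in> borel_measurable lebesgue"
  by (intro measurable_completion) (simp add: borel_measurable_continuous_onI smooth_continuous_on)

lemma test_measurable: "\<phi> \<in> test_functions U \<Longrightarrow> \<phi> \<in> borel_measurable lebesgue"
  by (intro smooth_measurable test_smooth)

lemma l2_indicator_cball: "l2 lebesgue (\<lambda>x::'a::euclidean_space. B * indicator (cball a R) x)"
proof -
  have "integrable lebesgue (\<lambda>x::'a. (indicator (cball a R) x)\<^sup>2 :: real)"
    by (simp add: power2_eq_square indicator_inter_arith[symmetric] integrable_indicator_iff)
       (metis bounded_cball emeasure_bounded_finite infinity_ennreal_def)
  then show ?thesis by (intro l2_cmult) (simp add: l2_def borel_measurable_indicator)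
qed

lemma l2_bounded_support:
  fixes f :: "'a::euclidean_space \<Rightarrow> real"
  assumes "f \<in> borel_measurable lebesgue" "\<And>x. \<bar>f x\<bar> \<le> B" "\<And>x. norm x \<ge> R \<Longrightarrow> f x = 0"
  shows "l2 lebesgue f" "integrable lebesgue f"
proof -
  have B: "B \<ge> 0" using assms(2)[of undefined] by linarith
  have le: "\<bar>f x\<bar> \<le> B * indicator (cball 0 R) x" for x
    using assms(2)[of x] assms(3)[of x] by (cases "norm x \<ge> R") (auto simp: indicator_def)
  show "l2 lebesgue f"
    by (rule l2_bound(1)[OF l2_indicator_cball[of B 0 R] assms(1)]) (use le B in \<open>auto simp: abs_mult\<close>)
  have "integrable lebesgue (\<lambda>x::'a. B * indicator (cball 0 R) x * (1 * indicator (cball 0 R) x))"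
    by (intro l2_mult_integrable l2_indicator_cball)
  moreover have "(\<lambda>x::'a. B * indicator (cball 0 R) x * (1 * indicator (cball 0 R) x)) = (\<lambda>x. B * indicator (cball 0 R) x)"
    by (auto simp: indicator_def)
  ultimately have "integrable lebesgue (\<lambda>x::'a. B * indicator (cball 0 R) x)" by (simp only:)
  then show "integrable lebesgue f"
    by (elim Bochner_Integration.integrable_bound) (use le B assms(1) in \<open>auto simp: abs_mult intro!: AE_I2\<close>)
qed

lemma test_l2: 
  assumes "\<phi> \<in> test_functions U"
  shows "l2 lebesgue \<phi>" "integrable lebesgue \<phi>"
proof -
  obtain R where R: "\<And>x. norm x \<ge> R \<Longrightarrow> \<phi> x = 0" using test_support_bounded[OF assms] by metis
  obtain B where B: "\<And>x. \<bar>\<phi> x\<bar> \<le> B" using test_bounded[OF assms] by metis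
  show "l2 lebesgue \<phi>" "integrable lebesgue \<phi>"
    using l2_bounded_support[OF test_measurable[OF assms] B R] by auto
qed

section \<open>Difference quotients and integration by parts\<close>

definition dq :: "'n::finite \<Rightarrow> real \<Rightarrow> (real^'n \<Rightarrow> real) \<Rightarrow> real^'n \<Rightarrow> real" where
  "dq i s f x = (f (x + s *\<^sub>R axis i 1) - f x) / s"

lemma has_real_derivative_line:
  assumes "smooth \<phi>"
  shows "((\<lambda>t. \<phi> (x + t *\<^sub>R axis i 1)) has_real_derivative partial_deriv i \<phi> (x + t *\<^sub>R axis i 1)) (at t)"
proof -
  let ?y = "x + t *\<^sub>R axis i 1"
  let ?D = "frechet_derivative \<phi> (at ?y)"
  have D: "(\<phi> has_derivative ?D) (at ?y)"
    using smooth_differentiable[OF assms] by (simp add: frechet_derivative_works)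
  have "((\<lambda>t. x + t *\<^sub>R axis i 1) has_derivative (\<lambda>s. s *\<^sub>R axis i 1)) (at t)"
    by (auto intro!: derivative_eq_intros)
  from has_derivative_compose[OF this D]
  have "((\<lambda>t. \<phi> (x + t *\<^sub>R axis i 1)) has_derivative (\<lambda>s. ?D (s *\<^sub>R axis i 1))) (at t)" .
  moreover have "?D (s *\<^sub>R axis i 1) = partial_deriv i \<phi> ?y * s" for s
    using linear_cmul[OF has_derivative_linear[OF D]] by (simp add: partial_deriv_def)
  ultimately show ?thesis by (simp add: has_field_derivative_def)
qed

lemma dq_bound:
  assumes "smooth \<phi>" "\<And>x. \<bar>partial_deriv i \<phi> x\<bar> \<le> B"
  shows "\<bar>dq i s \<phi> x\<bar> \<le> B"
proof (cases "s = 0")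
  \<comment> \<open>Division by zero yields 0, so the quotient with s = 0 is 0 and the bound is
    trivial.\<close>
  case True
  then show ?thesis using assms(2)[of x] by (auto simp: dq_def)
next
  case False
  let ?g = "\<lambda>t. \<phi> (x + t *\<^sub>R axis i 1)"
  have "norm (?g s - ?g 0) \<le> B * norm (s - 0)"
    by (rule field_differentiable_bound[of UNIV ?g "\<lambda>t. partial_deriv i \<phi> (x + t *\<^sub>R axis i 1)"])
      (use has_real_derivative_line[OF assms(1)] assms(2) in auto)
  then show ?thesis using False by (simp add: dq_def field_simps)
qed

text \<open>Shifts of length at most 1 keep all quotients supported in one ball, so a multiple of
  its indicator dominates them. The second conclusion exposes that ball for
  \<open>integral_partial_deriv\<close>.\<close>

lemma tends_l2_dq_test:
  assumes "\<phi> \<in> test_functions U" "s \<longlonglongrightarrow> 0" "\<And>n. s n \<noteq> 0" "\<And>n. \<bar>s n\<bar> \<le> 1"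
  shows "tends_l2 lebesgue (\<lambda>n. dq i (s n) \<phi>) (partial_deriv i \<phi>)"
    and "\<exists>R. \<forall>n x. norm x \<ge> R \<longrightarrow> dq i (s n) \<phi> x = 0 \<and> partial_deriv i \<phi> x = 0"
proof -
  note sm = test_smooth[OF assms(1)]
  obtain R where R: "\<And>x. norm x \<ge> R \<Longrightarrow> \<phi> x = 0" using test_support_bounded[OF assms(1)] by metis
  obtain R' where R': "\<And>x. norm x \<ge> R' \<Longrightarrow> partial_deriv i \<phi> x = 0"
    using test_support_bounded[OF test_partial_deriv[OF assms(1)]] by metis
  obtain B where B: "\<And>x. \<bar>partial_deriv i \<phi> x\<bar> \<le> B" using test_bounded[OF test_partial_deriv[OF assms(1)]] by metis
  have "B \<ge> 0" using B[of undefined] by linarith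
  \<comment> \<open>The added 1 is the largest length of a shift.\<close>
  define r where "r = max (R + 1) R'"
  have z: "dq i (s n) \<phi> x = 0" if "norm x \<ge> r" for n x
  proof -
    have "norm x \<le> norm (x + s n *\<^sub>R axis i 1) + norm (s n *\<^sub>R axis i (1::real))"
      using norm_triangle_ineq4[of "x + s n *\<^sub>R axis i 1" "s n *\<^sub>R axis i 1"] by simp
    then have "norm (x + s n *\<^sub>R axis i 1) \<ge> R"
      using that assms(4)[of n] by (simp add: r_def)
    moreover have "norm x \<ge> R" using that by (simp add: r_def)
    ultimately show ?thesis by (simp add: dq_def R)
  qed
  show "\<exists>R. \<forall>n x. norm x \<ge> R \<longrightarrow> dq i (s n) \<phi> x = 0 \<and> partial_deriv i \<phi> x = 0"
    by (rule exI[of _ r]) (auto simp: z R' r_def)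
  show "tends_l2 lebesgue (\<lambda>n. dq i (s n) \<phi>) (partial_deriv i \<phi>)"
  proof (rule tends_l2_dominated[where h="\<lambda>x. B * indicator (cball 0 r) x"])
    show "dq i (s n) \<phi> \<in> borel_measurable lebesgue" for n
      unfolding dq_def using smooth_translate[OF sm, of "s n *\<^sub>R axis i 1"] sm
      by (intro borel_measurable_divide borel_measurable_diff smooth_measurable) auto
    show "partial_deriv i \<phi> \<in> borel_measurable lebesgue"
      by (intro smooth_measurable smooth_partial_deriv sm)
    show "AE x in lebesgue. \<bar>dq i (s n) \<phi> x\<bar> \<le> \<bar>B * indicator (cball 0 r) x\<bar>" for n
    proof (rule AE_I2)
      fix x
      show "\<bar>dq i (s n) \<phi> x\<bar> \<le> \<bar>B * indicator (cball 0 r) x\<bar>"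
        using dq_bound[OF sm B, of "s n" x] z[of x n] \<open>B \<ge> 0\<close>
        by (cases "norm x \<ge> r") (auto simp: indicator_def)
    qed
    show "AE x in lebesgue. (\<lambda>n. dq i (s n) \<phi> x) \<longlonglongrightarrow> partial_deriv i \<phi> x"
    proof (rule AE_I2)
      fix x
      have "((\<lambda>h. (\<phi> (x + (0 + h) *\<^sub>R axis i 1) - \<phi> (x + 0 *\<^sub>R axis i 1)) / h)
          \<longlongrightarrow> partial_deriv i \<phi> (x + 0 *\<^sub>R axis i 1)) (at 0)"
        using has_real_derivative_line[OF sm, of x i 0] unfolding DERIV_def .
      moreover have "filterlim s (at 0) sequentially"
        using assms(2,3) by (auto simp: filterlim_at)
      ultimately show "(\<lambda>n. dq i (s n) \<phi> x) \<longlonglongrightarrow> partial_deriv i \<phi> x"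
        unfolding dq_def by (auto dest: filterlim_compose)
    qed
  qed (rule l2_indicator_cball)
qed

text \<open>One null sequence serves as shift length, truncation parameter, tolerance and variation
  parameter. Starting at 1 keeps it positive and at most 1, as \<open>tends_l2_dq_test\<close>
  demands.\<close>

definition step :: "nat \<Rightarrow> real" where "step n = inverse (real (Suc n))"

lemma step: "step \<longlonglongrightarrow> 0" "step n \<noteq> 0" "\<bar>step n\<bar> \<le> 1" "step n > 0"
  using LIMSEQ_inverse_real_of_nat by (auto simp: step_def[abs_def] inverse_le_1_iff)

text \<open>Translation invariance makes the integral of every difference quotient vanish, and the
  quotients converge to the derivative in L2.\<close>

lemma integral_partial_deriv:
  assumes "\<phi> \<in> test_functions U"
  shows "integral\<^sup>L lebesgue (partial_deriv i \<phi>) = 0"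
proof -
  note t = tends_l2_dq_test[OF assms step(1-3), of i]
  obtain R where R: "\<And>n x. norm x \<ge> R \<Longrightarrow> dq i (step n) \<phi> x = 0" "\<And>x. norm x \<ge> R \<Longrightarrow> partial_deriv i \<phi> x = 0"
    using t(2) by blast
  \<comment> \<open>Convergence of integrals is a pairing with the constant 1, which is not square
    integrable; the indicator of a ball containing all supports replaces it.\<close>
  let ?I = "\<lambda>x. 1 * indicator (cball 0 R) x :: real"
  have I: "(\<lambda>x. f x * ?I x) = f" if "\<And>x. norm x \<ge> R \<Longrightarrow> f x = 0" for f :: "real^'a \<Rightarrow> real"
    using that by (force simp: indicator_def)
  have "(\<lambda>n. integral\<^sup>L lebesgue (dq i (step n) \<phi>)) \<longlonglongrightarrow> integral\<^sup>L lebesgue (partial_deriv i \<phi>)"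
    using tends_l2_inner[OF t(1) tends_l2_const[OF l2_indicator_cball[of 1 0 R]]] by (simp only: I R)
  moreover have "integral\<^sup>L lebesgue (dq i s \<phi>) = 0" for s
  proof -
    have "(LINT x|lebesgue. \<phi> (x + s *\<^sub>R axis i 1) - \<phi> x) = 0"
      using integral_translate[OF test_measurable[OF assms], of "s *\<^sub>R axis i 1"] test_l2(2)[OF assms]
      by (subst Bochner_Integration.integral_diff) auto
    then show ?thesis unfolding dq_def by simp
  qed
  ultimately show ?thesis using LIMSEQ_unique[OF _ tendsto_const, of 0] by simp
qed

lemma ibp_test:
  assumes "\<phi> \<in> test_functions U" "\<psi> \<in> test_functions V"
  shows "(LINT x|lebesgue. \<phi> x * partial_deriv i \<psi> x) = - (LINT x|lebesgue. partial_deriv i \<phi> x * \<psi> x)"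
proof -
  have "partial_deriv i (\<lambda>x. \<phi> x * \<psi> x) = (\<lambda>x. \<phi> x * partial_deriv i \<psi> x + partial_deriv i \<phi> x * \<psi> x)"
    using assms by (intro smooth_partial_deriv_mult test_smooth)
  moreover have "integral\<^sup>L lebesgue (partial_deriv i (\<lambda>x. \<phi> x * \<psi> x)) = 0"
    by (rule integral_partial_deriv[OF test_smooth_mult[OF assms(1) test_smooth[OF assms(2)]]])
  moreover have "(LINT x|lebesgue. \<phi> x * partial_deriv i \<psi> x + partial_deriv i \<phi> x * \<psi> x)
    = (LINT x|lebesgue. \<phi> x * partial_deriv i \<psi> x) + (LINT x|lebesgue. partial_deriv i \<phi> x * \<psi> x)"
    by (intro Bochner_Integration.integral_add l2_mult_integrable test_l2(1)[OF assms(1)] test_l2(1)[OF assms(2)]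
        test_l2(1)[OF test_partial_deriv[OF assms(1)]] test_l2(1)[OF test_partial_deriv[OF assms(2)]])
  ultimately show ?thesis by simp
qed

section \<open>The fundamental lemma of the calculus of variations\<close>

text \<open>F is an almost everywhere limit of continuous functions; these are clipped to [-1, 1]
  and replaced by polynomials on a ball containing the support of \<psi>, and the factor \<psi>
  restores compact support. The 2 in the bound is 1 from clipping plus an approximation error of at
  most 1.\<close>

lemma test_approx:
  assumes F: "F \<in> borel_measurable lebesgue" "\<And>x. \<bar>F x\<bar> \<le> 1" and \<psi>: "\<psi> \<in> test_functions U"
  obtains \<phi> where "\<And>n. \<phi> n \<in> test_functions U" "\<And>n x. \<bar>\<phi> n x\<bar> \<le> \<bar>2 * \<psi> x\<bar>"
    "AE x in lebesgue. (\<lambda>n. \<phi> n x) \<longlonglongrightarrow> \<psi> x * F x"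
proof -
  obtain R where R: "\<And>x. norm x \<ge> R \<Longrightarrow> \<psi> x = 0" using test_support_bounded[OF \<psi>] by metis
  have "F measurable_on UNIV" by (intro lebesgue_measurable_imp_measurable_on F) auto
  then obtain N g where N: "negligible N" and g: "\<And>n. continuous_on UNIV (g n)"
    and gF: "\<And>x. x \<notin> N \<Longrightarrow> (\<lambda>n. g n x) \<longlonglongrightarrow> F x"
    unfolding measurable_on_def by auto
  define h where "h n x = max (-1) (min 1 (g n x))" for n x
  have h: "continuous_on (cball 0 R) (h n)" for n
    unfolding h_def using continuous_on_subset[OF g] by (intro continuous_intros) auto
  have "\<exists>p. real_polynomial_function p \<and> (\<forall>x\<in>cball 0 R. \<bar>h n x - p x\<bar> < step n)" for n
    using Stone_Weierstrass_real_polynomial_function[OF compact_cball h, of "step n"] step(4) by metis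
  then obtain p where p: "\<And>n. real_polynomial_function (p n)"
    "\<And>n x. norm x \<le> R \<Longrightarrow> \<bar>h n x - p n x\<bar> < step n" by (metis mem_cball_0)
  show thesis
  proof
    show "(\<lambda>x. \<psi> x * p n x) \<in> test_functions U" for n
      by (intro test_smooth_mult \<psi> smooth_real_polynomial_function p)
    show "\<bar>\<psi> x * p n x\<bar> \<le> \<bar>2 * \<psi> x\<bar>" for n x
    proof (cases "norm x \<le> R")
      case True
      have "\<bar>h n x\<bar> \<le> 1" by (auto simp: h_def)
      then have "\<bar>p n x\<bar> \<le> 2" using p(2)[OF True, of n] step(3)[of n] by linarith
      then show ?thesis by (simp add: abs_mult mult.commute mult_left_mono)
    qed (simp add: R)
    show "AE x in lebesgue. (\<lambda>n. \<psi> x * p n x) \<longlonglongrightarrow> \<psi> x * F x"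
    proof (rule AE_I')
      show "N \<in> null_sets lebesgue" using N by (simp add: negligible_iff_null_sets)
      have "(\<lambda>n. \<psi> x * p n x) \<longlonglongrightarrow> \<psi> x * F x" if "x \<notin> N" for x
      proof (cases "norm x \<le> R")
        case True
        have "(\<lambda>n. h n x) \<longlonglongrightarrow> max (-1) (min 1 (F x))"
          unfolding h_def by (intro tendsto_intros gF that)
        then have 1: "(\<lambda>n. h n x) \<longlonglongrightarrow> F x" using F(2)[of x] by (simp add: abs_le_iff)
        have "(\<lambda>n. h n x - p n x) \<longlonglongrightarrow> 0"
          by (rule Lim_null_comparison[OF _ step(1)])
            (use p(2)[OF True] in \<open>auto intro!: always_eventually less_imp_le\<close>)
        from tendsto_diff[OF 1 this] have "(\<lambda>n. p n x) \<longlonglongrightarrow> F x" by simp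
        then show ?thesis by (intro tendsto_intros)
      qed (simp add: R)
      then show "{x \<in> space lebesgue. \<not> (\<lambda>n. \<psi> x * p n x) \<longlonglongrightarrow> \<psi> x * F x} \<subseteq> N" by auto
    qed
  qed
qed

text \<open>The weight a lets a bound by a weighted L1 norm be localised, beyond the case a = 0 of
  the usual lemma. It is this form that later confines the density of L to {w = 0}.\<close>

lemma fundamental_lemma_bound:
  assumes Q: "l2 lebesgue Q" and a: "l2 lebesgue a" "\<And>x. a x \<ge> 0"
    and le: "\<And>\<psi>. \<psi> \<in> test_functions UNIV \<Longrightarrow>
      \<bar>(LINT x|lebesgue. Q x * \<psi> x)\<bar> \<le> (LINT x|lebesgue. a x * \<bar>\<psi> x\<bar>)"
  shows "AE x in lebesgue. \<bar>Q x\<bar> \<le> a x"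
proof -
  have "AE x in lebesgue. norm x \<le> real n + 1 \<longrightarrow> \<bar>Q x\<bar> \<le> a x" for n
  proof -
    obtain \<psi> where \<psi>: "\<psi> \<in> test_functions (UNIV :: (real^'a) set)" 
      and \<psi>1: "\<And>x. norm x \<le> real n + 1 \<Longrightarrow> \<psi> x = 1" and \<psi>0: "\<And>x. 0 \<le> \<psi> x"
      by (rule test_plateau[of "real n + 1"]) (simp, blast)
    \<comment> \<open>F is the sign of Q on {|Q| > a} and 0 elsewhere, so that Q F - a |F| is the
      positive part of |Q| - a. Testing with approximations of \<psi> F shows that its integral
      against \<psi> is at most 0.\<close>
    define F where "F x = (if a x < Q x then 1 else if Q x < - a x then -1 else 0 :: real)" for x
    have F: "F \<in> borel_measurable lebesgue" "\<bar>F x\<bar> \<le> 1" for x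
    proof -
      note [measurable] = l2_measurable[OF Q] l2_measurable[OF a(1)]
      show "F \<in> borel_measurable lebesgue" unfolding F_def by measurable
    qed (auto simp: F_def)
    obtain \<phi> where \<phi>: "\<And>k. \<phi> k \<in> test_functions UNIV" "\<And>k x. \<bar>\<phi> k x\<bar> \<le> \<bar>2 * \<psi> x\<bar>"
      "AE x in lebesgue. (\<lambda>k. \<phi> k x) \<longlonglongrightarrow> \<psi> x * F x"
      using test_approx[OF F \<psi>] by blast
    have m: "(\<lambda>x. \<psi> x * F x) \<in> borel_measurable lebesgue"
      using F test_measurable[OF \<psi>] by simp
    have t1: "tends_l2 lebesgue \<phi> (\<lambda>x. \<psi> x * F x)"
      by (rule tends_l2_dominated[OF test_measurable[OF \<phi>(1)] m l2_cmult[OF test_l2(1)[OF \<psi>], of 2]])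
        (use \<phi> in auto)
    have t2: "tends_l2 lebesgue (\<lambda>k x. \<bar>\<phi> k x\<bar>) (\<lambda>x. \<bar>\<psi> x * F x\<bar>)"
    proof (rule tends_l2_dominated[OF _ _ l2_cmult[OF test_l2(1)[OF \<psi>], of 2]])
      show "AE x in lebesgue. (\<lambda>k. \<bar>\<phi> k x\<bar>) \<longlonglongrightarrow> \<bar>\<psi> x * F x\<bar>"
        using \<phi>(3) by eventually_elim (rule tendsto_rabs)
    qed (use \<phi> m test_measurable[OF \<phi>(1)] in auto)
    have l: "l2 lebesgue (\<lambda>x. \<psi> x * F x)" "l2 lebesgue (\<lambda>x. \<bar>\<psi> x * F x\<bar>)"
      using t1 t2 by (auto simp: tends_l2_def)
    have "(LINT x|lebesgue. Q x * (\<psi> x * F x)) \<le> (LINT x|lebesgue. a x * \<bar>\<psi> x * F x\<bar>)"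
    proof (rule LIMSEQ_le)
      show "(\<lambda>k. (LINT x|lebesgue. Q x * \<phi> k x)) \<longlonglongrightarrow> (LINT x|lebesgue. Q x * (\<psi> x * F x))"
        by (rule tends_l2_inner[OF tends_l2_const[OF Q] t1])
      show "(\<lambda>k. (LINT x|lebesgue. a x * \<bar>\<phi> k x\<bar>)) \<longlonglongrightarrow> (LINT x|lebesgue. a x * \<bar>\<psi> x * F x\<bar>)"
        by (rule tends_l2_inner[OF tends_l2_const[OF a(1)] t2])
    qed (use le[OF \<phi>(1)] in \<open>auto intro!: exI[of _ 0] simp: abs_le_iff\<close>)
    moreover have "(LINT x|lebesgue. Q x * (\<psi> x * F x) - a x * \<bar>\<psi> x * F x\<bar>) =
      (LINT x|lebesgue. Q x * (\<psi> x * F x)) - (LINT x|lebesgue. a x * \<bar>\<psi> x * F x\<bar>)"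
      by (intro Bochner_Integration.integral_diff l2_mult_integrable Q a l)
    ultimately have le0: "(LINT x|lebesgue. Q x * (\<psi> x * F x) - a x * \<bar>\<psi> x * F x\<bar>) \<le> 0" by simp
    have eq: "Q x * (\<psi> x * F x) - a x * \<bar>\<psi> x * F x\<bar> = (if \<bar>Q x\<bar> > a x then \<psi> x * (\<bar>Q x\<bar> - a x) else 0)" for x
      using a(2)[of x] \<psi>0[of x] by (cases "Q x" "0::real" rule: linorder_cases) (auto simp: F_def algebra_simps)
    have nn: "Q x * (\<psi> x * F x) - a x * \<bar>\<psi> x * F x\<bar> \<ge> 0" for x
      unfolding eq using \<psi>0[of x] by auto
    have "(LINT x|lebesgue. Q x * (\<psi> x * F x) - a x * \<bar>\<psi> x * F x\<bar>) = 0"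
      using le0 nn by (intro antisym Bochner_Integration.integral_nonneg) auto
    then have "AE x in lebesgue. Q x * (\<psi> x * F x) - a x * \<bar>\<psi> x * F x\<bar> = 0"
      using nn by (subst (asm) integral_nonneg_eq_0_iff_AE)
        (auto intro!: Bochner_Integration.integrable_diff l2_mult_integrable Q a l)
    then show ?thesis
    proof eventually_elim
      case (elim x)
      then show ?case using \<psi>1[of x] by (auto simp: eq split: if_splits)
    qed
  qed
  then have "AE x in lebesgue. \<forall>n::nat. norm x \<le> real n + 1 \<longrightarrow> \<bar>Q x\<bar> \<le> a x"
    unfolding AE_all_countable by blast
  then show ?thesis
  proof eventually_elim
    case (elim x)
    obtain n :: nat where "norm x \<le> real n" using real_arch_simple by blast
    then show ?case using elim[rule_format, of n] by simp
  qed
qed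

lemma fundamental_lemma:
  assumes "l2 lebesgue Q" "\<And>\<psi>. \<psi> \<in> test_functions UNIV \<Longrightarrow> (LINT x|lebesgue. Q x * \<psi> x) = 0"
  shows "AE x in lebesgue. Q x = 0"
  using fundamental_lemma_bound[OF assms(1), of "\<lambda>x. 0"] assms(2) by simp

section \<open>Limits of test functions in the Sobolev norm\<close>

text \<open>\<open>sobolev0 U u G\<close> says that test functions supported in \<open>U\<close> converge to \<open>u\<close> in \<open>H\<^sup>1\<close> with
  gradients converging to \<open>G\<close>, all functions living on the whole space.\<close>

definition sobolev0 :: "(real^'n) set \<Rightarrow> (real^'n \<Rightarrow> real) \<Rightarrow> ('n \<Rightarrow> real^'n \<Rightarrow> real) \<Rightarrow> bool" where
  "sobolev0 U u G \<longleftrightarrow> l2 lebesgue u \<and> (\<forall>i. l2 lebesgue (G i)) \<and>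
    (\<forall>e>0. \<exists>\<phi>\<in>test_functions U. nsq lebesgue (\<lambda>x. \<phi> x - u x) +
       (\<Sum>i\<in>UNIV. nsq lebesgue (\<lambda>x. partial_deriv i \<phi> x - G i x)) < e)"

lemma sobolev0_l2: "sobolev0 U u G \<Longrightarrow> l2 lebesgue u" "sobolev0 U u G \<Longrightarrow> l2 lebesgue (G i)"
  by (auto simp: sobolev0_def)

lemma sobolev0D:
  assumes "sobolev0 U u G" "e > 0"
  obtains \<phi> where "\<phi> \<in> test_functions U" "nsq lebesgue (\<lambda>x. \<phi> x - u x) +
       (\<Sum>i\<in>UNIV. nsq lebesgue (\<lambda>x. partial_deriv i \<phi> x - G i x)) < e"
  using assms(1)[unfolded sobolev0_def, THEN conjunct2, THEN conjunct2, rule_format, OF assms(2)] that by (elim bexE)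

lemma sobolev0_seqD:
  assumes "sobolev0 U u G"
  obtains \<phi> where "\<And>n. \<phi> n \<in> test_functions U" "tends_l2 lebesgue \<phi> u"
    "\<And>i. tends_l2 lebesgue (\<lambda>n. partial_deriv i (\<phi> n)) (G i)"
proof -
  have "\<forall>n. \<exists>\<phi>\<in>test_functions U. nsq lebesgue (\<lambda>x. \<phi> x - u x) +
       (\<Sum>i\<in>UNIV. nsq lebesgue (\<lambda>x. partial_deriv i \<phi> x - G i x)) < step n"
    by (auto intro: sobolev0D[OF assms step(4)])
  then obtain \<phi> where \<phi>: "\<And>n. \<phi> n \<in> test_functions U"
    and le: "\<And>n. nsq lebesgue (\<lambda>x. \<phi> n x - u x) +
       (\<Sum>i\<in>UNIV. nsq lebesgue (\<lambda>x. partial_deriv i (\<phi> n) x - G i x)) < step n"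
    unfolding Bex_def choice_iff by auto
  have s: "nsq lebesgue (\<lambda>x. partial_deriv j (\<phi> n) x - G j x) \<le>
    (\<Sum>i\<in>UNIV. nsq lebesgue (\<lambda>x. partial_deriv i (\<phi> n) x - G i x))" for j n
    by (intro member_le_sum) auto
  have s0: "0 \<le> (\<Sum>i\<in>UNIV. nsq lebesgue (\<lambda>x. partial_deriv i (\<phi> n) x - G i x))" for n
    by (intro sum_nonneg) auto
  have 1: "nsq lebesgue (\<lambda>x. \<phi> n x - u x) \<le> step n"
    "nsq lebesgue (\<lambda>x. partial_deriv j (\<phi> n) x - G j x) \<le> step n" for n j
    using le[of n] s[of j n] s0[of n] nsq_nonneg[of lebesgue "\<lambda>x. \<phi> n x - u x"] by linarith+
  show thesis
  proof
    show "\<phi> n \<in> test_functions U" for n by (rule \<phi>)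
    show "tends_l2 lebesgue \<phi> u"
      unfolding tends_l2_def using test_l2(1)[OF \<phi>] sobolev0_l2[OF assms] 1(1)
      by (auto intro: tendsto_sandwich[OF _ _ tendsto_const step(1)])
    show "tends_l2 lebesgue (\<lambda>n. partial_deriv i (\<phi> n)) (G i)" for i
      unfolding tends_l2_def using test_l2(1)[OF test_partial_deriv[OF \<phi>]] sobolev0_l2[OF assms] 1(2)
      by (auto intro: tendsto_sandwich[OF _ _ tendsto_const step(1)])
  qed
qed

lemma sobolev0_test:
  assumes "\<phi> \<in> test_functions U"
  shows "sobolev0 U \<phi> (\<lambda>i. partial_deriv i \<phi>)"
  unfolding sobolev0_def using test_l2(1)[OF assms] test_l2(1)[OF test_partial_deriv[OF assms]] assms
  by (auto simp: nsq_def intro!: bexI[of _ \<phi>])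

text \<open>Limits of limits of test functions are limits of test functions. Both tolerances are e /
  4 because \<open>nsq_triangle\<close> doubles each squared distance.\<close>

lemma sobolev0_closed:
  assumes "\<And>n. sobolev0 U (F n) (H n)" "tends_l2 lebesgue F u"
    "\<And>i. tends_l2 lebesgue (\<lambda>n. H n i) (G i)"
  shows "sobolev0 U u G"
  unfolding sobolev0_def
proof (intro conjI allI impI)
  show lu: "l2 lebesgue u" and lG: "l2 lebesgue (G i)" for i
    using assms by (auto simp: tends_l2_def)
  fix e :: real assume e: "e > 0"
  let ?E = "\<lambda>n. nsq lebesgue (\<lambda>x. F n x - u x) + (\<Sum>i\<in>UNIV. nsq lebesgue (\<lambda>x. H n i x - G i x))"
  have "?E \<longlonglongrightarrow> 0 + (\<Sum>i\<in>(UNIV::'a set). 0)"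
    using assms(2,3) by (intro tendsto_intros) (auto simp: tends_l2_def)
  then have "\<forall>\<^sub>F n in sequentially. ?E n < e / 4"
    using e by (intro order_tendstoD(2)[of _ 0]) auto
  then obtain n where n: "?E n < e / 4" by (auto simp: eventually_sequentially)
  obtain \<phi> where \<phi>: "\<phi> \<in> test_functions U" "nsq lebesgue (\<lambda>x. \<phi> x - F n x) +
       (\<Sum>i\<in>UNIV. nsq lebesgue (\<lambda>x. partial_deriv i \<phi> x - H n i x)) < e / 4"
    by (rule sobolev0D[OF assms(1)[of n], of "e / 4"]) (use e in auto)
  have l: "l2 lebesgue (F n)" "l2 lebesgue (H n i)" "l2 lebesgue \<phi>" "l2 lebesgue (partial_deriv i \<phi>)" for i
    using sobolev0_l2[OF assms(1)] test_l2(1)[OF \<phi>(1)] test_l2(1)[OF test_partial_deriv[OF \<phi>(1)]] by auto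
  have "nsq lebesgue (\<lambda>x. \<phi> x - u x) + (\<Sum>i\<in>UNIV. nsq lebesgue (\<lambda>x. partial_deriv i \<phi> x - G i x))
    \<le> (2 * nsq lebesgue (\<lambda>x. \<phi> x - F n x) + 2 * nsq lebesgue (\<lambda>x. F n x - u x)) +
      (\<Sum>i\<in>UNIV. 2 * nsq lebesgue (\<lambda>x. partial_deriv i \<phi> x - H n i x) + 2 * nsq lebesgue (\<lambda>x. H n i x - G i x))"
    by (intro add_mono sum_mono nsq_triangle l lu lG)
  also have "\<dots> = 2 * (nsq lebesgue (\<lambda>x. \<phi> x - F n x) +
       (\<Sum>i\<in>UNIV. nsq lebesgue (\<lambda>x. partial_deriv i \<phi> x - H n i x))) + 2 * ?E n"
    by (simp add: sum.distrib sum_distrib_left algebra_simps)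
  also have "\<dots> < e"
    unfolding distrib_left[of 2] using \<phi>(2) n by linarith
  finally have "nsq lebesgue (\<lambda>x. \<phi> x - u x) +
       (\<Sum>i\<in>UNIV. nsq lebesgue (\<lambda>x. partial_deriv i \<phi> x - G i x)) < e" .
  then show "\<exists>\<phi>\<in>test_functions U. nsq lebesgue (\<lambda>x. \<phi> x - u x) +
       (\<Sum>i\<in>UNIV. nsq lebesgue (\<lambda>x. partial_deriv i \<phi> x - G i x)) < e"
    using \<phi>(1) by (rule bexI)
qed

lemma sobolev0_seqI:
  assumes "\<And>n. \<phi> n \<in> test_functions U" "tends_l2 lebesgue \<phi> u"
    "\<And>i. tends_l2 lebesgue (\<lambda>n. partial_deriv i (\<phi> n)) (G i)"
  shows "sobolev0 U u G"
  by (rule sobolev0_closed[OF sobolev0_test[OF assms(1)] assms(2,3)])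

lemma sobolev0_add:
  assumes "sobolev0 U u G" "sobolev0 U v H"
  shows "sobolev0 U (\<lambda>x. u x + v x) (\<lambda>i x. G i x + H i x)"
proof -
  obtain \<phi> where \<phi>: "\<And>n. \<phi> n \<in> test_functions U" "tends_l2 lebesgue \<phi> u"
    "\<And>i. tends_l2 lebesgue (\<lambda>n. partial_deriv i (\<phi> n)) (G i)" by (rule sobolev0_seqD[OF assms(1)]) blast
  obtain \<psi> where \<psi>: "\<And>n. \<psi> n \<in> test_functions U" "tends_l2 lebesgue \<psi> v"
    "\<And>i. tends_l2 lebesgue (\<lambda>n. partial_deriv i (\<psi> n)) (H i)" by (rule sobolev0_seqD[OF assms(2)]) blast
  show ?thesis
  proof (rule sobolev0_seqI[where \<phi>="\<lambda>n x. \<phi> n x + \<psi> n x"])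
    show "tends_l2 lebesgue (\<lambda>n. partial_deriv i (\<lambda>x. \<phi> n x + \<psi> n x)) (\<lambda>x. G i x + H i x)" for i
      using tends_l2_add[OF \<phi>(3) \<psi>(3), of i i]
      by (simp add: smooth_partial_deriv_add[OF test_smooth[OF \<phi>(1)] test_smooth[OF \<psi>(1)]])
  qed (intro test_add \<phi> \<psi> tends_l2_add)+
qed

text \<open>The last hypothesis leaves open how the factor changes supports: a constant keeps U,
  whereas a test function moves the product into its own set, which is how w gets localised.\<close>

lemma sobolev0_mult_smooth:
  assumes "sobolev0 U u G" "smooth \<eta>" "\<And>x. \<bar>\<eta> x\<bar> \<le> B" "\<And>i x. \<bar>partial_deriv i \<eta> x\<bar> \<le> B"
    and UV: "\<And>\<phi>. \<phi> \<in> test_functions U \<Longrightarrow> (\<lambda>x. \<eta> x * \<phi> x) \<in> test_functions V"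
  shows "sobolev0 V (\<lambda>x. \<eta> x * u x) (\<lambda>i x. \<eta> x * G i x + partial_deriv i \<eta> x * u x)"
proof -
  obtain \<phi> where \<phi>: "\<And>n. \<phi> n \<in> test_functions U" "tends_l2 lebesgue \<phi> u"
    "\<And>i. tends_l2 lebesgue (\<lambda>n. partial_deriv i (\<phi> n)) (G i)" by (rule sobolev0_seqD[OF assms(1)]) blast
  note m = smooth_measurable[OF assms(2)] smooth_measurable[OF smooth_partial_deriv[OF assms(2)]]
  show ?thesis
  proof (rule sobolev0_seqI[where \<phi>="\<lambda>n x. \<eta> x * \<phi> n x"])
    show "tends_l2 lebesgue (\<lambda>n x. \<eta> x * \<phi> n x) (\<lambda>x. \<eta> x * u x)"
      by (rule tends_l2_bounded_mult[OF \<phi>(2) m(1) _ m(1), of B]) (use assms(3) in auto)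
    have "tends_l2 lebesgue (\<lambda>n x. \<eta> x * partial_deriv i (\<phi> n) x + partial_deriv i \<eta> x * \<phi> n x)
       (\<lambda>x. \<eta> x * G i x + partial_deriv i \<eta> x * u x)" for i
      by (intro tends_l2_add tends_l2_bounded_mult[OF \<phi>(2) m(2) _ m(2), of _ B]
          tends_l2_bounded_mult[OF \<phi>(3) m(1) _ m(1), of B]) (use assms(3,4) in auto)
    then show "tends_l2 lebesgue (\<lambda>n. partial_deriv i (\<lambda>x. \<eta> x * \<phi> n x))
       (\<lambda>x. \<eta> x * G i x + partial_deriv i \<eta> x * u x)" for i
      by (simp add: smooth_partial_deriv_mult[OF assms(2) test_smooth[OF \<phi>(1)]])
  qed (intro UV \<phi>)
qed

lemma sobolev0_cmult:
  assumes "sobolev0 U u G"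
  shows "sobolev0 U (\<lambda>x. c * u x) (\<lambda>i x. c * G i x)"
  using sobolev0_mult_smooth[OF assms smooth_const, of c "\<bar>c\<bar>" U] by (simp add: test_cmult)

lemma sobolev0_diff:
  assumes "sobolev0 U u G" "sobolev0 U v H"
  shows "sobolev0 U (\<lambda>x. u x - v x) (\<lambda>i x. G i x - H i x)"
  using sobolev0_add[OF assms(1) sobolev0_cmult[OF assms(2), of "-1"]] by simp

lemma test_partial_bound:
  fixes \<phi> :: "real^'n \<Rightarrow> real"
  assumes "\<phi> \<in> test_functions U"
  obtains B where "\<And>x. \<bar>\<phi> x\<bar> \<le> B" "\<And>i x. \<bar>partial_deriv i \<phi> x\<bar> \<le> B" "B > 0"
proof -
  obtain A where A: "A > 0" "\<And>x. \<bar>\<phi> x\<bar> \<le> A" using test_bounded[OF assms] by metis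
  have "\<forall>i. \<exists>b. \<forall>x. \<bar>partial_deriv i \<phi> x\<bar> \<le> b" using test_bounded[OF test_partial_deriv[OF assms]] by metis
  then obtain b where b: "\<And>i x. \<bar>partial_deriv i \<phi> x\<bar> \<le> b i" by metis
  define S where "S = (\<Sum>i\<in>UNIV. \<bar>b i\<bar>)"
  have "\<bar>b i\<bar> \<le> S" for i
    unfolding S_def by (intro member_le_sum) auto
  then have S: "\<bar>partial_deriv i \<phi> x\<bar> \<le> S" for i x
    using b[of i x] by (meson abs_ge_self order_trans)
  have "S \<ge> 0" unfolding S_def by (intro sum_nonneg) auto
  show thesis
  proof (rule that[of "A + S"])
    show "\<bar>\<phi> x\<bar> \<le> A + S" for x using A(2)[of x] \<open>S \<ge> 0\<close> by linarith
    show "\<bar>partial_deriv i \<phi> x\<bar> \<le> A + S" for i x using S[of i x] A(1) by linarith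
    show "A + S > 0" using A(1) \<open>S \<ge> 0\<close> by linarith
  qed
qed

lemma sobolev0_mult_test:
  assumes "sobolev0 U u G" "\<eta> \<in> test_functions V"
  shows "sobolev0 V (\<lambda>x. \<eta> x * u x) (\<lambda>i x. \<eta> x * G i x + partial_deriv i \<eta> x * u x)"
proof -
  obtain B where "\<And>x. \<bar>\<eta> x\<bar> \<le> B" "\<And>i x. \<bar>partial_deriv i \<eta> x\<bar> \<le> B"
    using test_partial_bound[OF assms(2)] by metis
  then show ?thesis
    by (intro sobolev0_mult_smooth[OF assms(1) test_smooth[OF assms(2)]] test_smooth_mult[OF assms(2)])
      (auto intro: test_smooth)
qed

lemma tends_l2_translate:
  fixes F :: "nat \<Rightarrow> 'a::euclidean_space \<Rightarrow> real"
  assumes "tends_l2 lebesgue F f"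
  shows "tends_l2 lebesgue (\<lambda>n x. F n (x + a)) (\<lambda>x. f (x + a))"
  using assms l2_translate[OF l2_diff[of lebesgue "F _" f], of _ a] l2_translate(1)[of _ a]
  by (auto simp: tends_l2_def)

lemma sobolev0_translate:
  assumes "sobolev0 UNIV u G"
  shows "sobolev0 UNIV (\<lambda>x. u (x + a)) (\<lambda>i x. G i (x + a))"
proof -
  obtain \<phi> where \<phi>: "\<And>n. \<phi> n \<in> test_functions UNIV" "tends_l2 lebesgue \<phi> u"
    "\<And>i. tends_l2 lebesgue (\<lambda>n. partial_deriv i (\<phi> n)) (G i)" by (rule sobolev0_seqD[OF assms(1)]) blast
  show ?thesis
  proof (rule sobolev0_seqI[where \<phi>="\<lambda>n x. \<phi> n (x + a)"])
    show "tends_l2 lebesgue (\<lambda>n. partial_deriv i (\<lambda>x. \<phi> n (x + a))) (\<lambda>x. G i (x + a))" for i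
      using tends_l2_translate[OF \<phi>(3), of i a]
      by (simp add: smooth_partial_deriv_translate[OF test_smooth[OF \<phi>(1)]])
  qed (intro test_translate tends_l2_translate \<phi>)+
qed

section \<open>Integration by parts, chain rule and level sets for limits of test functions\<close>

lemma sobolev0_ibp:
  assumes "sobolev0 U u G" "\<psi> \<in> test_functions V"
  shows "(LINT x|lebesgue. u x * partial_deriv i \<psi> x) = - (LINT x|lebesgue. G i x * \<psi> x)"
proof -
  obtain \<phi> where \<phi>: "\<And>n. \<phi> n \<in> test_functions U" "tends_l2 lebesgue \<phi> u"
    "\<And>i. tends_l2 lebesgue (\<lambda>n. partial_deriv i (\<phi> n)) (G i)" by (rule sobolev0_seqD[OF assms(1)]) blast
  have 1: "(\<lambda>n. (LINT x|lebesgue. \<phi> n x * partial_deriv i \<psi> x)) \<longlonglongrightarrow> (LINT x|lebesgue. u x * partial_deriv i \<psi> x)"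
    by (intro tends_l2_inner \<phi> tends_l2_const test_l2(1)[OF test_partial_deriv[OF assms(2)]])
  have 2: "(\<lambda>n. - (LINT x|lebesgue. partial_deriv i (\<phi> n) x * \<psi> x)) \<longlonglongrightarrow> - (LINT x|lebesgue. G i x * \<psi> x)"
    by (intro tendsto_minus tends_l2_inner \<phi> tends_l2_const test_l2(1)[OF assms(2)])
  show ?thesis
    using LIMSEQ_unique[OF 1[unfolded ibp_test[OF \<phi>(1) assms(2)]] 2] .
qed

text \<open>\<open>T 0 = 0\<close> keeps supports compact and the bound on T' makes T a contraction.
  The factors \<open>T' (\<phi> n x)\<close> have no reason to converge in L2, so a subsequence
  converging almost everywhere is chosen and \<open>tends_l2_bounded_mult\<close> applies.\<close>

lemma sobolev0_chain:
  assumes "sobolev0 U u G"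
    and T: "\<And>t. (T has_real_derivative T' t) (at t)" "\<And>t. \<bar>T' t\<bar> \<le> 1" "continuous_on UNIV T'" "T 0 = 0"
    and sm: "\<And>\<phi> :: real^'n \<Rightarrow> real. smooth \<phi> \<Longrightarrow> smooth (\<lambda>x. T (\<phi> x))"
  shows "sobolev0 U (\<lambda>x::real^'n. T (u x)) (\<lambda>i x. T' (u x) * G i x)"
proof -
  obtain \<phi>' where \<phi>': "\<And>n. \<phi>' n \<in> test_functions U" "tends_l2 lebesgue \<phi>' u"
    "\<And>i. tends_l2 lebesgue (\<lambda>n. partial_deriv i (\<phi>' n)) (G i)" by (rule sobolev0_seqD[OF assms(1)]) blast
  obtain r where r: "strict_mono r" "AE x in lebesgue. (\<lambda>n. \<phi>' (r n) x) \<longlonglongrightarrow> u x"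
    by (rule tends_l2_AE_subseq[OF \<phi>'(2)])
  define \<phi> where "\<phi> n = \<phi>' (r n)" for n
  have \<phi>: "\<And>n. \<phi> n \<in> test_functions U" "tends_l2 lebesgue \<phi> u"
    "\<And>i. tends_l2 lebesgue (\<lambda>n. partial_deriv i (\<phi> n)) (G i)" "AE x in lebesgue. (\<lambda>n. \<phi> n x) \<longlonglongrightarrow> u x"
    unfolding \<phi>_def by (rule \<phi>'(1) r(2) tends_l2_subseq[OF \<phi>'(2) r(1)] tends_l2_subseq[OF \<phi>'(3) r(1)])+
  have lip: "\<bar>T a - T b\<bar> \<le> \<bar>a - b\<bar>" for a b
    using field_differentiable_bound[of UNIV T T' 1 a b] T(1,2) by auto
  have Tm: "T \<in> borel_measurable borel" "T' \<in> borel_measurable borel"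
    using T(1,3) DERIV_continuous_on[of UNIV T T'] by (auto intro!: borel_measurable_continuous_onI)
  have comp: "(\<lambda>x. T (f x)) \<in> borel_measurable lebesgue" "(\<lambda>x. T' (f x)) \<in> borel_measurable lebesgue"
    if "l2 lebesgue f" for f :: "real^'n \<Rightarrow> real"
    using measurable_compose[OF l2_measurable[OF that] Tm(1)] measurable_compose[OF l2_measurable[OF that] Tm(2)] by auto
  have l: "l2 lebesgue (\<phi> n)" "l2 lebesgue u" for n using \<phi>(2) by (auto simp: tends_l2_def)
  show ?thesis
  proof (rule sobolev0_seqI[where \<phi>="\<lambda>n x. T (\<phi> n x)"])
    show "(\<lambda>x. T (\<phi> n x)) \<in> test_functions U" for n
      by (rule test_compose[OF \<phi>(1) sm[OF test_smooth[OF \<phi>(1)]] T(4)])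
    have lT: "l2 lebesgue (\<lambda>x. T (f x))" if "l2 lebesgue f" for f :: "real^'n \<Rightarrow> real"
      by (rule l2_bound(1)[OF that comp(1)[OF that]]) (use lip[of _ 0] T(4) in auto)
    have "(\<lambda>n. nsq lebesgue (\<lambda>x. T (\<phi> n x) - T (u x))) \<longlonglongrightarrow> 0"
    proof (rule tendsto_sandwich[OF _ _ tendsto_const])
      show "(\<lambda>n. nsq lebesgue (\<lambda>x. \<phi> n x - u x)) \<longlonglongrightarrow> 0" using \<phi>(2) by (simp add: tends_l2_def)
      show "\<forall>\<^sub>F n in sequentially. nsq lebesgue (\<lambda>x. T (\<phi> n x) - T (u x)) \<le> nsq lebesgue (\<lambda>x. \<phi> n x - u x)"
        by (intro always_eventually allI l2_bound(2) l2_diff l borel_measurable_diff comp) (use lip in auto)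
    qed auto
    then show "tends_l2 lebesgue (\<lambda>n x. T (\<phi> n x)) (\<lambda>x. T (u x))"
      using lT l by (simp add: tends_l2_def)
    have "partial_deriv i (\<lambda>x. T (\<phi> n x)) = (\<lambda>x. T' (\<phi> n x) * partial_deriv i (\<phi> n) x)" for i n
      using partial_deriv_compose(2)[OF T(1)] smooth_differentiable[OF test_smooth[OF \<phi>(1)]] by blast
    moreover have "tends_l2 lebesgue (\<lambda>n x. T' (\<phi> n x) * partial_deriv i (\<phi> n) x) (\<lambda>x. T' (u x) * G i x)" for i
    proof (rule tends_l2_bounded_mult[OF \<phi>(3), of _ 1])
      have c: "isCont T' t" for t using T(3) by (simp add: continuous_on_eq_continuous_at)
      show "AE x in lebesgue. (\<lambda>n. T' (\<phi> n x)) \<longlonglongrightarrow> T' (u x)"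
        by (rule eventually_mono[OF \<phi>(4)]) (rule isCont_tendsto_compose[OF c])
    qed (use comp(2)[OF l(1)] comp(2)[OF l(2)] T(2) in auto)
    ultimately show "tends_l2 lebesgue (\<lambda>n. partial_deriv i (\<lambda>x. T (\<phi> n x))) (\<lambda>x. T' (u x) * G i x)" for i
      by simp
  qed
qed

text \<open>The truncations \<open>T\<^sub>d(s) = d\<^sup>2 s / (s\<^sup>2 + d\<^sup>2)\<close> tend to \<open>0\<close> uniformly while \<open>T\<^sub>d'\<close> tends to the
  indicator of \<open>{0}\<close>; hence \<open>(0, G \<chi>\<^bsub>{u = 0}\<^esub>)\<close> is again such a pair, and gradients are unique.\<close>

lemma sobolev0_gradient_zero:
  assumes "sobolev0 U u G"
  shows "AE x in lebesgue. u x = 0 \<longrightarrow> G i x = 0"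
proof -
  define T where "T n s = (step n)\<^sup>2 * s * inverse (s\<^sup>2 + (step n)\<^sup>2)" for n s
  define T' where "T' n s = (step n)\<^sup>2 * ((step n)\<^sup>2 - s\<^sup>2) * (inverse (s\<^sup>2 + (step n)\<^sup>2))\<^sup>2" for n s
  have d: "(step n)\<^sup>2 > 0" for n using step(2)[of n] by simp
  have pos: "s\<^sup>2 + (step n)\<^sup>2 > 0" for n s using d[of n] by (intro add_nonneg_pos) auto
  have T: "(T n has_real_derivative T' n t) (at t)" for n t
  proof -
    have "(T n has_real_derivative (step n)\<^sup>2 * inverse (t\<^sup>2 + (step n)\<^sup>2)
      + (step n)\<^sup>2 * t * - ((2 * t) * (inverse (t\<^sup>2 + (step n)\<^sup>2))\<^sup>2)) (at t)"
      unfolding T_def[abs_def] using pos[where s=t and n=n]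
      by (auto intro!: derivative_eq_intros simp: power2_eq_square)
    moreover have "(step n)\<^sup>2 * inverse (t\<^sup>2 + (step n)\<^sup>2) = (step n)\<^sup>2 * (t\<^sup>2 + (step n)\<^sup>2) * (inverse (t\<^sup>2 + (step n)\<^sup>2))\<^sup>2"
    proof -
      have "t\<^sup>2 + (step n)\<^sup>2 \<noteq> 0" using pos[where s=t and n=n] by linarith
      then show ?thesis unfolding power2_eq_square[of "inverse _"] by (metis mult.assoc mult.right_neutral right_inverse)
    qed
    moreover have "d * (t\<^sup>2 + d) * q\<^sup>2 + d * t * - (2 * t * q\<^sup>2) = d * (d - t\<^sup>2) * q\<^sup>2" for d q :: real
      by (simp add: algebra_simps power2_eq_square)
    ultimately show ?thesis by (simp only: T'_def)
  qed
  have T'b: "\<bar>T' n t\<bar> \<le> 1" for n t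
  proof -
    have "\<bar>(step n)\<^sup>2 * ((step n)\<^sup>2 - t\<^sup>2)\<bar> \<le> (t\<^sup>2 + (step n)\<^sup>2) * (t\<^sup>2 + (step n)\<^sup>2)"
      unfolding abs_mult using zero_le_power2[of t] zero_le_power2[of "step n"]
      by (intro mult_mono) (simp_all only: abs_le_iff, linarith+)
    then show ?thesis using pos[where s=t and n=n]
      unfolding T'_def abs_mult by (simp add: power_inverse divide_inverse[symmetric] power2_eq_square abs_mult)
  qed
  have Tb: "\<bar>T n t\<bar> \<le> step n" for n t
  proof -
    \<comment> \<open>The arithmetic-geometric mean inequality bounds |t| times
      \<open>step n\<close> by the denominator of T, which gives the uniform bound
      \<open>step n\<close>.\<close>
    have "2 * \<bar>t\<bar> * step n \<le> t\<^sup>2 + (step n)\<^sup>2" using sum_squares_bound[of "\<bar>t\<bar>" "step n"] by simp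
    then have "\<bar>t\<bar> * step n \<le> t\<^sup>2 + (step n)\<^sup>2" using mult_nonneg_nonneg[OF abs_ge_zero[of t] less_imp_le[OF step(4)[of n]]] by linarith
    then have "step n * (\<bar>t\<bar> * step n) \<le> step n * (t\<^sup>2 + (step n)\<^sup>2)" using step(4)[of n] by simp
    then show ?thesis using pos[where s=t and n=n]
      by (simp add: T_def abs_mult divide_inverse[symmetric] pos_divide_le_eq power2_eq_square algebra_simps)
  qed
  have T0: "T n 0 = 0" for n by (simp add: T_def)
  have sm: "smooth (\<lambda>x. T n (\<phi> x))" if "smooth \<phi>" for n and \<phi> :: "real^'a \<Rightarrow> real"
  proof -
    have "smooth (\<lambda>x. (step n)\<^sup>2 * \<phi> x * (\<phi> x * \<phi> x + (step n)\<^sup>2) powr (-1))"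
      using that pos by (intro smooth_mult smooth_powr smooth_add smooth_const) (auto simp: power2_eq_square)
    moreover have "(\<lambda>x. (step n)\<^sup>2 * \<phi> x * (\<phi> x * \<phi> x + (step n)\<^sup>2) powr (-1)) = (\<lambda>x. T n (\<phi> x))"
      using pos by (auto simp: T_def powr_minus power2_eq_square less_imp_le)
    ultimately show ?thesis by simp
  qed
  have cT': "continuous_on UNIV (T' n)" for n
    unfolding T'_def[abs_def] using pos[where n=n]
    by (intro continuous_intros) (auto simp: less_imp_neq[symmetric] simp del: sum_power2_eq_zero_iff)
  note lu = sobolev0_l2(1)[OF assms] and lG = sobolev0_l2(2)[OF assms]
  note [measurable] = l2_measurable[OF lu] l2_measurable[OF lG]
  have "sobolev0 U (\<lambda>x. 0) (\<lambda>i x. indicator {0} (u x) * G i x)"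
  proof (rule sobolev0_closed)
    show "sobolev0 U (\<lambda>x. T n (u x)) (\<lambda>i x. T' n (u x) * G i x)" for n
      by (rule sobolev0_chain[OF assms T T'b cT' T0 sm])
    show "tends_l2 lebesgue (\<lambda>n x. T n (u x)) (\<lambda>x. 0)"
    proof (rule tends_l2_dominated[OF _ _ lu])
      show "(\<lambda>x. T n (u x)) \<in> borel_measurable lebesgue" for n unfolding T_def by measurable
      have "\<bar>T n t\<bar> \<le> \<bar>t\<bar>" for n t
        using field_differentiable_bound[of UNIV "T n" "T' n" 1 t 0] T T'b T0 by auto
      then show "AE x in lebesgue. \<bar>T n (u x)\<bar> \<le> \<bar>u x\<bar>" for n by simp
      show "AE x in lebesgue. (\<lambda>n. T n (u x)) \<longlonglongrightarrow> 0"
        by (intro AE_I2 Lim_null_comparison[OF _ step(1)]) (simp add: Tb)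
    qed simp
    show "tends_l2 lebesgue (\<lambda>n x. T' n (u x) * G i x) (\<lambda>x. indicator {0} (u x) * G i x)" for i
    proof (rule tends_l2_bounded_mult[OF tends_l2_const[OF lG], of _ 1])
      show "(\<lambda>x. T' n (u x)) \<in> borel_measurable lebesgue" for n unfolding T'_def by measurable
      have lim: "(\<lambda>n. T' n t) \<longlonglongrightarrow> indicator {0} t" for t
      proof (cases "t = 0")
        case True
        then have "T' n t = 1" for n using step(2)[of n] by (simp add: T'_def power2_eq_square field_simps)
        then show ?thesis using True by simp
      next
        case False
        have "(\<lambda>n. T' n t) \<longlonglongrightarrow> 0\<^sup>2 * (0\<^sup>2 - t\<^sup>2) * (inverse (t\<^sup>2 + 0\<^sup>2))\<^sup>2"
          unfolding T'_def using False by (intro tendsto_intros step) auto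
        then show ?thesis using False by simp
      qed
      show "AE x in lebesgue. (\<lambda>n. T' n (u x)) \<longlonglongrightarrow> indicator {0} (u x)" using lim by simp
    qed (use T'b in auto)
  qed
  \<comment> \<open>The function of this pair is 0, so integration by parts makes its gradient
    orthogonal to every test function.\<close>
  then have "(LINT x|lebesgue. indicator {0} (u x) * G i x * \<psi> x) = 0"
    if "\<psi> \<in> test_functions UNIV" for \<psi>
    using sobolev0_ibp[OF _ that, of U "\<lambda>x. 0" "\<lambda>i x. indicator {0} (u x) * G i x" i] by simp
  moreover have "l2 lebesgue (\<lambda>x. indicator {0} (u x) * G i x)"
    by (rule l2_bounded_mult(1)[OF lG, of _ 1]) auto
  ultimately have "AE x in lebesgue. indicator {0} (u x) * G i x = 0"
    by (intro fundamental_lemma)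
  then show ?thesis by eventually_elim (auto simp: indicator_def)
qed

text \<open>The modulus is approximated by \<open>sqrt (s\<^sup>2 + d\<^sup>2) - d\<close> with d =
  \<open>step n\<close>; subtracting d secures the value 0 at 0. The derivatives stay in [-1, 1] and
  tend to \<open>sgn\<close>, including the value 0 at 0.\<close>

lemma sobolev0_abs:
  assumes "sobolev0 U u G"
  shows "sobolev0 U (\<lambda>x. \<bar>u x\<bar>) (\<lambda>i x. sgn (u x) * G i x)"
proof -
  define T where "T n s = sqrt (s\<^sup>2 + (step n)\<^sup>2) - step n" for n s
  define T' where "T' n s = s / sqrt (s\<^sup>2 + (step n)\<^sup>2)" for n s
  have d: "(step n)\<^sup>2 > 0" for n using step(2)[of n] by simp
  have pos: "s\<^sup>2 + (step n)\<^sup>2 > 0" for n s using d[of n] by (intro add_nonneg_pos) auto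
  have T: "(T n has_real_derivative T' n t) (at t)" for n t
    unfolding T_def[abs_def] T'_def using pos[where s=t and n=n]
    by (auto intro!: derivative_eq_intros simp: field_simps)
  have T'b: "\<bar>T' n t\<bar> \<le> 1" for n t
  proof -
    have "\<bar>t\<bar> = sqrt (t\<^sup>2)" by simp
    also have "\<dots> \<le> sqrt (t\<^sup>2 + (step n)\<^sup>2)" by (rule real_sqrt_le_mono) simp
    finally show ?thesis using pos[where s=t and n=n] by (simp add: T'_def)
  qed
  have T0: "T n 0 = 0" for n using step(4)[of n] by (simp add: T_def)
  have sm: "smooth (\<lambda>x. T n (\<phi> x))" if "smooth \<phi>" for n and \<phi> :: "real^'a \<Rightarrow> real"
  proof -
    have "smooth (\<lambda>x. (\<phi> x * \<phi> x + (step n)\<^sup>2) powr (1/2) - step n)"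
      using that pos by (intro smooth_diff smooth_mult smooth_powr smooth_add smooth_const) (auto simp: power2_eq_square)
    moreover have "(\<lambda>x. (\<phi> x * \<phi> x + (step n)\<^sup>2) powr (1/2) - step n) = (\<lambda>x. T n (\<phi> x))"
      using pos by (auto simp: T_def powr_half_sqrt power2_eq_square less_imp_le)
    ultimately show ?thesis by simp
  qed
  have cT': "continuous_on UNIV (T' n)" for n
    unfolding T'_def[abs_def] using pos[where n=n]
    by (intro continuous_intros) (auto simp: less_imp_neq[symmetric] simp del: sum_power2_eq_zero_iff)
  note lu = sobolev0_l2(1)[OF assms] and lG = sobolev0_l2(2)[OF assms]
  note [measurable] = l2_measurable[OF lu] l2_measurable[OF lG]
  show ?thesis
  proof (rule sobolev0_closed)
    show "sobolev0 U (\<lambda>x. T n (u x)) (\<lambda>i x. T' n (u x) * G i x)" for n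
      by (rule sobolev0_chain[OF assms T T'b cT' T0 sm])
    show "tends_l2 lebesgue (\<lambda>n x. T n (u x)) (\<lambda>x. \<bar>u x\<bar>)"
    proof (rule tends_l2_dominated[OF _ _ lu])
      show "(\<lambda>x. T n (u x)) \<in> borel_measurable lebesgue" for n unfolding T_def by measurable
      have "\<bar>T n t\<bar> \<le> \<bar>t\<bar>" for n t
        using field_differentiable_bound[of UNIV "T n" "T' n" 1 t 0] T T'b T0 by auto
      then show "AE x in lebesgue. \<bar>T n (u x)\<bar> \<le> \<bar>u x\<bar>" for n by simp
      have "(\<lambda>n. T n t) \<longlonglongrightarrow> sqrt (t\<^sup>2 + 0\<^sup>2) - 0" for t
        unfolding T_def by (intro tendsto_intros step)
      then show "AE x in lebesgue. (\<lambda>n. T n (u x)) \<longlonglongrightarrow> \<bar>u x\<bar>" by simp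
    qed simp
    show "tends_l2 lebesgue (\<lambda>n x. T' n (u x) * G i x) (\<lambda>x. sgn (u x) * G i x)" for i
    proof (rule tends_l2_bounded_mult[OF tends_l2_const[OF lG], of _ 1])
      show "(\<lambda>x. T' n (u x)) \<in> borel_measurable lebesgue" for n unfolding T'_def by measurable
      have "sgn (u x) = (if u x > 0 then 1 else if u x < 0 then -1 else 0)" for x by (auto simp: sgn_if)
      then show "(\<lambda>x. sgn (u x)) \<in> borel_measurable lebesgue" by simp
      have lim: "(\<lambda>n. T' n t) \<longlonglongrightarrow> sgn t" for t
      proof (cases "t = 0")
        case True
        then show ?thesis by (simp add: T'_def)
      next
        case False
        have "(\<lambda>n. T' n t) \<longlonglongrightarrow> t / sqrt (t\<^sup>2 + 0\<^sup>2)"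
          unfolding T'_def using False by (intro tendsto_intros step) auto
        then show ?thesis using False by (simp add: sgn_real_def abs_if split: if_splits)
      qed
      show "AE x in lebesgue. (\<lambda>n. T' n (u x)) \<longlonglongrightarrow> sgn (u x)" using lim by simp
    qed (use T'b in auto)
  qed
qed

section \<open>Second derivatives via difference quotients\<close>

lemma dq_alt: "dq i s f = (\<lambda>x. inverse s * (f (x + s *\<^sub>R axis i 1) - f x))"
  by (auto simp: dq_def divide_inverse)

lemma l2_dq: "l2 lebesgue f \<Longrightarrow> l2 lebesgue (dq i s f)"
  unfolding dq_alt by (intro l2_cmult l2_diff l2_translate)

lemma tends_l2_dq: "tends_l2 lebesgue F f \<Longrightarrow> tends_l2 lebesgue (\<lambda>n. dq i s (F n)) (dq i s f)"
  unfolding dq_alt by (intro tends_l2_cmult tends_l2_diff tends_l2_translate)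

lemma sobolev0_dq:
  "sobolev0 UNIV u G \<Longrightarrow> sobolev0 UNIV (dq i s u) (\<lambda>j. dq i s (G j))"
  unfolding dq_alt by (intro sobolev0_cmult sobolev0_diff sobolev0_translate)

text \<open>Discrete integration by parts: translation invariance moves the shift to the other
  factor and reverses it.\<close>

lemma dq_ibp:
  assumes "l2 lebesgue a" "l2 lebesgue b"
  shows "(LINT x|lebesgue. a x * dq i (-s) b x) = - (LINT x|lebesgue. dq i s a x * b x)"
proof -
  let ?h = "s *\<^sub>R axis i (1::real)"
  note l = l2_translate(1)[OF assms(1), of ?h] l2_translate(1)[OF assms(2), of "- ?h"]
  have "(LINT x|lebesgue. a x * b (x - ?h)) = (LINT x|lebesgue. a (x + ?h) * b x)"
    using integral_translate(1)[of "\<lambda>x. a x * b (x - ?h)" ?h] l2_measurable[OF l(2)] l2_measurable[OF assms(1)]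
    by simp
  moreover have "(LINT x|lebesgue. a x * dq i (-s) b x)
    = inverse (-s) * ((LINT x|lebesgue. a x * b (x - ?h)) - (LINT x|lebesgue. a x * b x))"
  proof -
    have "(\<lambda>x. a x * dq i (-s) b x) = (\<lambda>x. inverse (-s) * (a x * b (x + - ?h) - a x * b x))"
      by (auto simp: dq_alt algebra_simps)
    then show ?thesis
      using Bochner_Integration.integral_diff[OF l2_mult_integrable[OF assms(1) l(2)] l2_mult_integrable[OF assms]]
      by simp
  qed
  moreover have "(LINT x|lebesgue. dq i s a x * b x)
    = inverse s * ((LINT x|lebesgue. a (x + ?h) * b x) - (LINT x|lebesgue. a x * b x))"
  proof -
    have "(\<lambda>x. dq i s a x * b x) = (\<lambda>x. inverse s * (a (x + ?h) * b x - a x * b x))"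
      by (auto simp: dq_alt algebra_simps)
    then show ?thesis
      using Bochner_Integration.integral_diff[OF l2_mult_integrable[OF l(1) assms(2)] l2_mult_integrable[OF assms]]
      by simp
  qed
  ultimately show ?thesis by simp
qed

text \<open>The \<open>L\<^sup>2\<close> modulus of continuity is subadditive in the shift, so that long shifts are
  controlled by infinitesimal ones.\<close>

lemma nsq_dq_test_le:
  assumes "\<phi> \<in> test_functions U" "s \<noteq> 0" "\<bar>s\<bar> \<le> 1"
  shows "nsq lebesgue (dq i s \<phi>) \<le> nsq lebesgue (partial_deriv i \<phi>)"
proof -
  let ?e = "axis i (1::real)"
  define N where "N h = sqrt (nsq lebesgue (\<lambda>x. \<phi> (x + h *\<^sub>R ?e) - \<phi> x))" for h
  note l = test_l2(1)[OF assms(1)]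
  have lt: "l2 lebesgue (\<lambda>x. \<phi> (x + h *\<^sub>R ?e) - \<phi> x)" for h by (intro l2_diff l2_translate l)
  have sub: "N (g + h) \<le> N g + N h" for g h
  proof -
    have "N (g + h) = sqrt (nsq lebesgue (\<lambda>x. (\<phi> ((x + h *\<^sub>R ?e) + g *\<^sub>R ?e) - \<phi> (x + h *\<^sub>R ?e)) + (\<phi> (x + h *\<^sub>R ?e) - \<phi> x)))"
      unfolding N_def by (simp add: algebra_simps)
    also have "\<dots> \<le> sqrt (nsq lebesgue (\<lambda>x. (\<phi> ((x + h *\<^sub>R ?e) + g *\<^sub>R ?e) - \<phi> (x + h *\<^sub>R ?e)))) + N h"
      unfolding N_def by (intro minkowski lt l2_translate(1)[OF lt])
    also have "nsq lebesgue (\<lambda>x. (\<phi> ((x + h *\<^sub>R ?e) + g *\<^sub>R ?e) - \<phi> (x + h *\<^sub>R ?e)))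
      = nsq lebesgue (\<lambda>x. \<phi> (x + g *\<^sub>R ?e) - \<phi> x)"
      by (rule l2_translate(2)[OF lt])
    finally show ?thesis by (simp add: N_def)
  qed
  have mult: "N (real n * h) \<le> real n * N h" for n h
  proof (induction n)
    case 0
    then show ?case by (simp add: N_def nsq_def)
  next
    case (Suc n)
    have "N (real (Suc n) * h) \<le> N (real n * h) + N h" using sub[of "real n * h" h] by (simp add: algebra_simps)
    with Suc show ?case by (simp add: algebra_simps)
  qed
  have Ndq: "N h = \<bar>h\<bar> * sqrt (nsq lebesgue (dq i h \<phi>))" if "h \<noteq> 0" for h
  proof -
    have "nsq lebesgue (dq i h \<phi>) = (inverse h)\<^sup>2 * (N h)\<^sup>2"
      unfolding dq_alt nsq_cmult N_def by simp
    moreover have "N h \<ge> 0" by (simp add: N_def)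
    ultimately show ?thesis using that by (simp add: real_sqrt_mult abs_inverse)
  qed
  \<comment> \<open>The shift s consists of n + 1 shifts of length \<open>s * step n\<close>;
    subadditivity and division by |s| compare the two quotients.\<close>
  have "sqrt (nsq lebesgue (dq i s \<phi>)) \<le> sqrt (nsq lebesgue (dq i (s * step n) \<phi>))" for n
  proof -
    have "real (Suc n) * (s * step n) = s" by (simp add: step_def del: of_nat_Suc)
    then have "N s \<le> real (Suc n) * N (s * step n)" using mult[of "Suc n" "s * step n"] by (simp only:)
    also have "\<dots> = real (Suc n) * \<bar>s * step n\<bar> * sqrt (nsq lebesgue (dq i (s * step n) \<phi>))"
      using assms(2) step(2)[of n] by (simp add: Ndq)
    also have "real (Suc n) * \<bar>s * step n\<bar> = \<bar>s\<bar>"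
      using step(4)[of n] by (simp add: abs_mult step_def del: of_nat_Suc)
    finally show ?thesis using assms(2) by (simp add: Ndq)
  qed
  moreover have "(\<lambda>n. sqrt (nsq lebesgue (dq i (s * step n) \<phi>))) \<longlonglongrightarrow> sqrt (nsq lebesgue (partial_deriv i \<phi>))"
  proof (intro tendsto_real_sqrt tends_l2_nsq tends_l2_dq_test(1)[OF assms(1)])
    show "(\<lambda>n. s * step n) \<longlonglongrightarrow> 0" using tendsto_mult_right_zero[OF step(1)] .
    show "\<bar>s * step n\<bar> \<le> 1" for n
      unfolding abs_mult using assms(3) step(3)[of n] by (intro mult_le_one) auto
  qed (use assms(2) step(2) in auto)
  ultimately have "sqrt (nsq lebesgue (dq i s \<phi>)) \<le> sqrt (nsq lebesgue (partial_deriv i \<phi>))"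
    by (intro LIMSEQ_le_const) auto
  then show ?thesis by simp
qed

lemma nsq_dq_le:
  assumes "sobolev0 UNIV u G" "s \<noteq> 0" "\<bar>s\<bar> \<le> 1"
  shows "nsq lebesgue (dq i s u) \<le> nsq lebesgue (G i)"
proof -
  obtain \<phi> where \<phi>: "\<And>n. \<phi> n \<in> test_functions UNIV" "tends_l2 lebesgue \<phi> u"
    "\<And>i. tends_l2 lebesgue (\<lambda>n. partial_deriv i (\<phi> n)) (G i)" by (rule sobolev0_seqD[OF assms(1)]) blast
  show ?thesis
    by (rule LIMSEQ_le[OF tends_l2_nsq[OF tends_l2_dq[OF \<phi>(2)]] tends_l2_nsq[OF \<phi>(3)]])
      (use nsq_dq_test_le[OF \<phi>(1) assms(2,3)] in auto)
qed

text \<open>By density the bound may be tested with elements that are not smooth, in particular with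
  second difference quotients of the function under study.\<close>

lemma gradient_form_bound_extend:
  fixes \<psi> :: "real^'n \<Rightarrow> real"
  assumes G: "\<And>j. l2 lebesgue (G j)" and \<psi>: "sobolev0 UNIV \<psi> \<Psi>"
    and C: "\<And>\<psi>. \<psi> \<in> test_functions (UNIV :: (real^'n) set) \<Longrightarrow>
      \<bar>\<Sum>j\<in>UNIV. (LINT x|lebesgue. G j x * partial_deriv j \<psi> x)\<bar> \<le> C * sqrt (nsq lebesgue \<psi>)"
  shows "\<bar>\<Sum>j\<in>UNIV. (LINT x|lebesgue. G j x * \<Psi> j x)\<bar> \<le> C * sqrt (nsq lebesgue \<psi>)"
proof -
  obtain \<phi> where \<phi>: "\<And>n. \<phi> n \<in> test_functions UNIV" "tends_l2 lebesgue \<phi> \<psi>"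
    "\<And>i. tends_l2 lebesgue (\<lambda>n. partial_deriv i (\<phi> n)) (\<Psi> i)" by (rule sobolev0_seqD[OF \<psi>]) blast
  show ?thesis
  proof (rule LIMSEQ_le)
    show "(\<lambda>n. \<bar>\<Sum>j\<in>UNIV. (LINT x|lebesgue. G j x * partial_deriv j (\<phi> n) x)\<bar>)
      \<longlonglongrightarrow> \<bar>\<Sum>j\<in>UNIV. (LINT x|lebesgue. G j x * \<Psi> j x)\<bar>"
      by (intro tendsto_rabs tendsto_sum tends_l2_inner tends_l2_const G \<phi>)
    show "(\<lambda>n. C * sqrt (nsq lebesgue (\<phi> n))) \<longlonglongrightarrow> C * sqrt (nsq lebesgue \<psi>)"
      by (intro tendsto_intros tends_l2_nsq \<phi>)
  qed (use C[OF \<phi>(1)] in auto)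
qed

text \<open>Nirenberg's argument. Testing with the second difference quotient of v turns the form,
  by \<open>dq_ibp\<close>, into minus the sum S of squared norms. The norm of that test element is
  at most the square root of S, so S is at most C times its own square root.\<close>

lemma nsq_dq_gradient_le:
  fixes v :: "real^'n \<Rightarrow> real"
  assumes v: "sobolev0 UNIV v G" and "C \<ge> 0"
    and C: "\<And>\<psi>. \<psi> \<in> test_functions (UNIV :: (real^'n) set) \<Longrightarrow>
      \<bar>\<Sum>j\<in>UNIV. (LINT x|lebesgue. G j x * partial_deriv j \<psi> x)\<bar> \<le> C * sqrt (nsq lebesgue \<psi>)"
    and s: "s \<noteq> 0" "\<bar>s\<bar> \<le> 1"
  shows "(\<Sum>j\<in>UNIV. nsq lebesgue (dq i s (G j))) \<le> C\<^sup>2"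
proof -
  note G = sobolev0_l2(2)[OF v]
  define S where "S = (\<Sum>j\<in>UNIV. nsq lebesgue (dq i s (G j)))"
  have S0: "S \<ge> 0" unfolding S_def by (intro sum_nonneg) auto
  note w = sobolev0_dq[OF v, of i s]
  let ?\<psi> = "dq i (-s) (dq i s v)"
  have "(LINT x|lebesgue. G j x * dq i (-s) (dq i s (G j)) x) = - nsq lebesgue (dq i s (G j))" for j
    using dq_ibp[OF G l2_dq[OF G], of j i s i s j] by (simp add: nsq_def power2_eq_square)
  then have "S \<le> C * sqrt (nsq lebesgue ?\<psi>)"
    using gradient_form_bound_extend[OF G sobolev0_dq[OF w, of i "-s"] C] by (simp add: S_def sum_negf)
  also have "\<dots> \<le> C * sqrt S"
  proof (intro mult_left_mono real_sqrt_le_mono \<open>C \<ge> 0\<close>)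
    \<comment> \<open>\<open>nsq_dq_le\<close> is applied to the quotient \<open>dq i s v\<close>,
      whose i-th derivative is \<open>dq i s (G i)\<close>.\<close>
    have "nsq lebesgue ?\<psi> \<le> nsq lebesgue (dq i s (G i))"
      by (rule nsq_dq_le[OF w]) (use s in auto)
    also have "\<dots> \<le> S" unfolding S_def by (intro member_le_sum) auto
    finally show "nsq lebesgue ?\<psi> \<le> S" .
  qed
  finally have le: "S \<le> C * sqrt S" .
  have "S \<le> C\<^sup>2"
  proof (cases "S = 0")
    case False
    then have "sqrt S > 0" using S0 by simp
    moreover have "sqrt S * sqrt S \<le> C * sqrt S" using le S0 by simp
    ultimately have "sqrt S \<le> C" by (meson mult_right_le_imp_le)
    then have "(sqrt S)\<^sup>2 \<le> C\<^sup>2" by (intro power_mono) (use S0 in auto)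
    then show ?thesis using S0 by simp
  qed simp
  then show ?thesis by (simp add: S_def)
qed

text \<open>Bounded sequences of pairs have no reason to converge; elements of almost minimal norm in a
  decreasing sequence of midpoint convex sets do, by the parallelogram law.\<close>

lemma sobolev0_minimizing_sequence:
  fixes K :: "nat \<Rightarrow> ((real^'n \<Rightarrow> real) \<times> ('n \<Rightarrow> real^'n \<Rightarrow> real)) set"
  assumes sob: "\<And>n z Z. (z, Z) \<in> K n \<Longrightarrow> sobolev0 U z Z"
    and mid: "\<And>n z Z y Y. (z, Z) \<in> K n \<Longrightarrow> (y, Y) \<in> K n \<Longrightarrow>
        (\<lambda>x. (1/2) * (z x + y x), \<lambda>j x. (1/2) * (Z j x + Y j x)) \<in> K n"
    and dec: "\<And>m n. n \<le> m \<Longrightarrow> K m \<subseteq> K n"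
    and D: "\<And>n. (d n, d' n) \<in> K n"
      "\<And>n. nsq lebesgue (d n) + (\<Sum>j\<in>UNIV. nsq lebesgue (d' n j)) \<le> B"
  shows "\<exists>p P q Q. (\<forall>n. (p n, P n) \<in> K n) \<and> tends_l2 lebesgue p q \<and>
    (\<forall>j. tends_l2 lebesgue (\<lambda>n. P n j) (Q j))"
proof -
  define E where "E z Z = nsq lebesgue z + (\<Sum>j\<in>UNIV. nsq lebesgue (Z j))" 
    for z :: "real^'n \<Rightarrow> real" and Z :: "'n \<Rightarrow> real^'n \<Rightarrow> real"
  have E0: "E z Z \<ge> 0" for z Z unfolding E_def by (intro add_nonneg_nonneg sum_nonneg) auto
  define e where "e n = Inf ((\<lambda>(z, Z). E z Z) ` K n)" for n
  have bdd: "bdd_below ((\<lambda>(z, Z). E z Z) ` K n)" for n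
    by (rule bdd_belowI[of _ 0]) (auto simp: E0)
  have ne: "(\<lambda>(z, Z). E z Z) ` K n \<noteq> {}" for n using D(1)[of n] by auto
  have e_le: "e n \<le> E z Z" if "(z, Z) \<in> K n" for n z Z
    unfolding e_def using bdd that by (intro cInf_lower) (auto intro: rev_image_eqI)
  \<comment> \<open>Shrinking sets push the infimum up, while the given elements keep it below B;
    hence the infima converge.\<close>
  have "e n \<le> e m" if "n \<le> m" for n m
    unfolding e_def by (intro cInf_superset_mono ne bdd image_mono dec that)
  then have inc: "incseq e" by (auto simp: incseq_def)
  have eB: "e n \<le> B" for n using e_le[OF D(1)] D(2)[of n] by (auto simp: E_def intro: order_trans)
  obtain L where L: "e \<longlonglongrightarrow> L" "\<And>n. e n \<le> L"
    using incseq_convergent[OF inc, of B] eB by metis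
  have "\<exists>zZ\<in>K n. (case zZ of (z, Z) \<Rightarrow> E z Z) < e n + step n" for n
    using cInf_lessD[OF ne, of n "e n + step n"] step(4)[of n] by (auto simp: e_def)
  then obtain zZ where zZ: "\<And>n. zZ n \<in> K n" "\<And>n. (case zZ n of (z, Z) \<Rightarrow> E z Z) < e n + step n" by metis
  define p where "p n = fst (zZ n)" for n
  define P where "P n = snd (zZ n)" for n
  have pK: "(p n, P n) \<in> K n" and pE: "E (p n) (P n) < e n + step n" for n
    using zZ[of n] by (auto simp: p_def P_def split: prod.splits)
  note lp = sobolev0_l2(1)[OF sob[OF pK]] and lP = sobolev0_l2(2)[OF sob[OF pK]]
  \<comment> \<open>Both elements lie in \<open>K n\<close>, so their midpoint has energy at least
    \<open>e n\<close>. The parallelogram law leaves 2 E(p n) + 2 E(p m) - 4 e n, where E(p n) < e n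
    + step n and E(p m) < L + step n.\<close>
  have close: "E (\<lambda>x. p n x - p m x) (\<lambda>j x. P n j x - P m j x) \<le> 2 * (L - e n) + 4 * step n"
    if "n \<le> m" for n m
  proof -
    have "(p m, P m) \<in> K n" using pK[of m] dec[OF that] by auto
    from e_le[OF mid[OF pK[of n] this]]
    have "4 * e n \<le> 4 * E (\<lambda>x. (1/2) * (p n x + p m x)) (\<lambda>j x. (1/2) * (P n j x + P m j x))" by simp
    also have "\<dots> = E (\<lambda>x. p n x + p m x) (\<lambda>j x. P n j x + P m j x)"
      unfolding E_def nsq_cmult by (simp add: power2_eq_square sum_distrib_left algebra_simps)
    finally have 1: "4 * e n \<le> E (\<lambda>x. p n x + p m x) (\<lambda>j x. P n j x + P m j x)" .
    have "E (\<lambda>x. p n x + p m x) (\<lambda>j x. P n j x + P m j x) + E (\<lambda>x. p n x - p m x) (\<lambda>j x. P n j x - P m j x)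
      = (nsq lebesgue (\<lambda>x. p n x + p m x) + nsq lebesgue (\<lambda>x. p n x - p m x)) +
        (\<Sum>j\<in>UNIV. nsq lebesgue (\<lambda>x. P n j x + P m j x) + nsq lebesgue (\<lambda>x. P n j x - P m j x))"
      by (simp add: E_def sum.distrib)
    also have "\<dots> = 2 * E (p n) (P n) + 2 * E (p m) (P m)"
      unfolding E_def nsq_parallelogram[OF lp lp] nsq_parallelogram[OF lP lP]
      by (simp add: sum.distrib sum_distrib_left)
    finally have 2: "E (\<lambda>x. p n x - p m x) (\<lambda>j x. P n j x - P m j x) \<le> 2 * E (p n) (P n) + 2 * E (p m) (P m) - 4 * e n"
      using 1 by linarith
    have "step m \<le> step n" using that by (simp add: step_def)
    then show ?thesis
      unfolding right_diff_distrib using 2 pE[of n] pE[of m] L(2)[of m] by linarith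
  qed
  have lim0: "(\<lambda>n. 2 * (L - e n) + 4 * step n) \<longlonglongrightarrow> 0"
  proof -
    have "(\<lambda>n. 2 * (L - e n) + 4 * step n) \<longlonglongrightarrow> 2 * (L - L) + 4 * 0"
      by (intro tendsto_intros L step)
    then show ?thesis by simp
  qed
  have cauchy: "\<exists>N. \<forall>m\<ge>N. \<forall>n\<ge>N. E (\<lambda>x. p m x - p n x) (\<lambda>j x. P m j x - P n j x) < \<epsilon>" if eps: "\<epsilon> > 0" for \<epsilon>
  proof -
    obtain N where N: "\<And>n. n \<ge> N \<Longrightarrow> 2 * (L - e n) + 4 * step n < \<epsilon>"
      using order_tendstoD(2)[OF lim0 eps] by (auto simp: eventually_sequentially)
    have sym: "E (\<lambda>x. p m x - p n x) (\<lambda>j x. P m j x - P n j x) = E (\<lambda>x. p n x - p m x) (\<lambda>j x. P n j x - P m j x)" for m n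
      unfolding E_def by (simp add: nsq_minus_commute[of _ "p m"] nsq_minus_commute[of _ "P m _"])
    have "E (\<lambda>x. p m x - p n x) (\<lambda>j x. P m j x - P n j x) < \<epsilon>" if "m \<ge> N" "n \<ge> N" for m n
    proof (cases "m \<le> n")
      case True
      from close[OF this] N[OF that(1)] show ?thesis by linarith
    next
      case False
      then have "n \<le> m" by simp
      from close[OF this] N[OF that(2)] show ?thesis unfolding sym by linarith
    qed
    then show ?thesis by blast
  qed
  have Ele: "nsq lebesgue z \<le> E z Z" "nsq lebesgue (Z j) \<le> E z Z" for z Z j
  proof -
    have "nsq lebesgue (Z j) \<le> (\<Sum>j\<in>UNIV. nsq lebesgue (Z j))" by (intro member_le_sum) auto
    moreover have "0 \<le> (\<Sum>j\<in>UNIV. nsq lebesgue (Z j))" by (intro sum_nonneg) auto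
    ultimately show "nsq lebesgue z \<le> E z Z" "nsq lebesgue (Z j) \<le> E z Z"
      using nsq_nonneg[of lebesgue z] by (auto simp: E_def intro: add_increasing)
  qed
  have c1: "\<exists>N. \<forall>m\<ge>N. \<forall>n\<ge>N. nsq lebesgue (\<lambda>x. p m x - p n x) < \<epsilon>" if eps: "\<epsilon> > 0" for \<epsilon>
  proof -
    obtain N where N: "\<And>m n. m \<ge> N \<Longrightarrow> n \<ge> N \<Longrightarrow> E (\<lambda>x. p m x - p n x) (\<lambda>j x. P m j x - P n j x) < \<epsilon>"
      using cauchy[OF eps] by blast
    show ?thesis
      by (intro exI[of _ N] allI impI) (rule order.strict_trans1[OF Ele(1) N])
  qed
  have c2: "\<exists>N. \<forall>m\<ge>N. \<forall>n\<ge>N. nsq lebesgue (\<lambda>x. P m j x - P n j x) < \<epsilon>" if eps: "\<epsilon> > 0" for \<epsilon> j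
  proof -
    obtain N where N: "\<And>m n. m \<ge> N \<Longrightarrow> n \<ge> N \<Longrightarrow> E (\<lambda>x. p m x - p n x) (\<lambda>j x. P m j x - P n j x) < \<epsilon>"
      using cauchy[OF eps] by blast
    show ?thesis
      by (intro exI[of _ N] allI impI)
        (rule order.strict_trans1[OF Ele(2)[of "\<lambda>j x. P _ j x - P _ j x"] N])
  qed
  obtain q where q: "tends_l2 lebesgue p q" by (rule l2_complete[OF lp c1])
  have "\<exists>g. tends_l2 lebesgue (\<lambda>n. P n j) g" for j
    by (rule l2_complete[of lebesgue "\<lambda>n. P n j", OF lP c2]) blast+
  then obtain Q where "\<And>j. tends_l2 lebesgue (\<lambda>n. P n j) (Q j)" by metis
  with pK q show ?thesis by blast
qed

text \<open>The quotients of v and of its gradient are bounded independently of the step. The strong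
  limit q of the almost minimal elements has the same pairings with test functions as
  \<open>G i\<close>, which identifies it and yields second derivatives.\<close>

lemma sobolev0_gradient:
  fixes v :: "real^'n \<Rightarrow> real"
  assumes v: "sobolev0 UNIV v G" and "C \<ge> 0"
    and C: "\<And>\<psi>. \<psi> \<in> test_functions (UNIV :: (real^'n) set) \<Longrightarrow>
      \<bar>\<Sum>j\<in>UNIV. (LINT x|lebesgue. G j x * partial_deriv j \<psi> x)\<bar> \<le> C * sqrt (nsq lebesgue \<psi>)"
  shows "\<exists>H. sobolev0 UNIV (G i) H"
proof -
  let ?T = "test_functions (UNIV :: (real^'n) set)"
  define I where "I z \<psi> = (LINT x|lebesgue. z x * \<psi> x)" for z \<psi> :: "real^'n \<Rightarrow> real"
  \<comment> \<open>\<open>K n\<close> plays the role of the closed convex hull of the n-th tail: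
    against each test function, z is no farther from \<open>G i\<close> than any common bound for
    the tail. This is stable under midpoints and still forces pairings to converge.\<close>
  define K where "K n = {(z, Z). sobolev0 UNIV z Z \<and> (\<forall>\<psi>\<in>?T. \<forall>b.
     (\<forall>m\<ge>n. \<bar>I (dq i (step m) v) \<psi> - I (G i) \<psi>\<bar> \<le> b) \<longrightarrow> \<bar>I z \<psi> - I (G i) \<psi>\<bar> \<le> b)}" for n
  note lv = sobolev0_l2(1)[OF v] and lG = sobolev0_l2(2)[OF v]
  have "\<exists>p P q Q. (\<forall>n. (p n, P n) \<in> K n) \<and> tends_l2 lebesgue p q \<and>
    (\<forall>j. tends_l2 lebesgue (\<lambda>n. P n j) (Q j))"
  proof (rule sobolev0_minimizing_sequence[of K UNIV "\<lambda>n. dq i (step n) v" "\<lambda>n j. dq i (step n) (G j)"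
        "nsq lebesgue (G i) + C\<^sup>2"])
    show "sobolev0 UNIV z Z" if "(z, Z) \<in> K n" for n z Z using that by (simp add: K_def)
    show "K m \<subseteq> K n" if "n \<le> m" for m n
    proof (clarify, simp add: K_def, intro ballI allI impI)
      fix z Z \<psi> b
      assume "sobolev0 UNIV z Z \<and> (\<forall>\<psi>\<in>?T. \<forall>b. (\<forall>k\<ge>m. \<bar>I (dq i (step k) v) \<psi> - I (G i) \<psi>\<bar> \<le> b) \<longrightarrow> \<bar>I z \<psi> - I (G i) \<psi>\<bar> \<le> b)"
        "\<psi> \<in> ?T" "\<forall>k\<ge>n. \<bar>I (dq i (step k) v) \<psi> - I (G i) \<psi>\<bar> \<le> b"
      with \<open>n \<le> m\<close> show "\<bar>I z \<psi> - I (G i) \<psi>\<bar> \<le> b" by (meson order_trans)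
    qed
    show "(dq i (step n) v, \<lambda>j. dq i (step n) (G j)) \<in> K n" for n
      using sobolev0_dq[OF v] by (auto simp: K_def)
    show "nsq lebesgue (dq i (step n) v) + (\<Sum>j\<in>UNIV. nsq lebesgue (dq i (step n) (G j))) \<le> nsq lebesgue (G i) + C\<^sup>2" for n
      by (intro add_mono nsq_dq_le[OF v] nsq_dq_gradient_le[OF v assms(2) C] step)
    show "(\<lambda>x. 1 / 2 * (z x + y x), \<lambda>j x. 1 / 2 * (Z j x + Y j x)) \<in> K n"
      if z: "(z, Z) \<in> K n" and y: "(y, Y) \<in> K n" for n z Z y Y
    proof -
      have s: "sobolev0 UNIV z Z" "sobolev0 UNIV y Y" using z y by (auto simp: K_def)
      have "\<bar>I (\<lambda>x. 1 / 2 * (z x + y x)) \<psi> - I (G i) \<psi>\<bar> \<le> b"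
        if \<psi>: "\<psi> \<in> ?T" and b: "\<forall>m\<ge>n. \<bar>I (dq i (step m) v) \<psi> - I (G i) \<psi>\<bar> \<le> b" for \<psi> b
      proof -
        have "I (\<lambda>x. 1 / 2 * (z x + y x)) \<psi> = (LINT x|lebesgue. 1 / 2 * (z x * \<psi> x + y x * \<psi> x))"
          unfolding I_def by (intro Bochner_Integration.integral_cong) (auto simp: algebra_simps)
        also have "\<dots> = 1 / 2 * (I z \<psi> + I y \<psi>)"
          unfolding I_def
          by (simp only: integral_mult_right_zero Bochner_Integration.integral_add[OF
              l2_mult_integrable[OF sobolev0_l2(1)[OF s(1)] test_l2(1)[OF \<psi>]]
              l2_mult_integrable[OF sobolev0_l2(1)[OF s(2)] test_l2(1)[OF \<psi>]]])
        finally have "I (\<lambda>x. 1 / 2 * (z x + y x)) \<psi> = 1 / 2 * (I z \<psi> + I y \<psi>)" .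
        moreover have "\<bar>I z \<psi> - I (G i) \<psi>\<bar> \<le> b" "\<bar>I y \<psi> - I (G i) \<psi>\<bar> \<le> b"
          using z y \<psi> b by (auto simp: K_def)
        ultimately show ?thesis by (simp add: abs_le_iff field_simps)
      qed
      then show ?thesis
        using sobolev0_cmult[OF sobolev0_add[OF s], of "1/2"] by (simp add: K_def)
    qed
  qed
  then obtain p P q Q where p: "\<And>n. (p n, P n) \<in> K n" and q: "tends_l2 lebesgue p q"
    and Q: "\<And>j. tends_l2 lebesgue (\<lambda>n. P n j) (Q j)" by blast
  have sq: "sobolev0 UNIV q Q"
    by (rule sobolev0_closed[OF _ q Q]) (use p in \<open>simp add: K_def\<close>)
  have lq: "l2 lebesgue q" by (rule sobolev0_l2(1)[OF sq])
  have "I q \<psi> = I (G i) \<psi>" if \<psi>: "\<psi> \<in> ?T" for \<psi>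
  proof -
    have lim: "(\<lambda>m. I (dq i (step m) v) \<psi>) \<longlonglongrightarrow> I (G i) \<psi>"
    proof -
      have "I (dq i (step m) v) \<psi> = - I v (dq i (- step m) \<psi>)" for m
        using dq_ibp[OF lv test_l2(1)[OF \<psi>], of i "step m"] by (simp add: I_def)
      moreover have "tends_l2 lebesgue (\<lambda>m. dq i (- step m) \<psi>) (partial_deriv i \<psi>)"
        by (rule tends_l2_dq_test(1)[OF \<psi>]) (use step tendsto_minus[OF step(1)] in auto)
      then have "(\<lambda>m. - I v (dq i (- step m) \<psi>)) \<longlonglongrightarrow> - I v (partial_deriv i \<psi>)"
        unfolding I_def by (intro tendsto_minus tends_l2_inner tends_l2_const lv)
      moreover have "- I v (partial_deriv i \<psi>) = I (G i) \<psi>"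
        using sobolev0_ibp[OF v \<psi>, of i] by (simp add: I_def)
      ultimately show ?thesis by simp
    qed
    have "(\<lambda>n. I (p n) \<psi>) \<longlonglongrightarrow> I (G i) \<psi>"
    proof (rule LIMSEQ_I)
      fix r :: real assume r: "r > 0"
      from LIMSEQ_D[OF lim, of "r / 2"] r obtain N where
        N: "\<And>m. m \<ge> N \<Longrightarrow> \<bar>I (dq i (step m) v) \<psi> - I (G i) \<psi>\<bar> < r / 2" by auto
      have "\<bar>I (p n) \<psi> - I (G i) \<psi>\<bar> \<le> r / 2" if "n \<ge> N" for n
      proof -
        have "\<forall>m\<ge>n. \<bar>I (dq i (step m) v) \<psi> - I (G i) \<psi>\<bar> \<le> r / 2" using N that by (meson less_imp_le order_trans)
        moreover have "\<And>b. (\<forall>m\<ge>n. \<bar>I (dq i (step m) v) \<psi> - I (G i) \<psi>\<bar> \<le> b) \<Longrightarrow> \<bar>I (p n) \<psi> - I (G i) \<psi>\<bar> \<le> b"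
          using p[of n] \<psi> by (simp add: K_def)
        ultimately show ?thesis by blast
      qed
      then show "\<exists>no. \<forall>n\<ge>no. norm (I (p n) \<psi> - I (G i) \<psi>) < r"
        using r by (intro exI[of _ N]) force
    qed
    moreover have "(\<lambda>n. I (p n) \<psi>) \<longlonglongrightarrow> I q \<psi>"
      unfolding I_def by (intro tends_l2_inner q tends_l2_const test_l2(1)[OF \<psi>])
    ultimately show ?thesis by (rule LIMSEQ_unique[symmetric])
  qed
  then have "(LINT x|lebesgue. (q x - G i x) * \<psi> x) = 0" if "\<psi> \<in> ?T" for \<psi>
    using that Bochner_Integration.integral_diff[OF l2_mult_integrable[OF lq test_l2(1)[OF that]]
        l2_mult_integrable[OF lG test_l2(1)[OF that]], of i]
    by (simp add: I_def left_diff_distrib)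
  from fundamental_lemma[OF l2_diff[OF lq lG] this]
  \<comment> \<open>\<open>sobolev0\<close> concerns the function \<open>G i\<close> itself, so the
    equality is next carried into the convergence rather than used on q.\<close>
  have "AE x in lebesgue. q x = G i x" by simp
  from tends_l2_cong_AE[OF q this l2_measurable[OF lG]]
  have "sobolev0 UNIV (G i) Q"
    by (intro sobolev0_closed[OF _ _ Q, of UNIV p]) (use p in \<open>auto simp: K_def\<close>)
  then show ?thesis by blast
qed

text \<open>F is minus the Laplacian of v, the trace of the second derivatives.
  \<open>sobolev0_gradient_zero\<close> is applied twice: {v = 0} lies in {G = 0} up to a null set,
  and there each \<open>H i i\<close> vanishes.\<close>

lemma laplacian_zero_on_level_set:
  fixes v :: "real^'n \<Rightarrow> real"
  assumes v: "sobolev0 UNIV v G" and "C \<ge> 0"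
    and C: "\<And>\<psi>. \<psi> \<in> test_functions (UNIV :: (real^'n) set) \<Longrightarrow>
      \<bar>\<Sum>j\<in>UNIV. (LINT x|lebesgue. G j x * partial_deriv j \<psi> x)\<bar> \<le> C * sqrt (nsq lebesgue \<psi>)"
  obtains F where "l2 lebesgue F" "AE x in lebesgue. v x = 0 \<longrightarrow> F x = 0"
    "\<And>\<psi>. \<psi> \<in> test_functions UNIV \<Longrightarrow>
      (\<Sum>j\<in>UNIV. (LINT x|lebesgue. G j x * partial_deriv j \<psi> x)) = (LINT x|lebesgue. F x * \<psi> x)"
proof -
  obtain H where H: "\<And>i. sobolev0 UNIV (G i) (H i)"
    using sobolev0_gradient[OF assms] by metis
  note lH = sobolev0_l2(2)[OF H]
  show thesis
  proof (rule that[of "\<lambda>x. - (\<Sum>i\<in>UNIV. H i i x)"])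
    show "l2 lebesgue (\<lambda>x. - (\<Sum>i\<in>UNIV. H i i x))"
      using l2_cmult[OF l2_sum[of UNIV lebesgue "\<lambda>i. H i i"], of "-1"] lH by simp
    have "AE x in lebesgue. \<forall>i. v x = 0 \<longrightarrow> G i x = 0"
      unfolding AE_all_countable using sobolev0_gradient_zero[OF v] by blast
    moreover have "AE x in lebesgue. \<forall>i. G i x = 0 \<longrightarrow> H i i x = 0"
      unfolding AE_all_countable using sobolev0_gradient_zero[OF H] by blast
    ultimately show "AE x in lebesgue. v x = 0 \<longrightarrow> - (\<Sum>i\<in>UNIV. H i i x) = 0"
      by eventually_elim simp
    show "(\<Sum>j\<in>UNIV. (LINT x|lebesgue. G j x * partial_deriv j \<psi> x))
      = (LINT x|lebesgue. - (\<Sum>i\<in>UNIV. H i i x) * \<psi> x)" if \<psi>: "\<psi> \<in> test_functions UNIV" for \<psi>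
    proof -
      have "(LINT x|lebesgue. - (\<Sum>i\<in>UNIV. H i i x) * \<psi> x)
        = - (\<Sum>i\<in>UNIV. (LINT x|lebesgue. H i i x * \<psi> x))"
        using l2_mult_integrable[OF lH test_l2(1)[OF \<psi>]]
        by (simp add: sum_distrib_right)
      then show ?thesis by (simp add: sobolev0_ibp[OF H \<psi>] sum_negf)
    qed
  qed
qed

section \<open>Weak gradients and \<open>H\<^sup>1\<^sub>0\<close>\<close>

lemma integral_lebesgue_on_eq:
  fixes g :: "'a::euclidean_space \<Rightarrow> real"
  assumes "S \<in> sets lebesgue" "\<And>x. x \<notin> S \<Longrightarrow> g x = 0"
  shows "integral\<^sup>L (lebesgue_on S) g = integral\<^sup>L lebesgue g"
proof -
  have "integral\<^sup>L (lebesgue_on S) g = (LINT x|lebesgue. indicator S x *\<^sub>R g x)"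
    using assms(1) by (intro integral_restrict_space) auto
  also have "(\<lambda>x. indicator S x *\<^sub>R g x) = g"
    using assms(2) by (force simp: indicator_def)
  finally show ?thesis .
qed

lemma AE_lebesgue_on_iff:
  "S \<in> sets lebesgue \<Longrightarrow> (AE x in lebesgue_on S. P x) \<longleftrightarrow> (AE x in lebesgue. x \<in> S \<longrightarrow> P x)"
  by (rule AE_restrict_space_iff) simp

lemma borel_measurable_zero_extension:
  fixes f :: "'a::euclidean_space \<Rightarrow> real"
  assumes "S \<in> sets lebesgue"
  shows "(\<lambda>x. if x \<in> S then f x else 0) \<in> borel_measurable lebesgue \<longleftrightarrow> f \<in> borel_measurable (lebesgue_on S)"
  using borel_measurable_if_lebesgue_on[of S UNIV f] assms by (simp add: lebesgue_on_UNIV_eq)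

lemma l2_zero_extension:
  fixes f :: "'a::euclidean_space \<Rightarrow> real"
  assumes "S \<in> sets lebesgue"
  shows "l2 lebesgue (\<lambda>x. if x \<in> S then f x else 0) \<longleftrightarrow> l2 (lebesgue_on S) f"
    "nsq lebesgue (\<lambda>x. if x \<in> S then f x else 0) = nsq (lebesgue_on S) f"
proof -
  have e: "(\<lambda>x. (if x \<in> S then f x else 0)\<^sup>2) = (\<lambda>x. indicator S x *\<^sub>R (f x)\<^sup>2)"
    by (auto simp: indicator_def)
  show "l2 lebesgue (\<lambda>x. if x \<in> S then f x else 0) \<longleftrightarrow> l2 (lebesgue_on S) f"
    unfolding l2_def borel_measurable_zero_extension[OF assms] e
    using integrable_restrict_space[of S lebesgue "\<lambda>x. (f x)\<^sup>2"] assms by simp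
  show "nsq lebesgue (\<lambda>x. if x \<in> S then f x else 0) = nsq (lebesgue_on S) f"
    unfolding nsq_def e using integral_restrict_space[of S lebesgue "\<lambda>x. (f x)\<^sup>2"] assms by simp
qed

lemma l2_lebesgue_on:
  fixes f :: "'a::euclidean_space \<Rightarrow> real"
  assumes "S \<in> sets lebesgue" "l2 lebesgue f"
  shows "l2 (lebesgue_on S) f" "nsq (lebesgue_on S) f \<le> nsq lebesgue f"
proof -
  have ae: "AE x in lebesgue. \<bar>if x \<in> S then f x else 0\<bar> \<le> \<bar>f x\<bar>" by (rule AE_I2) simp
  have m: "(\<lambda>x. if x \<in> S then f x else 0) \<in> borel_measurable lebesgue"
    unfolding borel_measurable_zero_extension[OF assms(1)]
    by (rule measurable_restrict_space1[OF l2_measurable[OF assms(2)]])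
  show "l2 (lebesgue_on S) f" "nsq (lebesgue_on S) f \<le> nsq lebesgue f"
    using l2_bound[OF assms(2) m ae] unfolding l2_zero_extension[OF assms(1)] .
qed

lemma L2_space_real: "f \<in> L2_space S \<longleftrightarrow> l2 (lebesgue_on S) f" for f :: "real^'n \<Rightarrow> real"
  by (simp add: L2_space_def l2_def)

lemma L2_norm_real: "(L2_norm S f)\<^sup>2 = nsq (lebesgue_on S) f" for f :: "real^'n \<Rightarrow> real"
  by (simp add: L2_norm_def nsq_def)

lemma norm_sq_vec: "(norm x)\<^sup>2 = (\<Sum>i\<in>UNIV. (x $ i)\<^sup>2)" for x :: "real^'n"
  unfolding power2_norm_eq_inner inner_vec_def by (simp add: power2_eq_square)

lemma L2_space_vec:
  "G \<in> L2_space S \<longleftrightarrow> (\<forall>i. l2 (lebesgue_on S) (\<lambda>x. G x $ i))" for G :: "real^'n \<Rightarrow> real^'n"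
proof
  assume G: "G \<in> L2_space S"
  then have m: "(\<lambda>x. G x $ i) \<in> borel_measurable (lebesgue_on S)" for i
    unfolding L2_space_def using measurable_compose[OF _ borel_measurable_nth] by blast
  have "integrable (lebesgue_on S) (\<lambda>x. (G x $ i)\<^sup>2)" for i
    by (rule Bochner_Integration.integrable_bound[of _ "\<lambda>x. (norm (G x))\<^sup>2"])
      (use G m in \<open>auto simp: L2_space_def abs_le_square_iff[symmetric] component_le_norm_cart\<close>)
  with m show "\<forall>i. l2 (lebesgue_on S) (\<lambda>x. G x $ i)" by (simp add: l2_def)
next
  assume l: "\<forall>i. l2 (lebesgue_on S) (\<lambda>x. G x $ i)"
  have "G \<in> borel_measurable (lebesgue_on S)"
  proof (subst borel_measurable_euclidean_space, rule ballI)
    fix b :: "real^'n" assume "b \<in> Basis"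
    then obtain i where "b = axis i 1" by (auto simp: Basis_vec_def)
    then show "(\<lambda>x. G x \<bullet> b) \<in> borel_measurable (lebesgue_on S)"
      using l by (simp add: inner_axis l2_def)
  qed
  with l show "G \<in> L2_space S" by (simp add: L2_space_def norm_sq_vec l2_def)
qed

lemma L2_norm_vec:
  fixes G :: "real^'n \<Rightarrow> real^'n"
  assumes "G \<in> L2_space S"
  shows "(L2_norm S G)\<^sup>2 = (\<Sum>i\<in>UNIV. nsq (lebesgue_on S) (\<lambda>x. G x $ i))"
proof -
  have "(L2_norm S G)\<^sup>2 = (LINT x|lebesgue_on S. (norm (G x))\<^sup>2)"
    by (simp add: L2_norm_def)
  also have "\<dots> = (\<Sum>i\<in>UNIV. (LINT x|lebesgue_on S. (G x $ i)\<^sup>2))"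
    unfolding norm_sq_vec using assms by (intro Bochner_Integration.integral_sum) (auto simp: L2_space_vec l2_def)
  finally show ?thesis by (simp add: nsq_def)
qed

text \<open>Membership in \<open>H1_space\<close> with the gradient made explicit and split into
  components, which avoids the choice inside \<open>weak_grad\<close>.\<close>

definition weak_pair :: "(real^'n) set \<Rightarrow> (real^'n \<Rightarrow> real) \<Rightarrow> ('n \<Rightarrow> real^'n \<Rightarrow> real) \<Rightarrow> bool" where
  "weak_pair S u G \<longleftrightarrow> l2 (lebesgue_on S) u \<and> (\<forall>i. l2 (lebesgue_on S) (G i)) \<and>
    (\<forall>\<phi>\<in>test_functions S. \<forall>i. (LINT x|lebesgue_on S. u x * partial_deriv i \<phi> x)
       = - (LINT x|lebesgue_on S. G i x * \<phi> x))"

lemma weak_pair_iff: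
  "weak_pair S u (\<lambda>i x. G x $ i) \<longleftrightarrow> u \<in> L2_space S \<and> G \<in> L2_space S \<and> is_weak_grad S u G"
  by (simp add: weak_pair_def L2_space_real L2_space_vec is_weak_grad_def)

lemma sobolev0_weak_pair:
  assumes "S \<in> sets lebesgue" "sobolev0 U u G"
  shows "weak_pair S u G"
  unfolding weak_pair_def
proof (intro conjI allI ballI)
  show "l2 (lebesgue_on S) u" "l2 (lebesgue_on S) (G i)" for i
    using l2_lebesgue_on(1)[OF assms(1)] sobolev0_l2[OF assms(2)] by auto
  fix \<phi> i assume \<phi>: "\<phi> \<in> test_functions S"
  have "(LINT x|lebesgue_on S. u x * partial_deriv i \<phi> x) = (LINT x|lebesgue. u x * partial_deriv i \<phi> x)"
    by (rule integral_lebesgue_on_eq[OF assms(1)]) (simp add: test_zero_outside[OF test_partial_deriv[OF \<phi>]])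
  moreover have "(LINT x|lebesgue_on S. G i x * \<phi> x) = (LINT x|lebesgue. G i x * \<phi> x)"
    by (rule integral_lebesgue_on_eq[OF assms(1)]) (simp add: test_zero_outside[OF \<phi>])
  ultimately show "(LINT x|lebesgue_on S. u x * partial_deriv i \<phi> x) = - (LINT x|lebesgue_on S. G i x * \<phi> x)"
    using sobolev0_ibp[OF assms(2) \<phi>] by simp
qed

lemma weak_pair_diff:
  assumes "S \<in> sets lebesgue" "weak_pair S u G" "weak_pair S v H"
  shows "weak_pair S (\<lambda>x. u x - v x) (\<lambda>i x. G i x - H i x)"
  unfolding weak_pair_def
proof (intro conjI allI ballI)
  have l: "l2 (lebesgue_on S) u" "l2 (lebesgue_on S) v" "l2 (lebesgue_on S) (G i)" "l2 (lebesgue_on S) (H i)" for i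
    using assms by (auto simp: weak_pair_def)
  show "l2 (lebesgue_on S) (\<lambda>x. u x - v x)" "l2 (lebesgue_on S) (\<lambda>x. G i x - H i x)" for i
    by (intro l2_diff l)+
  fix \<phi> i assume \<phi>: "\<phi> \<in> test_functions S"
  note t = l2_lebesgue_on(1)[OF assms(1) test_l2(1)[OF \<phi>]]
    l2_lebesgue_on(1)[OF assms(1) test_l2(1)[OF test_partial_deriv[OF \<phi>]]]
  show "(LINT x|lebesgue_on S. (u x - v x) * partial_deriv i \<phi> x) = - (LINT x|lebesgue_on S. (G i x - H i x) * \<phi> x)"
    unfolding left_diff_distrib
      Bochner_Integration.integral_diff[OF l2_mult_integrable[OF l(1) t(2)] l2_mult_integrable[OF l(2) t(2)]]
      Bochner_Integration.integral_diff[OF l2_mult_integrable[OF l(3) t(1)] l2_mult_integrable[OF l(4) t(1)]]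
    using assms(2,3) \<phi> by (simp add: weak_pair_def)
qed

text \<open>Countably many balls with closure in S cover S. On each, Q times a bump positive on the
  ball satisfies the hypothesis of the lemma on the whole space.\<close>

lemma l2_local_zero:
  assumes "open S" "l2 lebesgue Q" "\<And>\<phi>. \<phi> \<in> test_functions S \<Longrightarrow> (LINT x|lebesgue. Q x * \<phi> x) = 0"
  shows "AE x in lebesgue. x \<in> S \<longrightarrow> Q x = 0"
proof -
  define \<F> where "\<F> = {ball a r | a r. r > 0 \<and> cball a r \<subseteq> S}"
  obtain \<F>' where \<F>': "\<F>' \<subseteq> \<F>" "countable \<F>'" "\<Union>\<F>' = \<Union>\<F>"
    by (rule Lindelof[of \<F>]) (auto simp: \<F>_def)
  have "S \<subseteq> \<Union>\<F>"
  proof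
    fix x assume "x \<in> S"
    then obtain r where "r > 0" "cball x r \<subseteq> S" using assms(1) open_contains_cball by blast
    then show "x \<in> \<Union>\<F>" unfolding \<F>_def by (auto intro!: exI[of _ "ball x r"])
  qed
  have "AE x in lebesgue. x \<in> B \<longrightarrow> Q x = 0" if B: "B \<in> \<F>'" for B
  proof -
    obtain a r where r: "B = ball a r" "r > 0" "cball a r \<subseteq> S" using B \<F>'(1) unfolding \<F>_def by blast
    obtain \<eta> where \<eta>: "\<eta> \<in> test_functions S" "\<And>x. x \<in> ball a r \<Longrightarrow> \<eta> x > 0"
      by (rule test_ball[OF r(2,3)]) blast
    obtain b where b: "\<And>x. \<bar>\<eta> x\<bar> \<le> b" using test_bounded[OF \<eta>(1)] by metis
    have "AE x in lebesgue. \<eta> x * Q x = 0"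
    proof (rule fundamental_lemma)
      show "l2 lebesgue (\<lambda>x. \<eta> x * Q x)"
        by (rule l2_bounded_mult(1)[OF assms(2) test_measurable[OF \<eta>(1)], of b]) (simp add: b)
      show "(LINT x|lebesgue. \<eta> x * Q x * \<psi> x) = 0" if "\<psi> \<in> test_functions UNIV" for \<psi>
        using assms(3)[OF test_smooth_mult[OF \<eta>(1) test_smooth[OF that]]] by (simp add: algebra_simps)
    qed
    then show ?thesis
    proof eventually_elim
      case (elim x)
      then show ?case using \<eta>(2)[of x] r(1) by auto
    qed
  qed
  then have "AE x in lebesgue. \<forall>B\<in>\<F>'. x \<in> B \<longrightarrow> Q x = 0"
    unfolding AE_ball_countable[OF \<F>'(2)] by blast
  then show ?thesis
  proof eventually_elim
    case (elim x)
    then show ?case using \<open>S \<subseteq> \<Union>\<F>\<close> \<F>'(3) by blast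
  qed
qed

text \<open>This ties the function chosen in \<open>weak_grad\<close> to whatever gradient a
  construction provides.\<close>

lemma weak_pair_unique:
  assumes "open S" "weak_pair S u G" "weak_pair S u H"
  shows "AE x in lebesgue_on S. \<forall>i. G i x = H i x"
proof -
  have S: "S \<in> sets lebesgue" using assms(1) by simp
  note d = weak_pair_diff[OF S assms(2,3)]
  have "AE x in lebesgue. x \<in> S \<longrightarrow> G i x - H i x = 0" for i
  proof -
    let ?Q = "\<lambda>x. if x \<in> S then G i x - H i x else 0"
    have "AE x in lebesgue. x \<in> S \<longrightarrow> ?Q x = 0"
    proof (rule l2_local_zero[OF assms(1)])
      show "l2 lebesgue ?Q" unfolding l2_zero_extension[OF S] using d by (simp add: weak_pair_def)
      fix \<phi> assume \<phi>: "\<phi> \<in> test_functions S"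
      have "(LINT x|lebesgue. ?Q x * \<phi> x) = (LINT x|lebesgue_on S. ?Q x * \<phi> x)"
        by (rule integral_lebesgue_on_eq[OF S, symmetric]) simp
      also have "\<dots> = (LINT x|lebesgue_on S. (G i x - H i x) * \<phi> x)"
        by (intro Bochner_Integration.integral_cong) auto
      also have "\<dots> = 0" using d \<phi> by (simp add: weak_pair_def)
      finally show "(LINT x|lebesgue. ?Q x * \<phi> x) = 0" .
    qed
    then show ?thesis by eventually_elim simp
  qed
  then have "AE x in lebesgue. \<forall>i. x \<in> S \<longrightarrow> G i x - H i x = 0"
    unfolding AE_all_countable by blast
  then show ?thesis unfolding AE_lebesgue_on_iff[OF S] by eventually_elim simp
qed

lemma nsq_cong_AE:
  assumes "AE x in M. f x = g x" "f \<in> borel_measurable M" "g \<in> borel_measurable M"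
  shows "nsq M f = nsq M g"
  unfolding nsq_def
proof (rule integral_cong_AE)
  show "AE x in M. (f x)\<^sup>2 = (g x)\<^sup>2" using assms(1) by eventually_elim simp
qed (use assms in measurable)

lemma weak_grad_weak_pair:
  assumes "u \<in> H1_space S"
  shows "weak_pair S u (\<lambda>i x. weak_grad S u x $ i)"
proof -
  have "\<exists>G. G \<in> L2_space S \<and> is_weak_grad S u G" using assms by (auto simp: H1_space_def)
  from someI_ex[OF this] show ?thesis
    using assms unfolding weak_pair_iff weak_grad_def H1_space_def by simp
qed

lemma weak_pair_weak_grad:
  assumes "open S" "weak_pair S u G"
  shows "u \<in> H1_space S" "AE x in lebesgue_on S. \<forall>i. weak_grad S u x $ i = G i x"
    "(H1_norm S u)\<^sup>2 = nsq (lebesgue_on S) u + (\<Sum>i\<in>UNIV. nsq (lebesgue_on S) (G i))"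
proof -
  have "weak_pair S u (\<lambda>i x. (\<chi> i. G i x) $ i)" using assms(2) by simp
  then show H1: "u \<in> H1_space S" unfolding weak_pair_iff H1_space_def by auto
  note w = weak_grad_weak_pair[OF H1]
  show ae: "AE x in lebesgue_on S. \<forall>i. weak_grad S u x $ i = G i x"
    by (rule weak_pair_unique[OF assms(1) w assms(2)])
  have "nsq (lebesgue_on S) (\<lambda>x. weak_grad S u x $ i) = nsq (lebesgue_on S) (G i)" for i
  proof (rule nsq_cong_AE)
    show "AE x in lebesgue_on S. weak_grad S u x $ i = G i x" using ae by eventually_elim simp
  qed (use w assms(2) in \<open>auto simp: weak_pair_def l2_def\<close>)
  moreover have "weak_grad S u \<in> L2_space S" using w by (simp add: weak_pair_iff)
  ultimately show "(H1_norm S u)\<^sup>2 = nsq (lebesgue_on S) u + (\<Sum>i\<in>UNIV. nsq (lebesgue_on S) (G i))"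
    by (simp add: H1_norm_def L2_norm_real L2_norm_vec sum_nonneg)
qed

text \<open>The function vanishes off S by definition of \<open>H10_space\<close>, but
  \<open>weak_grad\<close> is unconstrained there and has to be cut off.\<close>

lemma H10_space_sobolev0:
  assumes "open S" "u \<in> H10_space S"
  shows "sobolev0 S u (\<lambda>i x. if x \<in> S then weak_grad S u x $ i else 0)"
  unfolding sobolev0_def
proof (intro conjI allI impI)
  have S: "S \<in> sets lebesgue" using assms(1) by simp
  have H1: "u \<in> H1_space S" and z: "\<And>x. x \<notin> S \<Longrightarrow> u x = 0" using assms(2) by (auto simp: H10_space_def)
  obtain \<phi> where \<phi>: "\<And>j. \<phi> j \<in> test_functions S" and lim: "(\<lambda>j::nat. H1_norm S (\<lambda>x. u x - \<phi> j x)) \<longlonglongrightarrow> 0"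
    using assms(2) by (auto simp: H10_space_def)
  let ?G = "\<lambda>i x. weak_grad S u x $ i"
  note w = weak_grad_weak_pair[OF H1]
  have ux: "(\<lambda>x. if x \<in> S then u x else 0) = u" using z by auto
  show "l2 lebesgue u"
    using w l2_zero_extension(1)[OF S, of u] by (simp add: weak_pair_def ux)
  show "l2 lebesgue (\<lambda>x. if x \<in> S then ?G i x else 0)" for i
    using w l2_zero_extension(1)[OF S, of "?G i"] by (simp add: weak_pair_def)
  fix e :: real assume "e > 0"
  have "(\<lambda>j. (H1_norm S (\<lambda>x. u x - \<phi> j x))\<^sup>2) \<longlonglongrightarrow> 0\<^sup>2" by (intro tendsto_intros lim)
  then have "\<forall>\<^sub>F j in sequentially. (H1_norm S (\<lambda>x. u x - \<phi> j x))\<^sup>2 < e"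
    using \<open>e > 0\<close> by (intro order_tendstoD(2)[of _ "0\<^sup>2"]) auto
  then obtain j where j: "(H1_norm S (\<lambda>x. u x - \<phi> j x))\<^sup>2 < e" by (auto simp: eventually_sequentially)
  have "(H1_norm S (\<lambda>x. u x - \<phi> j x))\<^sup>2 = nsq (lebesgue_on S) (\<lambda>x. u x - \<phi> j x)
      + (\<Sum>i\<in>UNIV. nsq (lebesgue_on S) (\<lambda>x. ?G i x - partial_deriv i (\<phi> j) x))"
    by (rule weak_pair_weak_grad(3)[OF assms(1)
          weak_pair_diff[OF S w sobolev0_weak_pair[OF S sobolev0_test[OF \<phi>]]]])
  moreover have "nsq (lebesgue_on S) (\<lambda>x. u x - \<phi> j x) = nsq lebesgue (\<lambda>x. \<phi> j x - u x)"
    unfolding l2_zero_extension(2)[OF S, symmetric] nsq_minus_commute[of _ u]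
    using z test_zero_outside[OF \<phi>] by (intro arg_cong[of _ _ "nsq lebesgue"]) auto
  moreover have "nsq (lebesgue_on S) (\<lambda>x. ?G i x - partial_deriv i (\<phi> j) x)
      = nsq lebesgue (\<lambda>x. partial_deriv i (\<phi> j) x - (if x \<in> S then ?G i x else 0))" for i
    unfolding l2_zero_extension(2)[OF S, symmetric] nsq_minus_commute[of _ "?G i"]
    using test_zero_outside[OF test_partial_deriv[OF \<phi>]] by (intro arg_cong[of _ _ "nsq lebesgue"]) auto
  ultimately show "\<exists>\<phi>\<in>test_functions S. nsq lebesgue (\<lambda>x. \<phi> x - u x) +
       (\<Sum>i\<in>UNIV. nsq lebesgue (\<lambda>x. partial_deriv i \<phi> x - (if x \<in> S then ?G i x else 0))) < e"
    using j \<phi>[of j] by (intro bexI[of _ "\<phi> j"]) simp_all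
qed

text \<open>Limits in L2 fix u only up to a null set, whereas \<open>H10_space\<close> prescribes
  the value 0 at every point outside; hence the third hypothesis.\<close>

lemma sobolev0_H10_space:
  assumes "open S" "sobolev0 S u G" "\<And>x. x \<notin> S \<Longrightarrow> u x = 0"
  shows "u \<in> H10_space S"
proof -
  have S: "S \<in> sets lebesgue" using assms(1) by simp
  obtain \<phi> where \<phi>: "\<And>n. \<phi> n \<in> test_functions S" "tends_l2 lebesgue \<phi> u"
    "\<And>i. tends_l2 lebesgue (\<lambda>n. partial_deriv i (\<phi> n)) (G i)" by (rule sobolev0_seqD[OF assms(2)]) blast
  let ?h = "\<lambda>n. nsq lebesgue (\<lambda>x. \<phi> n x - u x) + (\<Sum>i\<in>UNIV. nsq lebesgue (\<lambda>x. partial_deriv i (\<phi> n) x - G i x))"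
  note l = sobolev0_l2[OF assms(2)]
  have "(H1_norm S (\<lambda>x. u x - \<phi> n x))\<^sup>2 \<le> ?h n" for n
  proof -
    have "(H1_norm S (\<lambda>x. u x - \<phi> n x))\<^sup>2 = nsq (lebesgue_on S) (\<lambda>x. u x - \<phi> n x)
      + (\<Sum>i\<in>UNIV. nsq (lebesgue_on S) (\<lambda>x. G i x - partial_deriv i (\<phi> n) x))"
      by (rule weak_pair_weak_grad(3)[OF assms(1) sobolev0_weak_pair[OF S
          sobolev0_diff[OF assms(2) sobolev0_test[OF \<phi>(1)]]]])
    also have "\<dots> \<le> nsq lebesgue (\<lambda>x. u x - \<phi> n x) + (\<Sum>i\<in>UNIV. nsq lebesgue (\<lambda>x. G i x - partial_deriv i (\<phi> n) x))"
      by (intro add_mono sum_mono l2_lebesgue_on(2)[OF S] l2_diff l test_l2(1)[OF \<phi>(1)]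
          test_l2(1)[OF test_partial_deriv[OF \<phi>(1)]])
    finally show ?thesis by (simp add: nsq_minus_commute[of lebesgue u] nsq_minus_commute[of lebesgue "G _"])
  qed
  then have "sqrt ((H1_norm S (\<lambda>x. u x - \<phi> n x))\<^sup>2) \<le> sqrt (?h n)" for n by (rule real_sqrt_le_mono)
  then have le: "\<bar>H1_norm S (\<lambda>x. u x - \<phi> n x)\<bar> \<le> sqrt (?h n)" for n by simp
  have "?h \<longlonglongrightarrow> 0 + (\<Sum>i\<in>(UNIV::'a set). 0)"
    using \<phi>(2,3) by (intro tendsto_intros) (auto simp: tends_l2_def)
  then have "(\<lambda>n. sqrt (?h n)) \<longlonglongrightarrow> sqrt (0 + (\<Sum>i\<in>(UNIV::'a set). 0))" by (rule tendsto_real_sqrt)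
  then have lim: "(\<lambda>n. sqrt (?h n)) \<longlonglongrightarrow> 0" by simp
  have "(\<lambda>n. H1_norm S (\<lambda>x. u x - \<phi> n x)) \<longlonglongrightarrow> 0"
    by (rule Lim_null_comparison[OF _ lim]) (use le in simp)
  with \<phi>(1) assms(3) weak_pair_weak_grad(1)[OF assms(1) sobolev0_weak_pair[OF S assms(2)]]
  show ?thesis by (auto simp: H10_space_def)
qed

lemma Linf_space_l2:
  assumes "f \<in> Linf_space S" "bounded S" "S \<in> sets lebesgue"
  shows "l2 (lebesgue_on S) f"
proof -
  obtain C where C: "AE x in lebesgue_on S. \<bar>f x\<bar> \<le> C" and m: "f \<in> borel_measurable (lebesgue_on S)"
    using assms(1) by (auto simp: Linf_space_def)
  obtain R where R: "\<And>x. x \<in> S \<Longrightarrow> norm x \<le> R" using assms(2) bounded_iff by blast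
  have l: "l2 (lebesgue_on S) (\<lambda>x. C * indicator (cball 0 R) x)"
    by (rule l2_lebesgue_on(1)[OF assms(3) l2_indicator_cball])
  have "AE x in lebesgue_on S. x \<in> S" by (rule AE_I2) simp
  with C have "AE x in lebesgue_on S. \<bar>f x\<bar> \<le> \<bar>C * indicator (cball 0 R) x\<bar>"
    by eventually_elim (use R in \<open>auto simp: indicator_def\<close>)
  then show ?thesis by (rule l2_bound(1)[OF l m])
qed

lemma energy1_eq:
  assumes "open S" "bounded S" "weak_pair S u G" "f \<in> Linf_space S"
  shows "energy1 S k f u = (\<Sum>i\<in>UNIV. nsq (lebesgue_on S) (G i)) - k\<^sup>2 * nsq (lebesgue_on S) u
    - 2 * (LINT x|lebesgue_on S. f x * u x)"
proof -
  let ?M = "lebesgue_on S"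
  have S: "S \<in> sets lebesgue" using assms(1) by simp
  have l: "l2 ?M u" "l2 ?M (G i)" "l2 ?M f" for i
    using assms(3) Linf_space_l2[OF assms(4,2) S] by (auto simp: weak_pair_def)
  note H1 = weak_pair_weak_grad(1)[OF assms(1,3)]
  note w = weak_grad_weak_pair[OF H1]
  have lw: "l2 ?M (\<lambda>x. weak_grad S u x $ i)" for i using w by (simp add: weak_pair_def)
  have i: "integrable ?M (\<lambda>x. \<Sum>i\<in>UNIV. (G i x)\<^sup>2)" "integrable ?M (\<lambda>x. k\<^sup>2 * (u x)\<^sup>2)" "integrable ?M (\<lambda>x. 2 * (f x * u x))"
    using l l2_mult_integrable[OF l(3,1)] by (auto simp: l2_def)
  have "energy1 S k f u = integral\<^sup>L ?M (\<lambda>x. (\<Sum>i\<in>UNIV. (G i x)\<^sup>2) - k\<^sup>2 * (u x)\<^sup>2 - 2 * (f x * u x))"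
    unfolding energy1_def norm_sq_vec
  proof (rule integral_cong_AE)
    show "AE x in ?M. (\<Sum>i\<in>UNIV. (weak_grad S u x $ i)\<^sup>2) - k\<^sup>2 * \<bar>u x\<bar>\<^sup>2 - 2 * f x * u x
      = (\<Sum>i\<in>UNIV. (G i x)\<^sup>2) - k\<^sup>2 * (u x)\<^sup>2 - 2 * (f x * u x)"
      using weak_pair_weak_grad(2)[OF assms(1,3)] by eventually_elim simp
  qed (use l2_measurable[OF l(1)] l2_measurable[OF l(2)] l2_measurable[OF l(3)] l2_measurable[OF lw] in measurable)
  also have "\<dots> = integral\<^sup>L ?M (\<lambda>x. \<Sum>i\<in>UNIV. (G i x)\<^sup>2) - integral\<^sup>L ?M (\<lambda>x. k\<^sup>2 * (u x)\<^sup>2)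
      - integral\<^sup>L ?M (\<lambda>x. 2 * (f x * u x))"
    by (simp only: Bochner_Integration.integral_diff[OF Bochner_Integration.integrable_diff[OF i(1,2)] i(3)]
        Bochner_Integration.integral_diff[OF i(1,2)])
  also have "integral\<^sup>L ?M (\<lambda>x. \<Sum>i\<in>UNIV. (G i x)\<^sup>2) = (\<Sum>i\<in>UNIV. nsq ?M (G i))"
    unfolding nsq_def using l by (intro Bochner_Integration.integral_sum) (auto simp: l2_def)
  finally show ?thesis by (simp add: nsq_def)
qed

section \<open>The variation of a segregated ground state\<close>

text \<open>The tangent line of the convex function \<open>(max s 0)\<^sup>2\<close> at a. Since the
  squares enter the energy with a minus sign, this is the direction needed to bound the energy of a
  competitor from above.\<close>

lemma pos_part_square_ge:
  fixes a b :: real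
  shows "(max (a + b) 0)\<^sup>2 \<ge> (max a 0)\<^sup>2 + 2 * max a 0 * b"
proof -
  have "(max a 0)\<^sup>2 + 2 * max a 0 * b \<le> (max a 0 + b)\<^sup>2" if "a + b \<ge> 0"
    by (simp add: power2_sum)
  moreover have "(max a 0 + b)\<^sup>2 = (max (a + b) 0)\<^sup>2" if "a + b \<ge> 0" "a \<ge> 0"
    using that by (simp add: max_def)
  moreover have "(max a 0)\<^sup>2 + 2 * max a 0 * b \<le> 0" if "a + b < 0" "a \<ge> 0"
  proof -
    have "a * (a + 2 * b) \<le> 0" using that by (intro mult_nonneg_nonpos) auto
    then show ?thesis using that by (simp add: max_def power2_eq_square algebra_simps)
  qed
  ultimately show ?thesis by (cases "a \<ge> 0"; cases "a + b \<ge> 0") (auto simp: max_def)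
qed

text \<open>If w is nonzero and |w| \<ge> t |p|, the sign does not change and the expression is
  exactly linear. The kink at w = 0 costs C t |p|, because only one of the two parts is nonzero
  there; a possible change of sign costs at most twice that.\<close>

lemma linear_part_ge:
  fixes w t p f1 f2 C :: real
  assumes "\<bar>f1\<bar> \<le> C" "\<bar>f2\<bar> \<le> C" "t > 0"
  shows "f1 * (max (w + t * p) 0 - max w 0) + f2 * (max (- (w + t * p)) 0 - max (- w) 0) \<ge>
    t * p * (f1 * of_bool (w > 0) - f2 * of_bool (w < 0)) - t * C * (\<bar>p\<bar> * of_bool (w = 0))
      - 2 * t * C * (\<bar>p\<bar> * of_bool (w \<noteq> 0 \<and> \<bar>w\<bar> < t * \<bar>p\<bar>))"
proof -
  have C: "C \<ge> 0" using assms(1) by linarith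
  have b: "\<bar>f * q\<bar> \<le> C * r" if "\<bar>f\<bar> \<le> C" "\<bar>q\<bar> \<le> r" for f q r :: real
    unfolding abs_mult using that C by (intro mult_mono) auto
  define z where "z = w + t * p"
  have ap: "\<bar>t * p\<bar> = t * \<bar>p\<bar>" using assms(3) by (simp add: abs_mult)
  have zz: "max z 0 - max (-z) 0 = z" by (simp add: max_def)
  consider "w = 0" | "w > 0" "\<bar>w\<bar> \<ge> t * \<bar>p\<bar>" | "w > 0" "\<bar>w\<bar> < t * \<bar>p\<bar>"
    | "w < 0" "\<bar>w\<bar> \<ge> t * \<bar>p\<bar>" | "w < 0" "\<bar>w\<bar> < t * \<bar>p\<bar>" by linarith
  then have "f1 * (max z 0 - max w 0) + f2 * (max (- z) 0 - max (- w) 0) \<ge>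
    t * p * (f1 * of_bool (w > 0) - f2 * of_bool (w < 0)) - C * ((t * \<bar>p\<bar>) * of_bool (w = 0))
      - 2 * (C * ((t * \<bar>p\<bar>) * of_bool (w \<noteq> 0 \<and> \<bar>w\<bar> < t * \<bar>p\<bar>)))"
  proof cases
    case 1
    then have "\<bar>f1 * max z 0\<bar> + \<bar>f2 * max (-z) 0\<bar> \<le> C * (t * \<bar>p\<bar>)"
      using b[OF assms(1), of z "t * \<bar>p\<bar>"] b[OF assms(2), of "-z" "t * \<bar>p\<bar>"] ap C assms(3)
      by (auto simp: max_def z_def)
    with 1 show ?thesis by simp
  next
    case 2
    then have "z \<ge> 0" using ap unfolding z_def by linarith
    then have "max z 0 = z" "max (-z) 0 = 0" by auto
    with 2 show ?thesis by (simp add: z_def algebra_simps)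
  next
    case 3
    have "\<bar>max (-z) 0\<bar> \<le> t * \<bar>p\<bar>" using 3 ap unfolding z_def by linarith
    from b[OF assms(1) this] b[OF assms(2) this]
    have "f1 * max (-z) 0 + f2 * max (-z) 0 \<ge> - 2 * (C * (t * \<bar>p\<bar>))" by linarith
    moreover have "f1 * (max z 0 - max w 0) = t * p * f1 + f1 * max (-z) 0"
      using zz 3 by (simp add: z_def algebra_simps)
    ultimately show ?thesis using 3 by simp
  next
    case 4
    then have "z \<le> 0" using ap unfolding z_def by linarith
    then have "max z 0 = 0" "max (-z) 0 = -z" by auto
    with 4 show ?thesis by (simp add: z_def algebra_simps)
  next
    case 5
    have "\<bar>max z 0\<bar> \<le> t * \<bar>p\<bar>" using 5 ap unfolding z_def by linarith
    from b[OF assms(1) this] b[OF assms(2) this]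
    have "f1 * max z 0 + f2 * max z 0 \<ge> - 2 * (C * (t * \<bar>p\<bar>))" by linarith
    moreover have "f2 * (max (-z) 0 - max (-w) 0) = - (t * p * f2) + f2 * max z 0"
      using zz 5 by (simp add: z_def algebra_simps)
    ultimately show ?thesis using 5 by simp
  qed
  then show ?thesis by (simp add: z_def mult.assoc mult.left_commute[of C])
qed

text \<open>The strip omits {w = 0}, so each point leaves it once \<open>step n\<close> is small,
  and |p| dominates.\<close>

lemma integral_vanishing_strip:
  assumes "l2 M w" "integrable M p"
  shows "(\<lambda>n. (LINT x|M. \<bar>p x\<bar> * of_bool (w x \<noteq> 0 \<and> \<bar>w x\<bar> < step n * \<bar>p x\<bar>))) \<longlonglongrightarrow> 0"
proof -
  note [measurable] = l2_measurable[OF assms(1)] borel_measurable_integrable[OF assms(2)]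
  have "(\<lambda>n. (LINT x|M. \<bar>p x\<bar> * of_bool (w x \<noteq> 0 \<and> \<bar>w x\<bar> < step n * \<bar>p x\<bar>))) \<longlonglongrightarrow> (LINT x|M. 0)"
  proof (rule integral_dominated_convergence[where w="\<lambda>x. \<bar>p x\<bar>"])
    show "AE x in M. (\<lambda>n. \<bar>p x\<bar> * of_bool (w x \<noteq> 0 \<and> \<bar>w x\<bar> < step n * \<bar>p x\<bar>)) \<longlonglongrightarrow> 0"
    proof (rule AE_I2)
      fix x
      show "(\<lambda>n. \<bar>p x\<bar> * of_bool (w x \<noteq> 0 \<and> \<bar>w x\<bar> < step n * \<bar>p x\<bar>)) \<longlonglongrightarrow> 0"
      proof (cases "w x = 0")
        case False
        have "(\<lambda>n. step n * \<bar>p x\<bar>) \<longlonglongrightarrow> 0 * \<bar>p x\<bar>" by (intro tendsto_intros step)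
        then have "\<forall>\<^sub>F n in sequentially. step n * \<bar>p x\<bar> < \<bar>w x\<bar>"
          using False by (intro order_tendstoD(2)[of _ "0 * \<bar>p x\<bar>"]) auto
        then have "\<forall>\<^sub>F n in sequentially. 0 = \<bar>p x\<bar> * of_bool (w x \<noteq> 0 \<and> \<bar>w x\<bar> < step n * \<bar>p x\<bar>)"
          by eventually_elim auto
        then show ?thesis by (rule Lim_transform_eventually[OF tendsto_const])
      qed simp
    qed
  qed (use assms(2) in \<open>auto simp: abs_mult intro!: AE_I2\<close>)
  then show ?thesis by simp
qed

text \<open>What two components retain of the minimality of the whole tuple. The others enter only
  through D, where variations may be supported, and through \<open>minimal\<close>, which is limited
  to the competitors actually used. C bounds both source terms.\<close>

locale ground_state_pair =
  fixes \<Omega> D :: "(real^'n) set" and k1 k2 :: real and f1 f2 u1 u2 :: "real^'n \<Rightarrow> real"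
    and G1 G2 :: "'n \<Rightarrow> real^'n \<Rightarrow> real" and C :: real
  assumes \<Omega>: "open \<Omega>" "bounded \<Omega>" and D: "D \<subseteq> \<Omega>"
    and f: "f1 \<in> Linf_space \<Omega>" "f2 \<in> Linf_space \<Omega>"
    and C: "AE x in lebesgue_on \<Omega>. \<bar>f1 x\<bar> \<le> C" "AE x in lebesgue_on \<Omega>. \<bar>f2 x\<bar> \<le> C" "C \<ge> 0"
    and s1: "sobolev0 \<Omega> u1 G1" and s2: "sobolev0 \<Omega> u2 G2"
    and z: "\<And>x. x \<notin> \<Omega> \<Longrightarrow> u1 x = 0" "\<And>x. x \<notin> \<Omega> \<Longrightarrow> u2 x = 0"
    and pos: "AE x in lebesgue_on \<Omega>. u1 x \<ge> 0" "AE x in lebesgue_on \<Omega>. u2 x \<ge> 0"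
    and seg: "AE x in lebesgue_on \<Omega>. u1 x * u2 x = 0"
    and minimal: "\<And>\<phi> v1 v2. \<phi> \<in> test_functions D \<Longrightarrow> v1 \<in> H10_space \<Omega> \<Longrightarrow> v2 \<in> H10_space \<Omega> \<Longrightarrow>
      (\<And>x. v1 x = max (u1 x - u2 x + \<phi> x) 0) \<Longrightarrow> (\<And>x. v2 x = max (- (u1 x - u2 x + \<phi> x)) 0) \<Longrightarrow>
      energy1 \<Omega> k1 f1 u1 + energy1 \<Omega> k2 f2 u2 \<le> energy1 \<Omega> k1 f1 v1 + energy1 \<Omega> k2 f2 v2"
begin

abbreviation "M \<equiv> lebesgue_on \<Omega>"
definition "w x = u1 x - u2 x"
definition "W j x = G1 j x - G2 j x"
definition "g x = k1\<^sup>2 * u1 x - k2\<^sup>2 * u2 x + f1 x * of_bool (u1 x > 0) - f2 x * of_bool (u2 x > 0)"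
text \<open>The asserted equation is -\<Delta> w = g; vanishing of L on test functions is its weak
  form.\<close>

definition "L \<phi> = (\<Sum>j\<in>UNIV. (LINT x|M. W j x * partial_deriv j \<phi> x)) - (LINT x|M. g x * \<phi> x)"

lemma \<Omega>_sets: "\<Omega> \<in> sets lebesgue" using \<Omega>(1) by simp

lemma sw: "sobolev0 \<Omega> w W"
  unfolding w_def[abs_def] W_def[abs_def] by (rule sobolev0_diff[OF s1 s2])

lemma l2_M:
  "l2 M u1" "l2 M u2" "l2 M w" "l2 M (G1 j)" "l2 M (G2 j)" "l2 M (W j)" "l2 M f1" "l2 M f2"
  using l2_lebesgue_on(1)[OF \<Omega>_sets] sobolev0_l2[OF s1] sobolev0_l2[OF s2] sobolev0_l2[OF sw]
    Linf_space_l2[OF f(1) \<Omega>(2) \<Omega>_sets] Linf_space_l2[OF f(2) \<Omega>(2) \<Omega>_sets] by auto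

lemma l2_test: "\<phi> \<in> test_functions U \<Longrightarrow> l2 M \<phi>"
  by (rule l2_lebesgue_on(1)[OF \<Omega>_sets test_l2(1)])

lemma integrable_test: "\<phi> \<in> test_functions U \<Longrightarrow> integrable M \<phi>"
  using integrable_mult_indicator[OF \<Omega>_sets test_l2(2)] integrable_restrict_space[of \<Omega> lebesgue \<phi>] \<Omega>_sets
  by simp

lemma l2_of_bool:
  assumes "l2 M' a" "b \<in> borel_measurable M'"
  shows "l2 M' (\<lambda>x. a x * of_bool (b x > (0::real)))"
proof (rule l2_bound(1)[OF assms(1)])
  note [measurable] = l2_measurable[OF assms(1)] assms(2)
  show "(\<lambda>x. a x * of_bool (b x > 0)) \<in> borel_measurable M'" by measurable
qed (auto intro!: AE_I2)

lemma l2_g: "l2 M g"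
  unfolding g_def[abs_def]
  by (intro l2_diff[OF l2_add[OF l2_diff]] l2_cmult l2_M l2_of_bool l2_measurable[OF l2_M(1)] l2_measurable[OF l2_M(2)])

text \<open>Two nonnegative numbers with product 0 are the positive and negative parts of their
  difference. Hence the pair can be varied through w alone.\<close>

lemma AE_split: "AE x in M. u1 x = max (w x) 0 \<and> u2 x = max (- w x) 0"
  using pos seg by eventually_elim (auto simp: w_def max_def)

text \<open>At almost every point one of the functions is 0, and so is its gradient there; the mixed
  term in the square of \<open>W j\<close> therefore integrates to 0.\<close>

lemma energy_split:
  "energy1 \<Omega> k1 f1 u1 + energy1 \<Omega> k2 f2 u2 = (\<Sum>j\<in>UNIV. nsq M (W j))
    - (k1\<^sup>2 * nsq M u1 + k2\<^sup>2 * nsq M u2 + 2 * (LINT x|M. f1 x * u1 x) + 2 * (LINT x|M. f2 x * u2 x))"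
proof -
  have "nsq M (W j) = nsq M (G1 j) + nsq M (G2 j)" for j
  proof -
    have "AE x in lebesgue. x \<in> \<Omega> \<longrightarrow> u1 x = 0 \<longrightarrow> G1 j x = 0" "AE x in lebesgue. x \<in> \<Omega> \<longrightarrow> u2 x = 0 \<longrightarrow> G2 j x = 0"
      using sobolev0_gradient_zero[OF s1, of j] sobolev0_gradient_zero[OF s2, of j] by auto
    then have "AE x in M. u1 x = 0 \<longrightarrow> G1 j x = 0" "AE x in M. u2 x = 0 \<longrightarrow> G2 j x = 0"
      unfolding AE_lebesgue_on_iff[OF \<Omega>_sets] by auto
    then have ae: "AE x in M. G1 j x * G2 j x = 0" using seg by eventually_elim auto
    have "nsq M (W j) = nsq M (\<lambda>x. G1 j x + (-1) * G2 j x)" by (simp add: W_def[abs_def])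
    also have "\<dots> = nsq M (G1 j) - 2 * (LINT x|M. G1 j x * G2 j x) + nsq M (G2 j)"
      by (subst nsq_add_expand[OF l2_M(4,5)]) simp
    also have "(LINT x|M. G1 j x * G2 j x) = 0" using ae by (rule integral_eq_zero_AE)
    finally show ?thesis by simp
  qed
  then show ?thesis
    by (simp add: energy1_eq[OF \<Omega> sobolev0_weak_pair[OF \<Omega>_sets s1] f(1)]
        energy1_eq[OF \<Omega> sobolev0_weak_pair[OF \<Omega>_sets s2] f(2)] sum.distrib)
qed

text \<open>The parts of y = w + \<phi> are half the sum and half the difference of |y| and y, so
  \<open>sobolev0_abs\<close> supplies their gradients. They vanish outside the domain because w and
  \<phi> do, hence \<open>minimal\<close> applies.\<close>

lemma energy_competitor:
  assumes \<phi>: "\<phi> \<in> test_functions D"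
  defines "v1 \<equiv> \<lambda>x. max (w x + \<phi> x) 0" and "v2 \<equiv> \<lambda>x. max (- (w x + \<phi> x)) 0"
  shows "l2 M v1" "l2 M v2"
    "energy1 \<Omega> k1 f1 u1 + energy1 \<Omega> k2 f2 u2 \<le> (\<Sum>j\<in>UNIV. nsq M (\<lambda>x. W j x + partial_deriv j \<phi> x))
      - (k1\<^sup>2 * nsq M v1 + k2\<^sup>2 * nsq M v2 + 2 * (LINT x|M. f1 x * v1 x) + 2 * (LINT x|M. f2 x * v2 x))"
proof -
  have \<phi>\<Omega>: "\<phi> \<in> test_functions \<Omega>" by (rule test_mono[OF \<phi> D])
  define y where "y x = w x + \<phi> x" for x
  define Y where "Y j x = W j x + partial_deriv j \<phi> x" for j x
  have sy: "sobolev0 \<Omega> y Y"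
    unfolding y_def[abs_def] Y_def[abs_def] by (rule sobolev0_add[OF sw sobolev0_test[OF \<phi>\<Omega>]])
  note sa = sobolev0_abs[OF sy]
  have v1: "v1 = (\<lambda>x. (1/2) * (y x + \<bar>y x\<bar>))" and v2: "v2 = (\<lambda>x. (1/2) * (\<bar>y x\<bar> - y x))"
    by (auto simp: v1_def v2_def y_def max_def)
  define V1 where "V1 j x = (1/2) * (Y j x + sgn (y x) * Y j x)" for j x
  define V2 where "V2 j x = (1/2) * (sgn (y x) * Y j x - Y j x)" for j x
  have sv1: "sobolev0 \<Omega> v1 V1" unfolding v1 V1_def[abs_def] by (intro sobolev0_cmult sobolev0_add[OF sy sa])
  have sv2: "sobolev0 \<Omega> v2 V2" unfolding v2 V2_def[abs_def] by (intro sobolev0_cmult sobolev0_diff[OF sa sy])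
  note l = l2_lebesgue_on(1)[OF \<Omega>_sets sobolev0_l2(1)[OF sv1]] l2_lebesgue_on(1)[OF \<Omega>_sets sobolev0_l2(1)[OF sv2]]
    l2_lebesgue_on(1)[OF \<Omega>_sets sobolev0_l2(2)[OF sv1]] l2_lebesgue_on(1)[OF \<Omega>_sets sobolev0_l2(2)[OF sv2]]
    l2_lebesgue_on(1)[OF \<Omega>_sets sobolev0_l2(2)[OF sy]]
  show "l2 M v1" "l2 M v2" by (rule l)+
  have out: "v1 x = 0" "v2 x = 0" if "x \<notin> \<Omega>" for x
    using z that test_zero_outside[OF \<phi>\<Omega> that] by (auto simp: v1_def v2_def w_def)
  have "energy1 \<Omega> k1 f1 u1 + energy1 \<Omega> k2 f2 u2 \<le> energy1 \<Omega> k1 f1 v1 + energy1 \<Omega> k2 f2 v2"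
    by (rule minimal[OF \<phi> sobolev0_H10_space[OF \<Omega>(1) sv1 out(1)] sobolev0_H10_space[OF \<Omega>(1) sv2 out(2)]])
      (auto simp: v1_def v2_def w_def)
  also have "\<dots> = (\<Sum>j\<in>UNIV. nsq M (V1 j) + nsq M (V2 j))
      - (k1\<^sup>2 * nsq M v1 + k2\<^sup>2 * nsq M v2 + 2 * (LINT x|M. f1 x * v1 x) + 2 * (LINT x|M. f2 x * v2 x))"
    by (simp add: energy1_eq[OF \<Omega> sobolev0_weak_pair[OF \<Omega>_sets sv1] f(1)]
        energy1_eq[OF \<Omega> sobolev0_weak_pair[OF \<Omega>_sets sv2] f(2)] sum.distrib)
  also have "\<dots> \<le> (\<Sum>j\<in>UNIV. nsq M (Y j))
      - (k1\<^sup>2 * nsq M v1 + k2\<^sup>2 * nsq M v2 + 2 * (LINT x|M. f1 x * v1 x) + 2 * (LINT x|M. f2 x * v2 x))"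
  proof (intro diff_right_mono sum_mono)
    fix j
    have "nsq M (V1 j) + nsq M (V2 j) = (LINT x|M. (V1 j x)\<^sup>2 + (V2 j x)\<^sup>2)"
      unfolding nsq_def using l by (intro Bochner_Integration.integral_add[symmetric]) (auto simp: l2_def)
    also have "\<dots> \<le> nsq M (Y j)"
      unfolding nsq_def
    proof (rule integral_mono)
      \<comment> \<open>Equality holds where y is nonzero. At y = 0 the convention
        \<open>sgn 0 = 0\<close> gives halves of Y with opposite signs, whose squares sum to only
        half of that of Y.\<close>
      show "(V1 j x)\<^sup>2 + (V2 j x)\<^sup>2 \<le> (Y j x)\<^sup>2" for x
        by (cases "y x" "0::real" rule: linorder_cases) (auto simp: V1_def V2_def power2_eq_square)
    qed (use l in \<open>auto simp: l2_def\<close>)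
    finally show "nsq M (V1 j) + nsq M (V2 j) \<le> nsq M (Y j)" .
  qed
  finally show "energy1 \<Omega> k1 f1 u1 + energy1 \<Omega> k2 f2 u2 \<le> (\<Sum>j\<in>UNIV. nsq M (\<lambda>x. W j x + partial_deriv j \<phi> x))
      - (k1\<^sup>2 * nsq M v1 + k2\<^sup>2 * nsq M v2 + 2 * (LINT x|M. f1 x * v1 x) + 2 * (LINT x|M. f2 x * v2 x))"
    unfolding Y_def[abs_def] .
qed

text \<open>The tangent bound for the squares and \<open>linear_part_ge\<close>, integrated. These
  terms are subtracted in the energy, so a lower bound is wanted; their linear part in t is exactly
  the pairing of g with \<phi>.\<close>

lemma lower_order_ge:
  assumes \<phi>: "\<phi> \<in> test_functions D" and t: "t > 0"
  defines "v1 \<equiv> \<lambda>x. max (w x + t * \<phi> x) 0" and "v2 \<equiv> \<lambda>x. max (- (w x + t * \<phi> x)) 0"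
  shows "k1\<^sup>2 * nsq M v1 + k2\<^sup>2 * nsq M v2 + 2 * (LINT x|M. f1 x * v1 x) + 2 * (LINT x|M. f2 x * v2 x)
    \<ge> k1\<^sup>2 * nsq M u1 + k2\<^sup>2 * nsq M u2 + 2 * (LINT x|M. f1 x * u1 x) + 2 * (LINT x|M. f2 x * u2 x)
      + 2 * t * (LINT x|M. g x * \<phi> x) - 2 * t * C * (LINT x|M. \<bar>\<phi> x\<bar> * of_bool (w x = 0))
      - 4 * t * C * (LINT x|M. \<bar>\<phi> x\<bar> * of_bool (w x \<noteq> 0 \<and> \<bar>w x\<bar> < t * \<bar>\<phi> x\<bar>))"
proof -
  note lv = energy_competitor(1,2)[OF test_cmult[OF \<phi>, of t], folded v1_def v2_def]
  note l = l2_M(1,2,7,8) lv l2_g l2_test[OF \<phi>]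
  note [measurable] = l2_measurable[OF l2_M(3)] l2_measurable[OF l2_test[OF \<phi>]]
  have i\<phi>: "integrable M (\<lambda>x. \<bar>\<phi> x\<bar>)" by (rule integrable_abs[OF integrable_test[OF \<phi>]])
  have i1: "integrable M (\<lambda>x. \<bar>\<phi> x\<bar> * of_bool (w x = 0))"
    and i2: "integrable M (\<lambda>x. \<bar>\<phi> x\<bar> * of_bool (w x \<noteq> 0 \<and> \<bar>w x\<bar> < t * \<bar>\<phi> x\<bar>))"
    by (rule Bochner_Integration.integrable_bound[OF i\<phi>]; (measurable; fail | auto intro!: AE_I2))+
  have sq: "integrable M (\<lambda>x. (a x)\<^sup>2)" if "l2 M a" for a using that by (simp add: l2_def)
  let ?lhs = "\<lambda>x. k1\<^sup>2 * (u1 x)\<^sup>2 + k2\<^sup>2 * (u2 x)\<^sup>2 + 2 * (f1 x * u1 x) + 2 * (f2 x * u2 x)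
      + (2 * t) * (g x * \<phi> x) - (2 * t * C) * (\<bar>\<phi> x\<bar> * of_bool (w x = 0))
      - (4 * t * C) * (\<bar>\<phi> x\<bar> * of_bool (w x \<noteq> 0 \<and> \<bar>w x\<bar> < t * \<bar>\<phi> x\<bar>))"
  let ?rhs = "\<lambda>x. k1\<^sup>2 * (v1 x)\<^sup>2 + k2\<^sup>2 * (v2 x)\<^sup>2 + 2 * (f1 x * v1 x) + 2 * (f2 x * v2 x)"
  have il: "integrable M ?lhs"
    by (intro Bochner_Integration.integrable_add Bochner_Integration.integrable_diff integrable_mult_right i1 i2 sq l2_mult_integrable l)
  have ir: "integrable M ?rhs"
    by (intro Bochner_Integration.integrable_add Bochner_Integration.integrable_diff integrable_mult_right i1 i2 sq l2_mult_integrable l)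
  have "integral\<^sup>L M ?lhs \<le> integral\<^sup>L M ?rhs"
  proof (rule integral_mono_AE[OF il ir])
    show "AE x in M. ?lhs x \<le> ?rhs x"
      using AE_split C(1,2)
    proof eventually_elim
      case (elim x)
      have e1: "u1 x = max (w x) 0" and e2: "u2 x = max (- w x) 0" using elim(1) by auto
      have b1: "u1 x > 0 \<longleftrightarrow> w x > 0" and b2: "u2 x > 0 \<longleftrightarrow> w x < 0" using e1 e2 by auto
      have q1: "k1\<^sup>2 * ((u1 x)\<^sup>2 + 2 * u1 x * (t * \<phi> x)) \<le> k1\<^sup>2 * (v1 x)\<^sup>2"
        using pos_part_square_ge[of "w x" "t * \<phi> x"] unfolding v1_def e1 by (intro mult_left_mono) auto
      have q2: "k2\<^sup>2 * ((u2 x)\<^sup>2 + 2 * u2 x * (- (t * \<phi> x))) \<le> k2\<^sup>2 * (v2 x)\<^sup>2"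
        using pos_part_square_ge[of "- w x" "- (t * \<phi> x)"] unfolding v2_def e2 by (intro mult_left_mono) auto
      have q3: "f1 x * (v1 x - u1 x) + f2 x * (v2 x - u2 x) \<ge>
        t * \<phi> x * (f1 x * of_bool (u1 x > 0) - f2 x * of_bool (u2 x > 0)) - t * C * (\<bar>\<phi> x\<bar> * of_bool (w x = 0))
        - 2 * t * C * (\<bar>\<phi> x\<bar> * of_bool (w x \<noteq> 0 \<and> \<bar>w x\<bar> < t * \<bar>\<phi> x\<bar>))"
        using linear_part_ge[OF elim(2,3) t, where w="w x" and p="\<phi> x"]
        unfolding v1_def v2_def b1 b2 unfolding e1 e2 .
      have "(2 * t) * (g x * \<phi> x) = k1\<^sup>2 * (2 * u1 x * (t * \<phi> x)) + k2\<^sup>2 * (2 * u2 x * (- (t * \<phi> x)))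
          + 2 * (t * \<phi> x * (f1 x * of_bool (u1 x > 0) - f2 x * of_bool (u2 x > 0)))"
        by (simp add: g_def algebra_simps)
      then show ?case
        using q1 q2 q3 unfolding distrib_left[of "k1\<^sup>2"] distrib_left[of "k2\<^sup>2"] right_diff_distrib[of "f1 x"] right_diff_distrib[of "f2 x"]
        by linarith
    qed
  qed
  moreover have "integral\<^sup>L M ?lhs = k1\<^sup>2 * nsq M u1 + k2\<^sup>2 * nsq M u2 + 2 * (LINT x|M. f1 x * u1 x) + 2 * (LINT x|M. f2 x * u2 x)
      + 2 * t * (LINT x|M. g x * \<phi> x) - 2 * t * C * (LINT x|M. \<bar>\<phi> x\<bar> * of_bool (w x = 0))
      - 4 * t * C * (LINT x|M. \<bar>\<phi> x\<bar> * of_bool (w x \<noteq> 0 \<and> \<bar>w x\<bar> < t * \<bar>\<phi> x\<bar>))"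
    unfolding nsq_def
    by (subst Bochner_Integration.integral_diff Bochner_Integration.integral_add,
        (intro Bochner_Integration.integrable_add Bochner_Integration.integrable_diff integrable_mult_right i1 i2 sq l2_mult_integrable l)+)+
      (simp only: integral_mult_right_zero)
  moreover have "integral\<^sup>L M ?rhs = k1\<^sup>2 * nsq M v1 + k2\<^sup>2 * nsq M v2 + 2 * (LINT x|M. f1 x * v1 x) + 2 * (LINT x|M. f2 x * v2 x)"
    unfolding nsq_def
    by (subst Bochner_Integration.integral_add,
        (intro Bochner_Integration.integrable_add Bochner_Integration.integrable_diff integrable_mult_right i1 i2 sq l2_mult_integrable l)+)+
      (simp only: integral_mult_right_zero)
  ultimately show ?thesis by simp
qed

text \<open>The difference of the energies is divided by 2 t. The quadratic gradient term and the
  strip vanish as t tends to 0, but the kink contributes at order t on a set independent of t, so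
  its term stays.\<close>

lemma L_ge:
  assumes \<phi>: "\<phi> \<in> test_functions D"
  shows "L \<phi> \<ge> - C * (LINT x|M. \<bar>\<phi> x\<bar> * of_bool (w x = 0))"
proof -
  define S where "S = (\<Sum>j\<in>UNIV. nsq M (partial_deriv j \<phi>))"
  define A where "A = (\<Sum>j\<in>UNIV. (LINT x|M. W j x * partial_deriv j \<phi> x))"
  define I where "I = (LINT x|M. g x * \<phi> x)"
  define Z where "Z = (LINT x|M. \<bar>\<phi> x\<bar> * of_bool (w x = 0))"
  define R where "R t = (LINT x|M. \<bar>\<phi> x\<bar> * of_bool (w x \<noteq> 0 \<and> \<bar>w x\<bar> < t * \<bar>\<phi> x\<bar>))" for t
  have main: "- C * Z \<le> A - I + t * S / 2 + 2 * C * R t" if t: "t > 0" for t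
  proof -
    have "nsq M (\<lambda>x. W j x + partial_deriv j (\<lambda>x. t * \<phi> x) x)
      = nsq M (W j) + 2 * t * (LINT x|M. W j x * partial_deriv j \<phi> x) + t\<^sup>2 * nsq M (partial_deriv j \<phi>)" for j
      unfolding smooth_partial_deriv_cmult[OF test_smooth[OF \<phi>]]
      by (rule nsq_add_expand[OF l2_M(6) l2_test[OF test_partial_deriv[OF \<phi>]]])
    then have "(\<Sum>j\<in>UNIV. nsq M (\<lambda>x. W j x + partial_deriv j (\<lambda>x. t * \<phi> x) x))
      = (\<Sum>j\<in>UNIV. nsq M (W j)) + 2 * t * A + t\<^sup>2 * S"
      by (simp add: sum.distrib A_def S_def sum_distrib_left)
    then have "0 \<le> 2 * t * A + t\<^sup>2 * S - 2 * t * I + 2 * t * C * Z + 4 * t * C * R t"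
      using energy_competitor(3)[OF test_cmult[OF \<phi>, of t]] energy_split lower_order_ge[OF \<phi> t]
      unfolding I_def Z_def R_def by linarith
    also have "\<dots> = (2 * t) * (A - I + t * S / 2 + 2 * C * R t + C * Z)"
      by (simp add: algebra_simps power2_eq_square)
    finally have "0 \<le> A - I + t * S / 2 + 2 * C * R t + C * Z"
      using t by (simp add: zero_le_mult_iff)
    then show ?thesis by simp
  qed
  have "(\<lambda>n. A - I + step n * S / 2 + 2 * C * R (step n)) \<longlonglongrightarrow> A - I + 0 * S / 2 + 2 * C * 0"
  proof (intro tendsto_intros step)
    show "(\<lambda>n. R (step n)) \<longlonglongrightarrow> 0"
      unfolding R_def by (rule integral_vanishing_strip[OF l2_M(3) integrable_test[OF \<phi>]])
  qed simp
  then have "- C * Z \<le> A - I + 0 * S / 2 + 2 * C * 0"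
    by (rule LIMSEQ_le_const) (use main step(4) in blast)
  then show ?thesis by (simp add: L_def A_def I_def Z_def)
qed

lemma L_bound:
  assumes \<phi>: "\<phi> \<in> test_functions D"
  shows "\<bar>L \<phi>\<bar> \<le> C * (LINT x|M. \<bar>\<phi> x\<bar> * of_bool (w x = 0))"
proof -
  have "L (\<lambda>x. (-1) * \<phi> x) = - L \<phi>"
    unfolding L_def smooth_partial_deriv_cmult[OF test_smooth[OF \<phi>]] by (simp add: sum_negf)
  then show ?thesis using L_ge[OF \<phi>] L_ge[OF test_cmult[OF \<phi>, of "-1"]] by (simp add: abs_le_iff)
qed

text \<open>w and W are square integrable on the whole space, but the source terms are uncontrolled
  off the domain, so g must be cut off before it is used there.\<close>

definition "g0 x = (if x \<in> \<Omega> then g x else 0)"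

lemma L_eq:
  assumes \<phi>: "\<phi> \<in> test_functions D"
  shows "L \<phi> = (\<Sum>j\<in>UNIV. (LINT x|lebesgue. W j x * partial_deriv j \<phi> x)) - (LINT x|lebesgue. g0 x * \<phi> x)"
proof -
  note \<phi>\<Omega> = test_mono[OF \<phi> D]
  have "(LINT x|M. W j x * partial_deriv j \<phi> x) = (LINT x|lebesgue. W j x * partial_deriv j \<phi> x)" for j
    by (rule integral_lebesgue_on_eq[OF \<Omega>_sets]) (simp add: test_zero_outside[OF test_partial_deriv[OF \<phi>\<Omega>]])
  moreover have "(LINT x|M. g x * \<phi> x) = (LINT x|M. g0 x * \<phi> x)"
    by (intro Bochner_Integration.integral_cong) (auto simp: g0_def)
  moreover have "\<dots> = (LINT x|lebesgue. g0 x * \<phi> x)"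
    by (rule integral_lebesgue_on_eq[OF \<Omega>_sets]) (simp add: g0_def)
  ultimately show ?thesis by (simp add: L_def)
qed

lemma AE_g0_zero: "AE x in lebesgue. w x = 0 \<longrightarrow> g0 x = 0"
  using AE_split[unfolded AE_lebesgue_on_iff[OF \<Omega>_sets]]
  by eventually_elim (auto simp: g0_def g_def)

text \<open>Since \<open>L\<close> is bounded by \<open>C\<close> times the \<open>L\<^sup>1\<close> norm on \<open>{w = 0}\<close>, the localisation \<open>\<eta> w\<close> has its
  Laplacian in \<open>L\<^sup>2\<close>; this Laplacian vanishes on \<open>{w = 0}\<close>, whereas \<open>L\<close> is concentrated there.\<close>

lemma L_zero:
  assumes \<eta>: "\<eta> \<in> test_functions D"
  shows "L \<eta> = 0"
proof -
  let ?I = "integral\<^sup>L lebesgue"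
  let ?T = "test_functions (UNIV :: (real^'n) set)"
  note lw = sobolev0_l2(1)[OF sw] and lW = sobolev0_l2(2)[OF sw]
  have lg0: "l2 lebesgue g0" unfolding g0_def[abs_def] l2_zero_extension[OF \<Omega>_sets] by (rule l2_g)
  note s\<eta> = test_smooth[OF \<eta>]
  define V where "V j x = \<eta> x * W j x + partial_deriv j \<eta> x * w x" for j x
  \<comment> \<open>P is the commutator 2 \<nabla>\<eta> \<nabla>w + w \<Delta>\<eta>: formally
    -\<Delta>(\<eta> w) = \<eta> (-\<Delta> w) - P.\<close>
  define P where "P x = (\<Sum>j\<in>UNIV. 2 * (partial_deriv j \<eta> x * W j x) + partial_deriv j (partial_deriv j \<eta>) x * w x)" for x
  have sv: "sobolev0 UNIV (\<lambda>x. \<eta> x * w x) V"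
    unfolding V_def[abs_def] by (rule sobolev0_mult_test[OF sw test_UNIV[OF \<eta>]])
  have tl: "l2 lebesgue (\<lambda>x. \<theta> x * a x)" if t: "\<theta> \<in> test_functions D" "l2 lebesgue a" for \<theta> a
  proof -
    obtain b where "\<And>x. \<bar>\<theta> x\<bar> \<le> b" using test_bounded[OF t(1)] by metis
    then show ?thesis by (intro l2_bounded_mult(1)[OF t(2) test_measurable[OF t(1)], of b]) simp
  qed
  note \<eta>1 = test_partial_deriv[OF \<eta>] and \<eta>2 = test_partial_deriv[OF test_partial_deriv[OF \<eta>]]
  have lP: "l2 lebesgue P"
    unfolding P_def[abs_def] by (intro l2_sum l2_add l2_cmult tl \<eta>1 \<eta>2 lw lW)
  have lQ: "l2 lebesgue (\<lambda>x. \<eta> x * g0 x - P x)" by (intro l2_diff tl \<eta> lg0 lP)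
  have \<eta>\<psi>: "(\<lambda>x. \<eta> x * \<psi> x) \<in> test_functions D" if "\<psi> \<in> ?T" for \<psi>
    by (rule test_smooth_mult[OF \<eta> test_smooth[OF that]])
  \<comment> \<open>The weak form of that identity. Testing L with \<eta> \<psi> produces the main
    part, and integrating w \<nabla>\<eta> \<nabla>\<psi> by parts removes the remaining derivative
    of \<psi>.\<close>
  have key: "(\<Sum>j\<in>UNIV. ?I (\<lambda>x. V j x * partial_deriv j \<psi> x)) = L (\<lambda>x. \<eta> x * \<psi> x) + ?I (\<lambda>x. (\<eta> x * g0 x - P x) * \<psi> x)"
    if \<psi>: "\<psi> \<in> ?T" for \<psi>
  proof -
    note l\<psi> = test_l2(1)[OF \<psi>] and l\<psi>' = test_l2(1)[OF test_partial_deriv[OF \<psi>]]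
    have j: "?I (\<lambda>x. V j x * partial_deriv j \<psi> x) = ?I (\<lambda>x. W j x * partial_deriv j (\<lambda>x. \<eta> x * \<psi> x) x)
      - ?I (\<lambda>x. (2 * (partial_deriv j \<eta> x * W j x) + partial_deriv j (partial_deriv j \<eta>) x * w x) * \<psi> x)" for j
    proof -
      have a: "integrable lebesgue (\<lambda>x. \<eta> x * W j x * partial_deriv j \<psi> x)"
        by (intro l2_mult_integrable tl \<eta> lW l\<psi>')
      have b: "integrable lebesgue (\<lambda>x. partial_deriv j \<eta> x * w x * partial_deriv j \<psi> x)"
        by (intro l2_mult_integrable tl \<eta>1 lw l\<psi>')
      have c: "integrable lebesgue (\<lambda>x. partial_deriv j \<eta> x * W j x * \<psi> x)"
        by (intro l2_mult_integrable tl \<eta>1 lW l\<psi>)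
      have d: "integrable lebesgue (\<lambda>x. partial_deriv j (partial_deriv j \<eta>) x * w x * \<psi> x)"
        by (intro l2_mult_integrable tl \<eta>2 lw l\<psi>)
      have "?I (\<lambda>x. V j x * partial_deriv j \<psi> x) = ?I (\<lambda>x. \<eta> x * W j x * partial_deriv j \<psi> x) + ?I (\<lambda>x. partial_deriv j \<eta> x * w x * partial_deriv j \<psi> x)"
        unfolding V_def distrib_right by (rule Bochner_Integration.integral_add[OF a b])
      moreover have "?I (\<lambda>x. partial_deriv j \<eta> x * w x * partial_deriv j \<psi> x)
         = - ?I (\<lambda>x. (partial_deriv j \<eta> x * W j x + partial_deriv j (partial_deriv j \<eta>) x * w x) * \<psi> x)"
        by (rule sobolev0_ibp[OF sobolev0_mult_test[OF sw \<eta>1] \<psi>])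
      moreover have "\<dots> = - (?I (\<lambda>x. partial_deriv j \<eta> x * W j x * \<psi> x) + ?I (\<lambda>x. partial_deriv j (partial_deriv j \<eta>) x * w x * \<psi> x))"
        unfolding distrib_right by (simp only: Bochner_Integration.integral_add[OF c d])
      moreover have "?I (\<lambda>x. W j x * partial_deriv j (\<lambda>x. \<eta> x * \<psi> x) x)
        = ?I (\<lambda>x. \<eta> x * W j x * partial_deriv j \<psi> x + partial_deriv j \<eta> x * W j x * \<psi> x)"
        unfolding smooth_partial_deriv_mult[OF s\<eta> test_smooth[OF \<psi>]] by (simp add: algebra_simps)
      moreover have "\<dots> = ?I (\<lambda>x. \<eta> x * W j x * partial_deriv j \<psi> x) + ?I (\<lambda>x. partial_deriv j \<eta> x * W j x * \<psi> x)"
        by (rule Bochner_Integration.integral_add[OF a c])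
      moreover have "?I (\<lambda>x. (2 * (partial_deriv j \<eta> x * W j x) + partial_deriv j (partial_deriv j \<eta>) x * w x) * \<psi> x)
        = ?I (\<lambda>x. 2 * (partial_deriv j \<eta> x * W j x * \<psi> x) + partial_deriv j (partial_deriv j \<eta>) x * w x * \<psi> x)"
        by (simp add: algebra_simps)
      moreover have "\<dots> = 2 * ?I (\<lambda>x. partial_deriv j \<eta> x * W j x * \<psi> x) + ?I (\<lambda>x. partial_deriv j (partial_deriv j \<eta>) x * w x * \<psi> x)"
        by (simp only: Bochner_Integration.integral_add[OF integrable_mult_right[OF c] d] integral_mult_right_zero)
      ultimately show ?thesis by linarith
    qed
    have iP: "?I (\<lambda>x. P x * \<psi> x) = (\<Sum>j\<in>UNIV. ?I (\<lambda>x. (2 * (partial_deriv j \<eta> x * W j x) + partial_deriv j (partial_deriv j \<eta>) x * w x) * \<psi> x))"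
      unfolding P_def sum_distrib_right
      by (intro Bochner_Integration.integral_sum l2_mult_integrable l2_add l2_cmult tl \<eta>1 \<eta>2 lw lW l\<psi>)
    have "?I (\<lambda>x. (\<eta> x * g0 x - P x) * \<psi> x) = ?I (\<lambda>x. \<eta> x * g0 x * \<psi> x) - ?I (\<lambda>x. P x * \<psi> x)"
      unfolding left_diff_distrib by (intro Bochner_Integration.integral_diff l2_mult_integrable tl \<eta> lg0 lP l\<psi>)
    moreover have "?I (\<lambda>x. \<eta> x * g0 x * \<psi> x) = ?I (\<lambda>x. g0 x * (\<eta> x * \<psi> x))" by (simp add: algebra_simps)
    ultimately show ?thesis unfolding j sum_subtractf iP[symmetric] L_eq[OF \<eta>\<psi>[OF \<psi>]] by linarith
  qed
  define a where "a x = C * \<bar>\<eta> x\<bar> * of_bool (w x = 0)" for x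
  have la: "l2 lebesgue a"
  proof (rule l2_bound(1)[OF l2_cmult[OF test_l2(1)[OF \<eta>], of C]])
    note [measurable] = l2_measurable[OF lw] test_measurable[OF \<eta>]
    show "a \<in> borel_measurable lebesgue" unfolding a_def by measurable
  qed (use C(3) in \<open>auto simp: a_def abs_mult\<close>)
  have Lb: "\<bar>L (\<lambda>x. \<eta> x * \<psi> x)\<bar> \<le> ?I (\<lambda>x. a x * \<bar>\<psi> x\<bar>)" if \<psi>: "\<psi> \<in> ?T" for \<psi>
  proof -
    have "C * (LINT x|M. \<bar>\<eta> x * \<psi> x\<bar> * of_bool (w x = 0)) = (LINT x|M. a x * \<bar>\<psi> x\<bar>)"
      by (simp add: a_def abs_mult algebra_simps flip: integral_mult_right_zero)
    also have "\<dots> = ?I (\<lambda>x. a x * \<bar>\<psi> x\<bar>)"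
      by (rule integral_lebesgue_on_eq[OF \<Omega>_sets]) (simp add: a_def test_zero_outside[OF test_mono[OF \<eta> D]])
    finally show ?thesis using L_bound[OF \<eta>\<psi>[OF \<psi>]] by simp
  qed
  have labs: "l2 lebesgue (\<lambda>x. \<bar>\<psi> x\<bar>)" if "\<psi> \<in> ?T" for \<psi> using test_l2(1)[OF that] by (auto simp: l2_def)
  define B where "B = sqrt (nsq lebesgue a) + sqrt (nsq lebesgue (\<lambda>x. \<eta> x * g0 x - P x))"
  have VB: "\<bar>\<Sum>j\<in>UNIV. ?I (\<lambda>x. V j x * partial_deriv j \<psi> x)\<bar> \<le> B * sqrt (nsq lebesgue \<psi>)" if \<psi>: "\<psi> \<in> ?T" for \<psi>
  proof -
    have "?I (\<lambda>x. a x * \<bar>\<psi> x\<bar>) \<le> sqrt (nsq lebesgue a) * sqrt (nsq lebesgue \<psi>)"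
      using cauchy_schwarz[OF la labs[OF \<psi>]] by (simp add: nsq_def)
    moreover have "\<bar>?I (\<lambda>x. (\<eta> x * g0 x - P x) * \<psi> x)\<bar> \<le> sqrt (nsq lebesgue (\<lambda>x. \<eta> x * g0 x - P x)) * sqrt (nsq lebesgue \<psi>)"
      by (rule cauchy_schwarz[OF lQ test_l2(1)[OF \<psi>]])
    ultimately show ?thesis unfolding key[OF \<psi>] B_def distrib_right using Lb[OF \<psi>] by linarith
  qed
  have "B \<ge> 0" by (simp add: B_def)
  \<comment> \<open>The Cauchy-Schwarz inequality has made the gradient form of \<eta> w bounded in
    the L2 norm of \<psi>, which is what the regularity argument requires.\<close>
  obtain F where F: "l2 lebesgue F" "AE x in lebesgue. \<eta> x * w x = 0 \<longrightarrow> F x = 0"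
    and FV: "\<And>\<psi>. \<psi> \<in> ?T \<Longrightarrow> (\<Sum>j\<in>UNIV. ?I (\<lambda>x. V j x * partial_deriv j \<psi> x)) = ?I (\<lambda>x. F x * \<psi> x)"
    by (rule laplacian_zero_on_level_set[OF sv \<open>B \<ge> 0\<close> VB]) blast+
  define Q where "Q x = F x - (\<eta> x * g0 x - P x)" for x
  have lQ': "l2 lebesgue Q" unfolding Q_def[abs_def] by (rule l2_diff[OF F(1) lQ])
  have LQ: "L (\<lambda>x. \<eta> x * \<psi> x) = ?I (\<lambda>x. Q x * \<psi> x)" if \<psi>: "\<psi> \<in> ?T" for \<psi>
  proof -
    have "?I (\<lambda>x. Q x * \<psi> x) = ?I (\<lambda>x. F x * \<psi> x) - ?I (\<lambda>x. (\<eta> x * g0 x - P x) * \<psi> x)"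
      unfolding Q_def left_diff_distrib[of "F _"]
      by (intro Bochner_Integration.integral_diff l2_mult_integrable F lQ test_l2(1)[OF \<psi>])
    then show ?thesis using key[OF \<psi>] FV[OF \<psi>] by simp
  qed
  \<comment> \<open>Two complementary facts meet: Q vanishes off {w = 0} by this bound, and on {w =
    0} because F, g0 and P all vanish there.\<close>
  have "AE x in lebesgue. \<bar>Q x\<bar> \<le> a x"
    by (rule fundamental_lemma_bound[OF lQ' la]) (use C(3) Lb LQ in \<open>auto simp: a_def\<close>)
  moreover have "AE x in lebesgue. \<forall>j. w x = 0 \<longrightarrow> W j x = 0"
    unfolding AE_all_countable using sobolev0_gradient_zero[OF sw] by blast
  ultimately have "AE x in lebesgue. Q x = 0"
    using F(2) AE_g0_zero
  proof eventually_elim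
    case (elim x)
    show ?case
    proof (cases "w x = 0")
      case True
      then have "P x = 0" using elim(2) by (simp add: P_def)
      then show ?thesis using True elim(3,4) by (simp add: Q_def)
    next
      case False
      then show ?thesis using elim(1) by (simp add: a_def)
    qed
  qed
  then have "AE x in lebesgue. Q x * \<psi> x = 0" for \<psi> by eventually_elim simp
  then have Q0: "?I (\<lambda>x. Q x * \<psi> x) = 0" for \<psi> by (rule integral_eq_zero_AE)
  obtain R where R: "R > 0" "\<And>x. norm x \<ge> R \<Longrightarrow> \<eta> x = 0" by (rule test_support_bounded[OF \<eta>]) blast
  \<comment> \<open>A cut-off equal to 1 on the support of \<eta> turns
    \<open>L (\<lambda>x. \<eta> x * \<psi> x)\<close> into \<open>L \<eta>\<close>.\<close>
  obtain \<psi> where \<psi>: "\<psi> \<in> ?T" "\<And>x. norm x \<le> R \<Longrightarrow> \<psi> x = 1" by (rule test_plateau[OF R(1)]) blast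
  have "(\<lambda>x. \<eta> x * \<psi> x) = \<eta>"
  proof
    fix x show "\<eta> x * \<psi> x = \<eta> x" using R(2)[of x] \<psi>(2)[of x] by (cases "norm x \<le> R") auto
  qed
  then show ?thesis using LQ[OF \<psi>(1)] Q0 by simp
qed

end

text \<open>Removing the closures leaves an open set on which every other component is at most 0 at
  each point, hence 0 almost everywhere, whichever representatives are taken. That suffices to make
  the variations of the pair admissible.\<close>

theorem theorem2p1:
  fixes \<Omega> :: "(real^'n) set"
    and m :: nat
    and k :: "nat \<Rightarrow> real"
    and f u :: "nat \<Rightarrow> real^'n \<Rightarrow> real"
  assumes dim: "CARD('n) \<ge> 2"
    and \<Omega>: "bounded_lipschitz_domain \<Omega>"
    and k: "\<forall>i\<in>{1..m}. 0 \<le> k i \<and> k i < k_star \<Omega>"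
    and f: "\<forall>i\<in>{1..m}. f i \<in> Linf_space \<Omega>"
    and u: "segregated_ground_state \<Omega> m k f u"
  shows "\<forall>i\<in>{1..m}. \<forall>j\<in>{1..m}. i \<noteq> j \<longrightarrow>
    (let D = \<Omega> - (\<Union>l\<in>{1..m} - {i, j}. closure (positivity_set (u l))) in
      \<forall>\<phi>\<in>test_functions D.
        distribution_laplacian (regular_distribution D (\<lambda>x. u i x - u j x)) \<phi>
          + regular_distribution D (\<lambda>x. (k i)\<^sup>2 * u i x - (k j)\<^sup>2 * u j x) \<phi>
        = regular_distribution D
            (\<lambda>x. - f i x * indicat_real (positivity_set (u i)) x
                 + f j x * indicat_real (positivity_set (u j)) x) \<phi>)"
proof (intro ballI impI, unfold Let_def, rule ballI)
  fix i j \<phi>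
  assume i: "i \<in> {1..m}" and j: "j \<in> {1..m}" and ij: "i \<noteq> j"
  define D where "D = \<Omega> - (\<Union>l\<in>{1..m} - {i, j}. closure (positivity_set (u l)))"
  assume "\<phi> \<in> test_functions (\<Omega> - (\<Union>l\<in>{1..m} - {i, j}. closure (positivity_set (u l))))"
  then have \<phi>: "\<phi> \<in> test_functions D" by (simp add: D_def)
  have op: "open \<Omega>" and bd: "bounded \<Omega>" using \<Omega> by (auto simp: bounded_lipschitz_domain_def)
  have \<Omega>s: "\<Omega> \<in> sets lebesgue" using op by simp
  have D\<Omega>: "D \<subseteq> \<Omega>" by (auto simp: D_def)
  have "closed (\<Union>l\<in>{1..m} - {i, j}. closure (positivity_set (u l)))" by (intro closed_UN) auto
  then have "open D" unfolding D_def by (rule open_Diff[OF op])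
  then have Ds: "D \<in> sets lebesgue" by simp
  have H: "u l \<in> H10_space \<Omega>" "AE x in lebesgue_on \<Omega>. u l x \<ge> 0" if "l \<in> {1..m}" for l
    using u that by (auto simp: segregated_ground_state_def segregated_states_def)
  have S: "AE x in lebesgue_on \<Omega>. u a x * u b x = 0" if "a \<in> {1..m}" "b \<in> {1..m}" "a \<noteq> b" for a b
    using u that by (auto simp: segregated_ground_state_def segregated_states_def)
  have z: "u l x = 0" if "l \<in> {1..m}" "x \<notin> \<Omega>" for l x
    using H(1)[OF that(1)] that(2) by (auto simp: H10_space_def)
  obtain Ci where Ci: "AE x in lebesgue_on \<Omega>. \<bar>f i x\<bar> \<le> Ci" using f i unfolding Linf_space_def by blast
  obtain Cj where Cj: "AE x in lebesgue_on \<Omega>. \<bar>f j x\<bar> \<le> Cj" using f j unfolding Linf_space_def by blast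
  define G where "G l a x = (if x \<in> \<Omega> then weak_grad \<Omega> (u l) x $ a else 0)" for l a x
  have min: "energy1 \<Omega> (k i) (f i) (u i) + energy1 \<Omega> (k j) (f j) (u j)
      \<le> energy1 \<Omega> (k i) (f i) v1 + energy1 \<Omega> (k j) (f j) v2"
    if \<theta>: "\<theta> \<in> test_functions D" and v: "v1 \<in> H10_space \<Omega>" "v2 \<in> H10_space \<Omega>"
      and v1: "\<And>x. v1 x = max (u i x - u j x + \<theta> x) 0"
      and v2: "\<And>x. v2 x = max (- (u i x - u j x + \<theta> x)) 0" for \<theta> v1 v2
  proof -
    define V where "V = u(i := v1, j := v2)"
    have V: "V i = v1" "V j = v2" "\<And>l. l \<noteq> i \<Longrightarrow> l \<noteq> j \<Longrightarrow> V l = u l" using ij by (auto simp: V_def)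
    \<comment> \<open>On D the unaltered component vanishes almost everywhere; off D the
      perturbation is 0, so v1 and v2 are the old components and the old segregation
      applies.\<close>
    have out: "AE x in lebesgue_on \<Omega>. v1 x * u l x = 0 \<and> v2 x * u l x = 0"
      if l: "l \<in> {1..m}" "l \<noteq> i" "l \<noteq> j" for l
      using H(2)[OF i] H(2)[OF j] H(2)[OF l(1)] S[OF i j ij] S[OF i l(1) l(2)[symmetric]] S[OF j l(1) l(3)[symmetric]]
        AE_space
    proof eventually_elim
      case (elim x)
      show ?case
      proof (cases "x \<in> D")
        case True
        then have "x \<notin> positivity_set (u l)"
          using l closure_subset[of "positivity_set (u l)"] by (auto simp: D_def)
        then have "u l x = 0" using elim(3) by (auto simp: positivity_set_def)
        then show ?thesis by simp
      next
        case False
        then have "\<theta> x = 0" by (rule test_zero_outside[OF \<theta>])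
        then show ?thesis using elim by (auto simp: v1 v2 max_def)
      qed
    qed
    have "V \<in> segregated_states \<Omega> m"
      unfolding segregated_states_def
    proof (intro CollectI conjI ballI impI)
      fix l assume l: "l \<in> {1..m}"
      show "V l \<in> H10_space \<Omega>" using H(1)[OF l] v V by (cases "l = i"; cases "l = j") auto
      show "AE x in lebesgue_on \<Omega>. V l x \<ge> 0"
        using H(2)[OF l] V by (cases "l = i"; cases "l = j") (auto simp: v1 v2)
    next
      fix a b assume ab: "a \<in> {1..m}" "b \<in> {1..m}" "a \<noteq> b"
      have 12: "v1 x * v2 x = 0" for x by (simp add: v1 v2 max_def)
      \<comment> \<open>Only a pair with one altered and one unaltered index needs
        \<open>out\<close>; the altered two are disjoint as positive and negative parts.\<close>
      consider "a = i" "b = j" | "a = j" "b = i" | "a = i" "b \<noteq> j" | "a = j" "b \<noteq> i" | "a \<noteq> i" "a \<noteq> j" "b = i"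
        | "a \<noteq> i" "a \<noteq> j" "b = j" | "a \<noteq> i" "a \<noteq> j" "b \<noteq> i" "b \<noteq> j" by blast
      then show "AE x in lebesgue_on \<Omega>. V a x * V b x = 0"
      proof cases
        case 3 then show ?thesis using out[of b] ab V by (auto elim: eventually_mono)
      next
        case 4 then show ?thesis using out[of b] ab V by (auto elim: eventually_mono)
      next
        case 5 then show ?thesis using out[of a] ab V by (auto elim: eventually_mono simp: mult.commute)
      next
        case 6 then show ?thesis using out[of a] ab V by (auto elim: eventually_mono simp: mult.commute)
      next
        case 7 then show ?thesis using S[OF ab] V by simp
      qed (use 12 V in \<open>simp_all add: mult.commute[of "v2 _"]\<close>)
    qed
    then have le: "energy \<Omega> m k f u \<le> energy \<Omega> m k f V"
      using u by (auto simp: segregated_ground_state_def)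
    have split: "energy \<Omega> m k f y = energy1 \<Omega> (k i) (f i) (y i) + energy1 \<Omega> (k j) (f j) (y j)
        + (\<Sum>l\<in>{1..m} - {i, j}. energy1 \<Omega> (k l) (f l) (y l))" for y
    proof -
      let ?e = "\<lambda>l. energy1 \<Omega> (k l) (f l) (y l)"
      have "sum ?e {1..m} = ?e i + sum ?e ({1..m} - {i})"
        using i by (intro sum.remove) auto
      moreover have "sum ?e ({1..m} - {i}) = ?e j + sum ?e ({1..m} - {i} - {j})"
        using j ij by (intro sum.remove) auto
      moreover have "{1..m} - {i} - {j} = {1..m} - {i, j}" by auto
      ultimately show ?thesis unfolding energy_def by (simp only: add.assoc)
    qed
    have "(\<Sum>l\<in>{1..m} - {i, j}. energy1 \<Omega> (k l) (f l) (V l)) = (\<Sum>l\<in>{1..m} - {i, j}. energy1 \<Omega> (k l) (f l) (u l))"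
      using V(3) by (intro sum.cong) auto
    then show ?thesis using le unfolding split V by simp
  qed
  \<comment> \<open>Absolute values make the common bound nonnegative, whatever sign the two
    essential bounds have.\<close>
  interpret ground_state_pair \<Omega> D "k i" "k j" "f i" "f j" "u i" "u j" "G i" "G j" "\<bar>Ci\<bar> + \<bar>Cj\<bar>"
  proof
    show "AE x in lebesgue_on \<Omega>. \<bar>f i x\<bar> \<le> \<bar>Ci\<bar> + \<bar>Cj\<bar>" using Ci by eventually_elim linarith
    show "AE x in lebesgue_on \<Omega>. \<bar>f j x\<bar> \<le> \<bar>Ci\<bar> + \<bar>Cj\<bar>" using Cj by eventually_elim linarith
    show "sobolev0 \<Omega> (u i) (G i)" "sobolev0 \<Omega> (u j) (G j)"
      unfolding G_def[abs_def] by (intro H10_space_sobolev0 op H i j)+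
    show "energy1 \<Omega> (k i) (f i) (u i) + energy1 \<Omega> (k j) (f j) (u j)
      \<le> energy1 \<Omega> (k i) (f i) v1 + energy1 \<Omega> (k j) (f j) v2"
      if "\<theta> \<in> test_functions D" "v1 \<in> H10_space \<Omega>" "v2 \<in> H10_space \<Omega>"
        "\<And>x. v1 x = max (u i x - u j x + \<theta> x) 0" "\<And>x. v2 x = max (- (u i x - u j x + \<theta> x)) 0" for \<theta> v1 v2
      by (rule min[OF that])
  qed (use op bd D\<Omega> f i j z H(2) S[OF i j ij] in simp_all)
  let ?\<chi> = "\<lambda>l. indicat_real (positivity_set (u l))"
  note \<phi>\<Omega> = test_mono[OF \<phi> D\<Omega>]
  \<comment> \<open>The theorem integrates over D and the locale over the whole domain; a test
    function supported in D does not see the difference.\<close>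
  have reg: "regular_distribution D y \<theta> = (LINT x|lebesgue_on \<Omega>. y x * \<theta> x)"
    if "\<theta> \<in> test_functions D" for y \<theta>
  proof -
    have "(LINT x|lebesgue_on D. y x * \<theta> x) = (LINT x|lebesgue. y x * \<theta> x)"
      by (rule integral_lebesgue_on_eq[OF Ds]) (simp add: test_zero_outside[OF that])
    moreover have "(LINT x|lebesgue_on \<Omega>. y x * \<theta> x) = (LINT x|lebesgue. y x * \<theta> x)"
      by (rule integral_lebesgue_on_eq[OF \<Omega>s]) (simp add: test_zero_outside[OF test_mono[OF that D\<Omega>]])
    ultimately show ?thesis by (simp add: regular_distribution_def)
  qed
  have lap: "laplacian \<phi> \<in> test_functions D"
  proof -
    have "(\<lambda>x. \<Sum>a\<in>A. partial_deriv a (partial_deriv a \<phi>) x) \<in> test_functions D" for A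
    proof (induction A rule: infinite_finite_induct)
      case (insert a A)
      then show ?case by (simp add: test_add[OF test_partial_deriv[OF test_partial_deriv[OF \<phi>]]])
    qed (simp_all add: test_zero)
    then show ?thesis unfolding laplacian_def[abs_def] .
  qed
  have "distribution_laplacian (regular_distribution D (\<lambda>x. u i x - u j x)) \<phi>
      = (LINT x|M. (\<Sum>a\<in>UNIV. w x * partial_deriv a (partial_deriv a \<phi>) x))"
    unfolding distribution_laplacian_def reg[OF lap] w_def laplacian_def sum_distrib_left ..
  also have "\<dots> = (\<Sum>a\<in>UNIV. (LINT x|M. w x * partial_deriv a (partial_deriv a \<phi>) x))"
    by (intro Bochner_Integration.integral_sum l2_mult_integrable l2_M l2_test[OF test_partial_deriv[OF test_partial_deriv[OF \<phi>]]])
  \<comment> \<open>One integration by parts, with the first derivatives of \<phi> as test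
    functions, leads to the gradient form occurring in L.\<close>
  also have "\<dots> = - (\<Sum>a\<in>UNIV. (LINT x|M. W a x * partial_deriv a \<phi> x))"
    using sobolev0_weak_pair[OF \<Omega>s sw] test_partial_deriv[OF \<phi>\<Omega>] by (simp add: weak_pair_def sum_negf)
  also have "\<dots> = - (LINT x|M. g x * \<phi> x)"
    using L_zero[OF \<phi>] by (simp add: L_def)
  also have "(\<lambda>x. g x * \<phi> x) = (\<lambda>x. ((k i)\<^sup>2 * u i x - (k j)\<^sup>2 * u j x) * \<phi> x
      - (- f i x * ?\<chi> i x + f j x * ?\<chi> j x) * \<phi> x)"
    by (auto simp: g_def positivity_set_def indicator_def algebra_simps)
  also have "integral\<^sup>L M \<dots> = (LINT x|M. ((k i)\<^sup>2 * u i x - (k j)\<^sup>2 * u j x) * \<phi> x)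
      - (LINT x|M. (- f i x * ?\<chi> i x + f j x * ?\<chi> j x) * \<phi> x)"
  proof (intro Bochner_Integration.integral_diff l2_mult_integrable l2_test[OF \<phi>] l2_diff l2_cmult l2_M)
    have "l2 M (\<lambda>x. f j x * of_bool (u j x > 0) - f i x * of_bool (u i x > 0))"
      by (intro l2_diff l2_of_bool l2_M l2_measurable[OF l2_M(1)] l2_measurable[OF l2_M(2)])
    also have "(\<lambda>x. f j x * of_bool (u j x > 0) - f i x * of_bool (u i x > 0)) = (\<lambda>x. - f i x * ?\<chi> i x + f j x * ?\<chi> j x)"
      by (auto simp: positivity_set_def indicator_def)
    finally show "l2 M (\<lambda>x. - f i x * ?\<chi> i x + f j x * ?\<chi> j x)" .
  qed
  finally show "distribution_laplacian (regular_distribution (\<Omega> - (\<Union>l\<in>{1..m} - {i, j}. closure (positivity_set (u l)))) (\<lambda>x. u i x - u j x)) \<phi>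
      + regular_distribution (\<Omega> - (\<Union>l\<in>{1..m} - {i, j}. closure (positivity_set (u l)))) (\<lambda>x. (k i)\<^sup>2 * u i x - (k j)\<^sup>2 * u j x) \<phi>
      = regular_distribution (\<Omega> - (\<Union>l\<in>{1..m} - {i, j}. closure (positivity_set (u l))))
          (\<lambda>x. - f i x * ?\<chi> i x + f j x * ?\<chi> j x) \<phi>"
    unfolding D_def[symmetric] reg[OF \<phi>] by simp
qed

end
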